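(* Let $k\in\mathbb N$ and $p_1,p_2,q\in[1,\infty)$. (i) Assume that $0<s_0<\widetilde{s_0}\le 1$ satisfy $$n\left(\frac{1-s_0}{p_1}+\frac{s_0}{p_2}-\frac1q\right)<s_0k\quad\text{and}\quad n\left(\frac{1-\widetilde{s_0}}{p_1}+\frac{\widetilde{s_0}}{p_2}-\frac1q\right)<\widetilde{s_0}k.$$ Then there exists a positive constant $C$, depending only on $n,k,p_1,p_2,q,s_0,\widetilde{s_0}$, such that, for any $s\in(s_0,\widetilde{s_0})$, any $f\in W^{k,1}_{\rm loc}$, and almost every $x\in\mathbb R^n$, $$\mathfrak D^{s,k}_q(f)(x)\le \frac{C}{[(s-s_0)(\widetilde{s_0}-s)]^{\frac1q}}\left[M^\sharp_{p_1}(f)(x)\right]^{1-s}\left[M_{p_2}(|\nabla^kf|)(x)\right]^s.$$ (ii) Assume that $p_1\ge q$ and $n(\frac1{p_2}-\frac1q)<k$. Then there exists a positive constant $C$, depending only on $n,k,p_1,p_2,q$, such that, for any $s\in(0,1)$, any $f\in W^{k,1}_{\rm loc}$, and almost every $x\in\mathbb R^n$, $$\mathfrak D^{s,k}_q(f)(x)\le \frac{C}{[s(1-s)]^{\frac1q}}\left[M_{p_1}(f-f(x))(x)\right]^{1-s}\left[M_{p_2}(|\nabla^kf|)(x)\right]^s.$$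
   Context: All functions are real-valued measurable functions on $\mathbb R^n$. $W^{k,1}_{\rm loc}$ is the set of all $f\in L^1_{\rm loc}$ with $f\in W^{k,1}(U)$ for every bounded open $U\subset\mathbb R^n$; $\nabla^kf$ is the collection of all weak partial derivatives of order $k$. For $k\in\mathbb N$ and $h\in\mathbb R^n$, $\Delta_h^kf(x):=\sum_{j=0}^k(-1)^{k-j}\binom kj f(x+jh)$. For $s\in(0,1)$ and $q\in[1,\infty)$, $$\mathfrak D^{s,k}_q(f)(x):=\left[\int_{\mathbb R^n}\frac{|\Delta_h^kf(x)|^q}{|h|^{n+skq}}\,dh\right]^{\frac1q}.$$ For $p\in[1,\infty)$, with suprema over all cubes $Q\subset\mathbb R^n$ and values in $[0,\infty]$, $$M_p(f)(x):=\sup_{Q\ni x}\left[\frac1{|Q|}\int_Q|f(y)|^p\,dy\right]^{\frac1p},\qquad M_p^\sharp(f)(x):=\sup_{Q\ni x}\left[\inf_{c\in\mathbb R}\frac1{|Q|}\int_Q|f(y)-c|^p\,dy\right]^{\frac1p}.$$ $M_{p_1}(f-f(x))(x)$ means $M_{p_1}$ applied to the function $y\mapsto f(y)-f(x)$ ($x$ fixed), evaluated at $x$. *)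

theory Defs
  imports "HOL-Analysis.Analysis"
begin

text \<open>Real powers of values in [0,\<open>\<infinity>\<close>]; only used with exponents \<open>a > 0\<close>, where
  \<open>0\<close> to the power \<open>a\<close> is \<open>0\<close> and \<open>\<infinity>\<close> to the power \<open>a\<close> is \<open>\<infinity>\<close>.\<close>

definition ennpow :: "ennreal \<Rightarrow> real \<Rightarrow> ennreal"  (infixr "powe" 80)
  where "x powe a = (if x = top then top else ennreal (enn2real x powr a))"


text \<open>Iterated classical partial derivatives. \<^term>\<open>partials is \<phi>\<close> differentiates
  once in each of the coordinate directions listed in \<^term>\<open>is\<close> (with repetition).\<close>

primrec partials :: "'n list \<Rightarrow> (real^'n \<Rightarrow> real) \<Rightarrow> (real^'n::finite \<Rightarrow> real)"
  where
    "partials [] \<phi> = \<phi>"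
  | "partials (i # is) \<phi> = (\<lambda>x. frechet_derivative (partials is \<phi>) (at x) (axis i 1))"

text \<open>Differentiability of every iterated partial derivative entails their continuity, so this
  is the usual class of infinitely differentiable functions.\<close>

definition smooth :: "(real^'n::finite \<Rightarrow> real) \<Rightarrow> bool"
  where "smooth \<phi> \<longleftrightarrow> (\<forall>is x. partials is \<phi> differentiable (at x))"

definition test_functions :: "(real^'n::finite) set \<Rightarrow> (real^'n \<Rightarrow> real) set"
  where "test_functions U =
    {\<phi>. smooth \<phi> \<and> (\<exists>K. compact K \<and> K \<subseteq> U \<and> (\<forall>x. x \<notin> K \<longrightarrow> \<phi> x = 0))}"


text \<open>Multi-indices are functions \<open>\<alpha> :: 'n \<Rightarrow> nat\<close> of order \<open>\<Sum>i\<in>UNIV. \<alpha> i\<close>. As the index type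
  carries no order, the classical derivative of a test function belonging to \<open>\<alpha>\<close> is written
  with an arbitrary list of directions that contains each \<open>i\<close> exactly \<open>\<alpha> i\<close> times; since mixed
  partial derivatives of smooth functions commute, all such lists give the same derivative.\<close>

definition has_weak_deriv ::
    "(real^'n::finite) set \<Rightarrow> ('n \<Rightarrow> nat) \<Rightarrow> (real^'n \<Rightarrow> real) \<Rightarrow> (real^'n \<Rightarrow> real) \<Rightarrow> bool"
  where "has_weak_deriv U \<alpha> f g \<longleftrightarrow>
    (\<forall>\<phi>\<in>test_functions U. \<forall>is. (\<forall>i. count_list is i = \<alpha> i) \<longrightarrow>
      (LINT x:U|lebesgue. f x * partials is \<phi> x)
        = (-1) ^ (\<Sum>i\<in>UNIV. \<alpha> i) * (LINT x:U|lebesgue. g x * \<phi> x))"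

definition L1_loc :: "(real^'n::finite \<Rightarrow> real) set"
  where "L1_loc = {f. \<forall>K. compact K \<longrightarrow> set_integrable lebesgue K f}"

text \<open>The Sobolev space \<open>W\<^sup>k\<^sup>,\<^sup>1(U)\<close> on an open set \<open>U\<close>.\<close>

definition Sobolev1 :: "nat \<Rightarrow> (real^'n::finite) set \<Rightarrow> (real^'n \<Rightarrow> real) set"
  where "Sobolev1 k U =
    {f. set_integrable lebesgue U f \<and>
        (\<forall>\<alpha>. (\<Sum>i\<in>UNIV. \<alpha> i) \<le> k \<longrightarrow>
          (\<exists>g. set_integrable lebesgue U g \<and> has_weak_deriv U \<alpha> f g))}"

definition Sobolev1_loc :: "nat \<Rightarrow> (real^'n::finite \<Rightarrow> real) set"
  where "Sobolev1_loc k =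
    {f \<in> L1_loc. \<forall>U. open U \<and> bounded U \<longrightarrow> f \<in> Sobolev1 k U}"

text \<open>A representative of the weak derivative on the whole space. It is determined up to null
  sets, and it exists for \<open>f\<close> in \<^term>\<open>Sobolev1_loc k\<close> and \<open>\<alpha>\<close> of order at most \<open>k\<close>: weak
  derivatives on an exhausting sequence of balls agree on overlaps.\<close>

definition weak_deriv ::
    "('n \<Rightarrow> nat) \<Rightarrow> (real^'n \<Rightarrow> real) \<Rightarrow> (real^'n::finite \<Rightarrow> real)"
  where "weak_deriv \<alpha> f = (SOME g. g \<in> L1_loc \<and> has_weak_deriv UNIV \<alpha> f g)"

text \<open>The function \<open>\<bar>\<nabla>\<^sup>k f\<bar>\<close>, with the Euclidean norm of the collection of all weak derivatives
  of order \<open>k\<close>.\<close>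

definition norm_nabla :: "nat \<Rightarrow> (real^'n \<Rightarrow> real) \<Rightarrow> (real^'n::finite \<Rightarrow> real)"
  where "norm_nabla k f x = sqrt (\<Sum>\<alpha> | (\<Sum>i\<in>UNIV. \<alpha> i) = k. (weak_deriv \<alpha> f x)\<^sup>2)"


definition fdiff :: "nat \<Rightarrow> real^'n \<Rightarrow> (real^'n \<Rightarrow> real) \<Rightarrow> (real^'n::finite \<Rightarrow> real)"
  where "fdiff k h f x =
    (\<Sum>j=0..k. (-1) ^ (k - j) * real (k choose j) * f (x + real j *\<^sub>R h))"

text \<open>The quotient has the value \<open>0\<close> at \<open>h = 0\<close>, which is irrelevant for the integral.\<close>

definition frakD :: "real \<Rightarrow> nat \<Rightarrow> real \<Rightarrow> (real^'n \<Rightarrow> real) \<Rightarrow> (real^'n::finite \<Rightarrow> ennreal)"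
  where "frakD s k q f x =
    (\<integral>\<^sup>+ h. ennreal (\<bar>fdiff k h f x\<bar> powr q
                  / norm h powr (real CARD('n) + s * real k * q)) \<partial>lebesgue) powe (1 / q)"


text \<open>Nondegenerate cubes with edges parallel to the coordinate axes. Taking them closed does not
  affect the maximal functions below.\<close>

definition cubes :: "(real^'n::finite) set set"
  where "cubes = {cbox a (a + (\<chi> i. l)) | a l. l > 0}"

definition avg_pow :: "real \<Rightarrow> (real^'n::finite) set \<Rightarrow> (real^'n \<Rightarrow> real) \<Rightarrow> ennreal"
  where "avg_pow p Q f =
    (\<integral>\<^sup>+ y\<in>Q. ennreal (\<bar>f y\<bar> powr p) \<partial>lebesgue) / emeasure lebesgue Q"

definition maxfun :: "real \<Rightarrow> (real^'n \<Rightarrow> real) \<Rightarrow> (real^'n::finite \<Rightarrow> ennreal)"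
  where "maxfun p f x = (SUP Q\<in>{Q\<in>cubes. x \<in> Q}. avg_pow p Q f powe (1 / p))"

definition sharp_maxfun :: "real \<Rightarrow> (real^'n \<Rightarrow> real) \<Rightarrow> (real^'n::finite \<Rightarrow> ennreal)"
  where "sharp_maxfun p f x =
    (SUP Q\<in>{Q\<in>cubes. x \<in> Q}. (INF c. avg_pow p Q (\<lambda>y. f y - c)) powe (1 / p))"

end

theory Submission
  imports Defs
begin

text \<open>Let \<open>F\<^sub>r\<close> be the mollification of \<open>f\<close> at scale \<open>r\<close> by a tensor product of one kernel \<open>a\<close> on the line,
  chosen such that \<open>2 a(2 x) - a(x)\<close> is the \<open>k\<close>-th derivative of a test function. Exchanging the factors of
  the kernel one coordinate at a time and integrating by parts, one bounds \<open>F\<^bsub>r/2\<^esub>(y) - F\<^sub>r(y)\<close> both by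
  the mean of \<open>\<bar>f - c\<bar>\<close> and by \<open>r\<^sup>k\<close> times the mean of \<open>\<bar>\<nabla>\<^sup>k f\<bar>\<close> over a cube of side \<open>r\<close> at \<open>y\<close>; the same two bounds
  hold for \<open>\<Delta>\<^sub>h\<^sup>k F\<^sub>r(x)\<close> with \<open>\<bar>h\<bar> \<le> r\<close>. No polynomial approximation and no Sobolev embedding is needed: \<open>f\<close> is
  almost everywhere the sum of \<open>F\<^sub>r\<close> and the differences at the scales \<open>r / 2\<^sup>i\<close>, each of which is at most the geometric
  mean of its two bounds with exponent \<open>\<theta>\<close>. The \<open>q\<close>-th power of the resulting local means is integrated in \<open>y\<close> by Tonelli's theorem
  and the crude bound \<open>(r / \<rho>)\<^sup>n\<close> for a mean at scale \<open>\<rho> = r / 2\<^sup>i\<close>; the hypothesis on the exponents says that the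
  series over \<open>i\<close> still converges. This gives
  \<open>\<integral>\<^bsub>\<bar>h\<bar> \<le> r\<^esub> \<bar>\<Delta>\<^sub>h\<^sup>k f(x)\<bar>\<^sup>q dh \<le> C r\<^sup>n (A\<^bsup>1-\<theta>\<^esup> (r\<^sup>k B)\<^bsup>\<theta>\<^esup>)\<^sup>q\<close>, where \<open>A\<close> and \<open>B\<close> are the two maximal functions at \<open>x\<close>. Summing over
  dyadic shells, with the larger exponent inside the ball of radius \<open>(A/B)\<^bsup>1/k\<^esup>\<close> and the smaller one outside, yields the
  theorem. In part (ii) the exponents are \<open>1\<close> and \<open>0\<close>, the latter being elementary because \<open>q \<le> p\<^sub>1\<close>.\<close>

section \<open>Smooth functions on the line\<close>

text \<open>The relation between \<open>a\<close> and \<open>b\<close> forces the moments of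
  \<open>a 0\<close> of orders 1 to k - 1 to vanish: a k-th derivative of a test function has no
  moments below order k, while 2 a(2 x) has 2^(-m) times the m-th moment of a(x). Mollification thus
  reproduces polynomials of degree below k, which does the work of polynomial approximation. The
  maximal functions see only cubes that contain x, whereas at y = x + j h small cubes at y are
  needed. Local means enter with exponent e q, where e = (1 - \<theta>)/p1 + \<theta>/p2, and
  Tonelli's theorem integrates just one power. The excess max(e q, 1) - 1 is paid by the crude
  bound, at the price of that power of 2^n per halving, against a gain of 2^(k \<theta> q); the
  balance is \<delta> > 0. The term j = 0 is f(x) itself, which averaging in h cannot improve; it is
  treated pointwise and asks for \<theta> > 0. The exceptional x are those where the mollifications
  do not converge to f(x), so they depend on f and the kernel only. The factor in s comes from two
  geometric series whose ratios tend to 1 as s approaches an end of its interval.\<close>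

definition deriv_chain :: "(nat \<Rightarrow> real \<Rightarrow> real) \<Rightarrow> bool"
  where "deriv_chain G \<longleftrightarrow> (\<forall>m x. (G m has_real_derivative G (Suc m) x) (at x))"

definition smooth1 :: "(real \<Rightarrow> real) \<Rightarrow> bool"
  where "smooth1 g \<longleftrightarrow> deriv_chain (\<lambda>m. (deriv ^^ m) g)"

text \<open>Links two encodings of smoothness: sequences of functions, on which scaling, differences
  and shifts act termwise, and iterated \<open>deriv\<close>. A termwise construction then has to be
  matched with a given function at index 0 only.\<close>

lemma deriv_chain_unique:
  assumes "deriv_chain G" shows "(deriv ^^ m) (G 0) = G m"
proof (induction m)
  case (Suc m)
  have "deriv (G m) x = G (Suc m) x" for x
    using assms unfolding deriv_chain_def by (blast intro: DERIV_imp_deriv)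
  then show ?case using Suc by auto
qed simp

lemma smooth1I: assumes "deriv_chain G" "G 0 = g" shows "smooth1 g"
  using assms deriv_chain_unique[OF assms(1)] by (simp add: smooth1_def)

lemma smooth1D: "smooth1 g \<Longrightarrow> deriv_chain (\<lambda>m. (deriv ^^ m) g)"
  by (simp add: smooth1_def)

lemma deriv_chain_DERIV: "deriv_chain G \<Longrightarrow> (G m has_real_derivative G (Suc m) x) (at x)"
  by (simp add: deriv_chain_def)

lemma deriv_chain_cont: "deriv_chain G \<Longrightarrow> continuous_on S (G m)"
  by (meson DERIV_isCont continuous_at_imp_continuous_on deriv_chain_DERIV)

lemma deriv_chain_scale:
  assumes "deriv_chain G"
  shows "deriv_chain (\<lambda>m x. c ^ m * G m (c * x + d))"
  unfolding deriv_chain_def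
proof (intro allI)
  fix m x
  have "((\<lambda>x. G m (c * x + d)) has_real_derivative G (Suc m) (c * x + d) * c) (at x)"
    by (rule DERIV_chain2[OF deriv_chain_DERIV[OF assms]]) (auto intro!: derivative_eq_intros)
  from DERIV_cmult[OF this, of "c ^ m"]
  show "((\<lambda>x. c ^ m * G m (c * x + d)) has_real_derivative c ^ Suc m * G (Suc m) (c * x + d)) (at x)"
    by (simp add: mult_ac)
qed

lemma deriv_chain_diff: "deriv_chain G \<Longrightarrow> deriv_chain H \<Longrightarrow> deriv_chain (\<lambda>m x. G m x - H m x)"
  unfolding deriv_chain_def by (intro allI DERIV_diff) auto

lemma deriv_chain_cmult: "deriv_chain G \<Longrightarrow> deriv_chain (\<lambda>m x. c * G m x)"
  unfolding deriv_chain_def by (intro allI DERIV_cmult) auto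

lemma deriv_chain_shift: "deriv_chain G \<Longrightarrow> deriv_chain (\<lambda>m. G (m + j))"
  unfolding deriv_chain_def by simp

text \<open>The induction is on the order of differentiability rather than through Leibniz' formula.\<close>

primrec ntimes_diff :: "nat \<Rightarrow> (real \<Rightarrow> real) \<Rightarrow> bool" where
  "ntimes_diff 0 g \<longleftrightarrow> True"
| "ntimes_diff (Suc m) g \<longleftrightarrow> (\<exists>g'. (\<forall>x. (g has_real_derivative g' x) (at x)) \<and> ntimes_diff m g')"

lemma ntimes_diff_Suc_imp: "ntimes_diff (Suc m) g \<Longrightarrow> ntimes_diff m g"
  by (induction m arbitrary: g) auto

lemma ntimes_diff_add: "ntimes_diff m g \<Longrightarrow> ntimes_diff m h \<Longrightarrow> ntimes_diff m (\<lambda>x. g x + h x)"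
proof (induction m arbitrary: g h)
  case (Suc m)
  then obtain g' h' where "\<forall>x. (g has_real_derivative g' x) (at x)" "ntimes_diff m g'"
      "\<forall>x. (h has_real_derivative h' x) (at x)" "ntimes_diff m h'"
    by auto
  then show ?case using Suc.IH[of g' h']
    by (auto intro!: exI[of _ "\<lambda>x. g' x + h' x"] DERIV_add)
qed simp

lemma ntimes_diff_mult: "ntimes_diff m g \<Longrightarrow> ntimes_diff m h \<Longrightarrow> ntimes_diff m (\<lambda>x. g x * h x)"
proof (induction m arbitrary: g h)
  case (Suc m)
  then obtain g' h' where d: "\<And>x. (g has_real_derivative g' x) (at x)" "ntimes_diff m g'"
      "\<And>x. (h has_real_derivative h' x) (at x)" "ntimes_diff m h'"
    by auto
  have "((\<lambda>x. g x * h x) has_real_derivative (g' x * h x + h' x * g x)) (at x)" for x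
    using DERIV_mult[OF d(1) d(3)] .
  moreover have "ntimes_diff m (\<lambda>x. g' x * h x + h' x * g x)"
    using Suc.prems[THEN ntimes_diff_Suc_imp] d by (intro ntimes_diff_add Suc.IH) auto
  ultimately show ?case unfolding ntimes_diff.simps by (intro exI[of _ "\<lambda>x. g' x * h x + h' x * g x"]) simp
qed simp

lemma ntimes_diff_iff_deriv:
  "ntimes_diff (Suc m) g \<longleftrightarrow> (\<forall>x. (g has_real_derivative deriv g x) (at x)) \<and> ntimes_diff m (deriv g)"
proof
  assume "ntimes_diff (Suc m) g"
  then obtain g' where g': "\<forall>x. (g has_real_derivative g' x) (at x)" "ntimes_diff m g'" by auto
  then have "deriv g x = g' x" for x by (blast intro: DERIV_imp_deriv)
  then have "deriv g = g'" by blast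
  then show "(\<forall>x. (g has_real_derivative deriv g x) (at x)) \<and> ntimes_diff m (deriv g)" using g' by simp
qed auto

lemma smooth1_iff_ntimes_diff: "smooth1 g \<longleftrightarrow> (\<forall>m. ntimes_diff m g)"
proof
  assume "smooth1 g"
  note d = deriv_chain_DERIV[OF smooth1D[OF this]]
  have "ntimes_diff m ((deriv ^^ j) g)" for m j
  proof (induction m arbitrary: j)
    case (Suc m)
    show ?case using d[of j] Suc[of "Suc j"] by auto
  qed simp
  from this[of _ 0] show "\<forall>m. ntimes_diff m g" by simp
next
  assume *: "\<forall>m. ntimes_diff m g"
  have all: "\<forall>m. ntimes_diff m ((deriv ^^ j) g)" for j
  proof (induction j)
    case (Suc j)
    show ?case
    proof
      fix m show "ntimes_diff m ((deriv ^^ Suc j) g)"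
        using Suc[rule_format, of "Suc m"] unfolding ntimes_diff_iff_deriv by simp
    qed
  qed (use * in simp)
  show "smooth1 g"
    unfolding smooth1_def deriv_chain_def
  proof (intro allI)
    fix m x show "((deriv ^^ m) g has_real_derivative (deriv ^^ Suc m) g x) (at x)"
      using all[of m, rule_format, of "Suc 0"] unfolding ntimes_diff_iff_deriv by simp
  qed
qed

lemma smooth1_mult: "smooth1 g \<Longrightarrow> smooth1 h \<Longrightarrow> smooth1 (\<lambda>x. g x * h x)"
  unfolding smooth1_iff_ntimes_diff by (blast intro: ntimes_diff_mult)

lemma smooth1_diff: "smooth1 g \<Longrightarrow> smooth1 h \<Longrightarrow> smooth1 (\<lambda>x. g x - h x)"
  using smooth1I[OF deriv_chain_diff[OF smooth1D smooth1D], of g h "\<lambda>x. g x - h x"] by simp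

lemma smooth1_scale: "smooth1 g \<Longrightarrow> smooth1 (\<lambda>x. g (c * x + d))"
  using smooth1I[OF deriv_chain_scale[OF smooth1D], of g c d "\<lambda>x. g (c * x + d)"] by simp

lemma smooth1_cmult: "smooth1 g \<Longrightarrow> smooth1 (\<lambda>x. c * g x)"
  using smooth1I[OF deriv_chain_cmult[OF smooth1D], of g c "\<lambda>x. c * g x"] by simp

lemma smooth1_const: "smooth1 (\<lambda>x. c)"
proof (rule smooth1I[of "\<lambda>m x. if m = 0 then c else 0"])
  show "deriv_chain (\<lambda>m x. if m = 0 then c else 0)"
    by (auto simp: deriv_chain_def)
qed simp

lemma smooth1_id: "smooth1 (\<lambda>x. x)"
proof (rule smooth1I[of "\<lambda>m x. if m = 0 then x else if m = 1 then 1 else 0"])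
  show "deriv_chain (\<lambda>m x. if m = 0 then x else if m = 1 then 1 else 0)"
    unfolding deriv_chain_def
  proof (intro allI)
    fix m :: nat and x :: real
    show "((\<lambda>x. if m = 0 then x else if m = 1 then 1 else 0) has_real_derivative
       (if Suc m = 0 then x else if Suc m = 1 then 1 else 0)) (at x)"
      by (cases "m = 0") simp_all
  qed
qed simp

lemma smooth1_power: "smooth1 (\<lambda>x. x ^ m)"
proof (induction m)
  case 0
  show ?case using smooth1_const[of 1] by simp
next
  case (Suc m)
  show ?case using smooth1_mult[OF smooth1_id Suc] by simp
qed

lemma smooth1_antideriv:
  assumes "smooth1 g" "\<And>x. (G has_real_derivative g x) (at x)"
  shows "smooth1 G"
proof -
  have "ntimes_diff m G" for m
  proof (cases m)
    case (Suc j)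
    have "ntimes_diff j g" using assms(1) unfolding smooth1_iff_ntimes_diff by blast
    then show ?thesis unfolding Suc using assms(2) by auto
  qed simp
  then show ?thesis unfolding smooth1_iff_ntimes_diff by blast
qed

lemma higher_deriv_eq_on_open:
  assumes "open S" "\<And>x. x \<in> S \<Longrightarrow> g x = h x" "x \<in> S"
  shows "(deriv ^^ m) g x = (deriv ^^ m) h x"
  using assms(3)
proof (induction m arbitrary: x)
  case (Suc m)
  have "eventually (\<lambda>x. (deriv ^^ m) g x = (deriv ^^ m) h x) (nhds x)"
    using Suc eventually_nhds assms(1) by blast
  then show ?case by (auto intro: deriv_cong_ev)
qed (use assms in auto)

lemma higher_deriv_power:
  "j \<le> p \<Longrightarrow> (deriv ^^ j) (\<lambda>x::real. x ^ p) = (\<lambda>x. fact p / fact (p - j) * x ^ (p - j))"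
proof (induction j)
  case (Suc j)
  obtain i where i: "p - j = Suc i" using Suc.prems by (metis Suc_diff_Suc Suc_le_lessD)
  then have i': "p - Suc j = i" by simp
  have "((\<lambda>x::real. fact p / fact (Suc i) * x ^ Suc i) has_real_derivative
       fact p / fact (Suc i) * (real (Suc i) * x ^ i)) (at x)" for x
    by (rule DERIV_cmult) (use DERIV_pow[of "Suc i" x] in simp)
  moreover have "fact p / fact (Suc i) * (real (Suc i) * x ^ i) = fact p / fact i * x ^ i" for x :: real
    using fact_nonzero[of i, where 'a=real] by (simp add: divide_simps del: of_nat_Suc)
  ultimately have "deriv (\<lambda>x::real. fact p / fact (Suc i) * x ^ Suc i) = (\<lambda>x. fact p / fact i * x ^ i)"
    by (metis (no_types, lifting) DERIV_imp_deriv ext)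
  then show ?case using Suc i i' by simp
qed simp


section \<open>A flat exponential, a smooth step and the profiles \<open>a\<close> and
  \<open>b\<close>\<close>

definition flat_exp :: "real poly \<Rightarrow> real \<Rightarrow> real"
  where "flat_exp p x = (if x > 0 then poly p (1 / x) * exp (- (1 / x)) else 0)"

lemma flat_exp_tendsto: "((\<lambda>h. poly p (1 / h) * exp (- (1 / h))) \<longlongrightarrow> 0) (at_right (0::real))"
proof -
  have "((\<lambda>t. \<Sum>i\<le>degree p. coeff p i * (t ^ i / exp t)) \<longlongrightarrow> (\<Sum>i\<le>degree p. coeff p i * 0)) at_top"
    by (intro tendsto_sum tendsto_mult tendsto_const tendsto_power_div_exp_0)
  then have "((\<lambda>t. poly p t * exp (- t)) \<longlongrightarrow> 0) at_top"
    by (simp add: poly_altdef sum_distrib_right exp_minus divide_inverse mult.assoc)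
  from filterlim_compose[OF this filterlim_inverse_at_top_right] show ?thesis
    by (simp add: inverse_eq_divide)
qed

text \<open>With t = 1/x and dt/dx = -t^2 the derivative of p(t) exp(-t) is t^2 (p - p')(t) exp(-t).
  Admitting all polynomials closes the family under differentiation, so that smoothness of exp(-1/x)
  follows without formulas for its higher derivatives.\<close>

lemma flat_exp_DERIV:
  "(flat_exp p has_real_derivative flat_exp ([:0, 0, 1:] * (p - pderiv p)) x) (at x)"
proof -
  consider "x < 0" | "x = 0" | "x > 0" by linarith
  then show ?thesis
  proof cases
    case 1
    have "((\<lambda>x. 0) has_real_derivative 0) (at x)" by simp
    then have "(flat_exp p has_real_derivative 0) (at x)"
      by (rule has_field_derivative_transform_within_open[where S = "{..<0}"])
        (use 1 in \<open>auto simp: flat_exp_def\<close>)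
    then show ?thesis using 1 by (simp add: flat_exp_def)
  next
    case 3
    have i: "((\<lambda>x. 1 / x) has_real_derivative (- 1 / x ^ 2)) (at x)"
      using 3 by (auto intro!: derivative_eq_intros simp: power2_eq_square)
    have "((\<lambda>x. - (1 / x)) has_real_derivative - (- 1 / x ^ 2)) (at x)"
      by (rule DERIV_minus[OF i])
    from DERIV_mult[OF DERIV_chain2[OF poly_DERIV i] DERIV_chain2[OF DERIV_exp this], of p]
    have "((\<lambda>x. poly p (1 / x) * exp (- (1 / x))) has_real_derivative
        (poly (pderiv p) (1 / x) * (- 1 / x ^ 2)) * exp (- (1 / x))
        + (exp (- (1 / x)) * (1 / x ^ 2)) * poly p (1 / x)) (at x)"
      by simp
    then have "(flat_exp p has_real_derivative
        (poly (pderiv p) (1 / x) * (- 1 / x ^ 2)) * exp (- (1 / x))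
        + (exp (- (1 / x)) * (1 / x ^ 2)) * poly p (1 / x)) (at x)"
      by (rule has_field_derivative_transform_within_open[where S = "{0<..}"])
        (use 3 in \<open>auto simp: flat_exp_def\<close>)
    moreover have "(poly (pderiv p) (1 / x) * (- 1 / x ^ 2)) * exp (- (1 / x))
        + (exp (- (1 / x)) * (1 / x ^ 2)) * poly p (1 / x) = flat_exp ([:0, 0, 1:] * (p - pderiv p)) x"
      using 3 by (simp add: flat_exp_def field_simps power2_eq_square)
    ultimately show ?thesis by simp
  next
    case 2
    \<comment> \<open>At the junction the left quotient is zero. On the right, division by h is
      multiplication by t = 1/h, that is, by the polynomial \<open>[:0, 1:]\<close>, so
      \<open>flat_exp_tendsto\<close> applies again.\<close>
    have "((\<lambda>h. (flat_exp p h - flat_exp p 0) / h) \<longlongrightarrow> 0) (at 0)"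
    proof (rule filterlim_split_at)
      show "((\<lambda>h. (flat_exp p h - flat_exp p 0) / h) \<longlongrightarrow> 0) (at_left 0)"
        by (rule tendsto_eventually) (auto simp: flat_exp_def eventually_at_filter)
      have "\<forall>\<^sub>F h in at_right 0. poly ([:0, 1:] * p) (1 / h) * exp (- (1 / h)) = (flat_exp p h - flat_exp p 0) / h"
        by (auto simp: flat_exp_def eventually_at_filter)
      from Lim_transform_eventually[OF flat_exp_tendsto this]
      show "((\<lambda>h. (flat_exp p h - flat_exp p 0) / h) \<longlongrightarrow> 0) (at_right 0)" .
    qed
    then show ?thesis using 2 by (simp add: has_field_derivative_iff flat_exp_def)
  qed
qed

lemma smooth1_flat_exp: "smooth1 (flat_exp p)"
proof (rule smooth1I)
  show "deriv_chain (\<lambda>m. flat_exp (((\<lambda>p. [:0, 0, 1:] * (p - pderiv p)) ^^ m) p))"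
    unfolding deriv_chain_def by (auto simp del: mult_pCons_left intro: flat_exp_DERIV)
qed simp

text \<open>\<open>N\<close> is the normalised antiderivative of \<open>e\<close>, the product of a
  flat function at 0 with its mirror image at 1; \<open>e\<close> is positive inside (0, 1) and zero
  elsewhere.\<close>

lemma smooth_step_exists:
  obtains N where "smooth1 N" "\<And>x. x \<le> 0 \<Longrightarrow> N x = 0" "\<And>x. x \<ge> 1 \<Longrightarrow> N x = 1"
proof -
  define e where "e x = flat_exp 1 x * flat_exp 1 (1 - x)" for x
  have e: "smooth1 e"
    unfolding e_def using smooth1_mult[OF smooth1_flat_exp smooth1_scale[OF smooth1_flat_exp, of _ "-1" 1]]
    by simp
  have "continuous_on UNIV e"
    using deriv_chain_cont[OF smooth1D[OF e], of UNIV 0] by simp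
  then have "isCont e x" for x by (simp add: continuous_on_eq_continuous_at)
  then obtain W where "\<forall>x. (W has_vector_derivative e x) (at x)"
    using einterval_antiderivative[of "-\<infinity>" \<infinity> e] by auto
  then have W: "(W has_real_derivative e x) (at x)" for x
    by (simp add: has_real_derivative_iff_has_vector_derivative)
  have contW: "continuous_on S W" for S
    by (meson DERIV_isCont W continuous_at_imp_continuous_on)
  have e0: "e x = 0" if "x \<le> 0 \<or> x \<ge> 1" for x
    using that by (auto simp: e_def flat_exp_def)
  have W0: "W x = W 0" if "x \<le> 0" for x
  proof (cases "x = 0")
    case False
    then have "x < 0" using that by simp
    then show ?thesis
      using DERIV_isconst_end[of x 0 W, OF _ contW] W e0 by (metis less_eq_real_def)
  qed simp
  have W1: "W x = W 1" if "x \<ge> 1" for x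
  proof (cases "x = 1")
    case False
    then have "1 < x" using that by simp
    then show ?thesis
      using DERIV_isconst_end[of 1 x W, OF _ contW] W e0 by (metis less_eq_real_def)
  qed simp
  have "W 0 < W 1"
  proof (rule DERIV_pos_imp_increasing_open[OF _ _ contW])
    fix x :: real assume "0 < x" "x < 1"
    then have "e x > 0" by (simp add: e_def flat_exp_def)
    then show "\<exists>y. (W has_real_derivative y) (at x) \<and> 0 < y" using W by blast
  qed simp
  define N where "N x = (1 / (W 1 - W 0)) * (W x - W 0)" for x
  have "smooth1 N"
    unfolding N_def
    by (intro smooth1_cmult smooth1_diff smooth1_const smooth1_antideriv[OF e W])
  show ?thesis
  proof (rule that[OF \<open>smooth1 N\<close>])
    show "N x = 0" if "x \<le> 0" for x using W0[OF that] by (simp add: N_def)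
    show "N x = 1" if "x \<ge> 1" for x using W1[OF that] \<open>W 0 < W 1\<close> by (simp add: N_def)
  qed
qed

definition bump_chain :: "(nat \<Rightarrow> real \<Rightarrow> real) \<Rightarrow> bool"
  where "bump_chain U \<longleftrightarrow> deriv_chain U \<and> (\<forall>m x. x \<notin> {0..1} \<longrightarrow> U m x = 0)"

lemma deriv_chain_zero_on_open:
  assumes "deriv_chain U" "open S" "\<And>x. x \<in> S \<Longrightarrow> U 0 x = 0" "x \<in> S"
  shows "U m x = 0"
proof -
  have "(deriv ^^ j) (\<lambda>x::real. 0::real) = (\<lambda>x. 0)" for j by (induction j) auto
  moreover have "(deriv ^^ m) (U 0) x = (deriv ^^ m) (\<lambda>x. 0) x"
    by (rule higher_deriv_eq_on_open[OF assms(2) _ assms(4)]) (use assms(3) in auto)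
  ultimately show ?thesis using deriv_chain_unique[OF assms(1), of m] by simp
qed

text \<open>The complement of [0, 1] is open, and there all derivatives of a vanishing function
  vanish; only the function itself has to be inspected.\<close>

lemma bump_chainI:
  assumes "deriv_chain U" "\<And>x. x < 0 \<Longrightarrow> U 0 x = 0" "\<And>x. x > 1 \<Longrightarrow> U 0 x = 0"
  shows "bump_chain U"
  unfolding bump_chain_def
proof (intro conjI allI impI)
  fix m and x :: real assume "x \<notin> {0..1}"
  then have "x \<in> {..<0} \<union> {1<..}" by auto
  then show "U m x = 0"
    by (rule deriv_chain_zero_on_open[OF assms(1), of "{..<0} \<union> {1<..}", rotated 2]) (use assms in auto)
qed (fact assms(1))

lemma bump_chain_bounded:
  assumes "bump_chain U" shows "\<exists>M. \<forall>x. \<bar>U m x\<bar> \<le> M"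
proof -
  have "compact (U m ` {0..1})"
    using assms by (intro compact_continuous_image deriv_chain_cont) (auto simp: bump_chain_def)
  then obtain M where "\<And>x. x \<in> {0..1} \<Longrightarrow> \<bar>U m x\<bar> \<le> M"
    by (meson bounded_real compact_imp_bounded image_eqI)
  then have "\<bar>U m x\<bar> \<le> max M 0" for x
    using assms by (cases "x \<in> {0..1}") (fastforce simp: bump_chain_def)+
  then show ?thesis by blast
qed

text \<open>With a smooth step function \<open>N\<close> from \<open>0\<close> to \<open>1\<close> one takes \<open>a = D\<^sup>k (x\<^bsup>k-1\<^esup> N(x)) / (k-1)!\<close> and
  \<open>b = x\<^bsup>k-1\<^esup> (N(2 x) - N(x)) / (k-1)!\<close>: since \<open>N\<close> is constant on either side of \<open>[0, 1]\<close>, both vanish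
  outside that interval.\<close>

lemma mollifier_exists:
  assumes "k \<ge> 1"
  obtains a b where "bump_chain a" "bump_chain b" "\<And>x. b k x = 2 * a 0 (2 * x) - a 0 x"
    "integrable lborel (a 0)" "(LINT x|lborel. a 0 x) = 1"
proof -
  obtain N where N: "smooth1 N" "\<And>x. x \<le> 0 \<Longrightarrow> N x = 0" "\<And>x. x \<ge> 1 \<Longrightarrow> N x = 1"
    using smooth_step_exists by metis
  define p where "p = k - 1"
  have k: "k = Suc p" using assms by (simp add: p_def)
  define G where "G x = x ^ p * N x" for x
  have "smooth1 G"
    unfolding G_def by (intro smooth1_mult smooth1_power N)
  define D where "D m = (deriv ^^ m) G" for m
  have D: "deriv_chain D" "D 0 = G"
    using smooth1D[OF \<open>smooth1 G\<close>] by (simp_all add: D_def[abs_def])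
  have D_neg: "D m x = 0" if "x < 0" for m x
    by (rule deriv_chain_zero_on_open[OF D(1), of "{..<0}"]) (use that N(2) D(2) in \<open>auto simp: G_def\<close>)
  \<comment> \<open>Right of 1 the step equals 1 and \<open>G\<close> is a monomial, whose p-th
    derivative is the constant p!. Hence \<open>a\<close> vanishes there, and its integral is p! /
    p! = 1.\<close>
  have D_p: "D p x = fact p" if "x > 1" for x
  proof -
    have "D p x = (deriv ^^ p) (\<lambda>x. x ^ p) x"
      unfolding D_def by (rule higher_deriv_eq_on_open[of "{1<..}"]) (use that N(3) in \<open>auto simp: G_def\<close>)
    then show ?thesis by (simp add: higher_deriv_power)
  qed
  have D_Suc_p: "D (Suc p) x = 0" if "x > 1" for x
  proof -
    have "((\<lambda>x. fact p) has_real_derivative 0) (at x)" by simp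
    then have "(D p has_real_derivative 0) (at x)"
      by (rule has_field_derivative_transform_within_open[of _ _ _ "{1<..}"]) (use that D_p in auto)
    then show ?thesis using deriv_chain_DERIV[OF D(1)] DERIV_unique by blast
  qed
  define a where "a m x = 1 / fact p * D (m + k) x" for m x
  \<comment> \<open>The factor \<open>(1 / 2) ^ p\<close> turns G(2 x) into x^p N(2 x), so that the
    monomials cancel beyond 1; after k = p + 1 derivatives the chain rule factor 2^k leaves exactly
    2 in front of a(2 x).\<close>
  define b where "b m x = 1 / fact p * ((1 / 2) ^ p * (2 ^ m * D m (2 * x + 0)) - D m x)" for m x
  have a: "bump_chain a"
  proof (rule bump_chainI)
    show "deriv_chain a"
      unfolding a_def by (intro deriv_chain_cmult deriv_chain_shift D)
  qed (use D_neg D_Suc_p in \<open>auto simp: a_def k\<close>)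
  have b: "bump_chain b"
  proof (rule bump_chainI)
    show "deriv_chain b"
      unfolding b_def by (intro deriv_chain_cmult deriv_chain_diff deriv_chain_scale D)
    show "b 0 x = 0" if "x > 1" for x
      using that N(3) by (simp add: b_def D(2) G_def power_mult_distrib power_one_over)
  qed (use N(2) in \<open>auto simp: b_def D(2) G_def\<close>)
  have "b k x = 2 * a 0 (2 * x) - a 0 x" for x
    by (simp add: a_def b_def k field_simps power_one_over)
  \<comment> \<open>The interval is larger than [0, 1] because the values of \<open>D p\<close> have
    been determined strictly outside [0, 1].\<close>
  moreover have hb: "has_bochner_integral lborel (\<lambda>x. a 0 x * indicator {-1..2} x) (1 / fact p * D p 2 - 1 / fact p * D p (-1))"
  proof (rule has_bochner_integral_FTC_Icc_real)
    show "((\<lambda>x. 1 / fact p * D p x) has_real_derivative a 0 x) (at x)" for x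
      unfolding a_def k using DERIV_cmult[OF deriv_chain_DERIV[OF D(1)], of "1 / fact p" p x] by simp
    show "isCont (a 0) x" for x
      using a DERIV_isCont deriv_chain_DERIV unfolding bump_chain_def by blast
  qed simp
  moreover have "(\<lambda>x. a 0 x * indicator {-1..2} x) = a 0"
  proof
    fix x
    show "a 0 x * indicator {-1..2} x = a 0 x"
      using a by (cases "x \<in> {0..1}") (auto simp: bump_chain_def indicator_def)
  qed
  ultimately show ?thesis
    using that[OF a b] D_p[of 2] D_neg[of "-1" p] by (auto simp: has_bochner_integral_iff)
qed

section \<open>Tensor product kernels\<close>

text \<open>\<open>lborel\<close> is by definition the image of a product of one-dimensional
  measures under summation over the basis, so the integral factorises on that product.\<close>

lemma tensor_integral:
  fixes h :: "'a::euclidean_space \<Rightarrow> real \<Rightarrow> real"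
  assumes "\<And>b. b \<in> Basis \<Longrightarrow> integrable lborel (h b)"
  shows "(LINT x|lborel. (\<Prod>b\<in>Basis. h b (x \<bullet> b))) = (\<Prod>b\<in>Basis. LINT t|lborel. h b t)"
proof -
  have [measurable]: "h b \<in> borel_measurable borel" if "b \<in> Basis" for b
    using assms[OF that] by simp
  interpret product_sigma_finite "\<lambda>_::'a. interval_measure (\<lambda>x. x)"
    by (simp add: product_sigma_finite_def lborel.sigma_finite_measure_axioms flip: lborel_eq_real)
  have "(LINT x|lborel. (\<Prod>b\<in>Basis. h b (x \<bullet> b)))
      = (LINT x|(\<Pi>\<^sub>M b\<in>(Basis::'a set). interval_measure (\<lambda>x. x)). (\<Prod>b\<in>Basis. h b (x b)))"
    unfolding lborel_def by (subst integral_distr) simp_all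
  also have "\<dots> = (\<Prod>b\<in>Basis. LINT t|lborel. h b t)"
    using assms by (subst product_integral_prod) (simp_all add: lborel_eq_real)
  finally show ?thesis .
qed

lemma prod_Basis_vec: "(\<Prod>b\<in>(Basis :: (real^'n::finite) set). F b) = (\<Prod>i\<in>UNIV. F (axis i 1))"
proof -
  have B: "Basis = (\<lambda>i. axis i (1::real)) ` (UNIV :: 'n set)"
    by (auto simp: Basis_vec_def)
  have "inj (\<lambda>i::'n. axis i (1::real))"
    by (auto simp: inj_def axis_eq_axis)
  then show ?thesis unfolding B by (subst prod.reindex) (simp_all add: o_def)
qed

text \<open>The point \<open>y\<close> is a corner rather than a centre because the profiles live on
  [0, 1]. The normalising factor r^(-n) is left out, and each coordinate has its own profile, so
  that differentiating or exchanging a single factor stays within the family.\<close>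

definition tker :: "('n::finite \<Rightarrow> real \<Rightarrow> real) \<Rightarrow> real^'n \<Rightarrow> real \<Rightarrow> real^'n \<Rightarrow> real"
  where "tker u y r w = (\<Prod>i\<in>UNIV. u i ((w $ i - y $ i) / r))"

abbreviation corner_cube :: "real^'n::finite \<Rightarrow> real \<Rightarrow> (real^'n) set"
  where "corner_cube y r \<equiv> cbox y (y + (\<chi> i. r))"

lemma tker_outside:
  assumes "\<And>i x. x \<notin> {0..1} \<Longrightarrow> u i x = 0" "r > 0" "w \<notin> corner_cube y r"
  shows "tker u y r w = 0"
proof -
  obtain i where "w $ i < y $ i \<or> w $ i > y $ i + r"
    using assms(3) by (auto simp: mem_box_cart not_le)
  then have "(w $ i - y $ i) / r \<notin> {0..1}"
    using assms(2) by (auto simp: field_simps)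
  then show ?thesis using assms(1) by (auto simp: tker_def intro!: prod_zero)
qed

lemma tker_bound:
  assumes "\<And>i x. \<bar>u i x\<bar> \<le> M"
  shows "\<bar>tker u y (r::real) (w :: real^'n::finite)\<bar> \<le> M ^ CARD('n)"
proof -
  have "\<bar>tker u y r w\<bar> \<le> (\<Prod>i\<in>(UNIV::'n set). M)"
    unfolding tker_def abs_prod by (intro prod_mono) (use assms in auto)
  then show ?thesis by simp
qed

lemma tker_cont:
  assumes "\<And>i. continuous_on UNIV (u i)"
  shows "continuous_on UNIV (tker u y r)"
  unfolding tker_def divide_inverse
  by (intro continuous_on_prod continuous_on_compose2[OF assms]) (auto intro!: continuous_intros)

lemma tker_integral:
  fixes y :: "real^'n::finite"
  assumes a: "integrable lborel a" and "r > 0"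
  shows "(LINT w|lebesgue. tker (\<lambda>_. a) y r w) = (r * (LINT x|lborel. a x)) ^ CARD('n)"
proof -
  have aff: "(\<lambda>t. a ((t - c) / r)) = (\<lambda>t. a (- c / r + 1 / r * t))" for c
    by (simp add: diff_divide_distrib)
  have int: "integrable lborel (\<lambda>t. a ((t - c) / r))" for c
    unfolding aff using assms(2) by (intro lborel_integrable_real_affine[OF a]) simp
  have val: "(LINT t|lborel. a ((t - c) / r)) = r * (LINT x|lborel. a x)" for c
    unfolding aff using lborel_integral_real_affine[of "1 / r" a "- c / r"] assms(2) by simp
  have "(LINT w|lebesgue. tker (\<lambda>_. a) y r w) = (LINT w|lborel. tker (\<lambda>_. a) y r w)"
    using a unfolding tker_def by (intro integral_completion) simp
  also have "\<dots> = (LINT w|lborel. (\<Prod>b\<in>Basis. a ((w \<bullet> b - y \<bullet> b) / r)))"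
    by (simp add: prod_Basis_vec tker_def inner_axis)
  also have "\<dots> = (\<Prod>b\<in>(Basis :: (real^'n) set). LINT t|lborel. a ((t - y \<bullet> b) / r))"
    using tensor_integral[of "\<lambda>b t. a ((t - y \<bullet> b) / r)"] int by simp
  finally show ?thesis by (simp add: val)
qed

text \<open>A derivative in direction l raises the order of the l-th factor only. The result
  therefore depends on the list through its counts alone, which is how \<open>has_weak_deriv\<close>
  encodes multi-indices.\<close>

lemma partials_tensor:
  fixes u :: "'n::finite \<Rightarrow> nat \<Rightarrow> real \<Rightarrow> real"
  assumes "\<And>i. deriv_chain (u i)"
  shows "partials is (\<lambda>x. \<Prod>i\<in>UNIV. u i 0 (x $ i)) = (\<lambda>x. \<Prod>i\<in>UNIV. u i (count_list is i) (x $ i))"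
    and "partials is (\<lambda>x. \<Prod>i\<in>UNIV. u i 0 (x $ i)) differentiable at x"
proof -
  have d: "((\<lambda>x. \<Prod>i\<in>UNIV. u i (m i) (x $ i)) has_derivative
      (\<lambda>v. \<Sum>i\<in>UNIV. (u i (Suc (m i)) (x $ i) * v $ i) * (\<Prod>j\<in>UNIV - {i}. u j (m j) (x $ j)))) (at x)" for m x
  proof (rule has_derivative_prod)
    fix i :: 'n
    have "(u i (m i) has_derivative (\<lambda>t. u i (Suc (m i)) (x $ i) * t)) (at (x $ i))"
      using deriv_chain_DERIV[OF assms] by (simp add: has_field_derivative_def)
    from has_derivative_compose[OF bounded_linear_imp_has_derivative[OF bounded_linear_vec_nth] this]
    show "((\<lambda>x. u i (m i) (x $ i)) has_derivative (\<lambda>v. u i (Suc (m i)) (x $ i) * v $ i)) (at x)" .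
  qed
  have step: "frechet_derivative (\<lambda>x. \<Prod>i\<in>UNIV. u i (m i) (x $ i)) (at x) (axis l 1)
      = (\<Prod>i\<in>UNIV. u i ((m(l := Suc (m l))) i) (x $ i))" for m x l
  proof -
    have "frechet_derivative (\<lambda>x. \<Prod>i\<in>UNIV. u i (m i) (x $ i)) (at x) (axis l 1)
       = (\<Sum>i\<in>UNIV. (u i (Suc (m i)) (x $ i) * axis l 1 $ i) * (\<Prod>j\<in>UNIV - {i}. u j (m j) (x $ j)))"
      using frechet_derivative_at[OF d[of m x], symmetric] by metis
    also have "\<dots> = (\<Sum>i\<in>{l}. (u i (Suc (m i)) (x $ i) * axis l 1 $ i) * (\<Prod>j\<in>UNIV - {i}. u j (m j) (x $ j)))"
      by (rule sum.mono_neutral_right) (auto simp: axis_def)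
    also have "\<dots> = u l (Suc (m l)) (x $ l) * (\<Prod>j\<in>UNIV - {l}. u j ((m(l := Suc (m l))) j) (x $ j))"
      by (auto simp: axis_def intro!: prod.cong)
    also have "\<dots> = (\<Prod>i\<in>UNIV. u i ((m(l := Suc (m l))) i) (x $ i))"
      by (subst (2) prod.remove[of _ l]) auto
    finally show ?thesis .
  qed
  show eq: "partials is (\<lambda>x. \<Prod>i\<in>UNIV. u i 0 (x $ i)) = (\<lambda>x. \<Prod>i\<in>UNIV. u i (count_list is i) (x $ i))" for "is"
  proof (induction "is")
    case (Cons l "is")
    have "(count_list is)(l := Suc (count_list is l)) = count_list (l # is)" by auto
    then show ?case unfolding partials.simps Cons step by simp
  qed simp
  show "partials is (\<lambda>x. \<Prod>i\<in>UNIV. u i 0 (x $ i)) differentiable at x"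
    unfolding eq differentiable_def using d by blast
qed

lemma sum_count_list_UNIV: "(\<Sum>i\<in>(UNIV::'n::finite set). count_list is i) = length is"
proof (induction "is")
  case (Cons a "is")
  have "(\<Sum>i\<in>(UNIV::'n set). count_list (a # is) i) = (\<Sum>i\<in>UNIV. count_list is i + (if a = i then 1 else 0))"
    by (intro sum.cong) auto
  then show ?case using Cons by (simp add: sum.distrib)
qed simp

lemma tker_test_function:
  fixes y :: "real^'n::finite"
  assumes U: "\<And>i. bump_chain (U i)" and r: "r > 0"
  shows "partials is (tker (\<lambda>i. U i 0) y r) = (\<lambda>w. tker (\<lambda>i. U i (count_list is i)) y r w / r ^ length is)"
    and "corner_cube y r \<subseteq> V \<Longrightarrow> tker (\<lambda>i. U i 0) y r \<in> test_functions V"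
proof -
  let ?u = "\<lambda>i m x. (1 / r) ^ m * U i m (1 / r * x + - y $ i / r)"
  have u: "deriv_chain (?u i)" for i
    using U by (intro deriv_chain_scale) (auto simp: bump_chain_def)
  have t: "tker (\<lambda>i. U i 0) y r = (\<lambda>x. \<Prod>i\<in>UNIV. ?u i 0 (x $ i))"
    by (auto simp: tker_def diff_divide_distrib)
  show "partials is (tker (\<lambda>i. U i 0) y r) = (\<lambda>w. tker (\<lambda>i. U i (count_list is i)) y r w / r ^ length is)"
    unfolding t partials_tensor(1)[of ?u, OF u]
    by (simp add: tker_def diff_divide_distrib prod.distrib prod_dividef power_sum[symmetric] sum_count_list_UNIV power_one_over)
  assume "corner_cube y r \<subseteq> V"
  moreover have "tker (\<lambda>i. U i 0) y r w = 0" if "w \<notin> corner_cube y r" for w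
    by (rule tker_outside[OF _ r that]) (use U in \<open>auto simp: bump_chain_def\<close>)
  moreover have "smooth (tker (\<lambda>i. U i 0) y r)"
    unfolding smooth_def t using partials_tensor(2)[of ?u, OF u] by blast
  ultimately show "tker (\<lambda>i. U i 0) y r \<in> test_functions V"
    unfolding test_functions_def using compact_cbox by blast
qed

text \<open>Each derivative of the scaled kernel costs 1 / r, so moving the derivatives to
  \<open>f\<close> gains a factor r for each of them. This is the source of every r^k in the
  gradient bounds.\<close>

lemma weak_deriv_tker:
  fixes y :: "real^'n::finite"
  assumes wd: "has_weak_deriv V (count_list is) f g" and U: "\<And>i. bump_chain (U i)" and r: "r > 0"
    and V: "corner_cube y r \<subseteq> V"
  shows "(LINT w|lebesgue. f w * tker (\<lambda>i. U i (count_list is i)) y r w)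
    = (- r) ^ length is * (LINT w|lebesgue. g w * tker (\<lambda>i. U i 0) y r w)"
proof -
  have out: "tker (\<lambda>i. U i (m i)) y r w = 0" if "w \<notin> V" for m w
    by (rule tker_outside[OF _ r]) (use U V that in \<open>auto simp: bump_chain_def\<close>)
  have glob: "(LINT w:V|lebesgue. h w * tker (\<lambda>i. U i (m i)) y r w)
      = (LINT w|lebesgue. h w * tker (\<lambda>i. U i (m i)) y r w)" for h m
    unfolding set_lebesgue_integral_def by (intro Bochner_Integration.integral_cong) (auto simp: indicator_def out)
  have "(LINT w:V|lebesgue. f w * partials is (tker (\<lambda>i. U i 0) y r) w)
      = (-1) ^ length is * (LINT w:V|lebesgue. g w * tker (\<lambda>i. U i 0) y r w)"
    using wd tker_test_function(2)[of U r y V, OF U r V]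
    unfolding has_weak_deriv_def sum_count_list_UNIV by simp
  then have "(LINT w:V|lebesgue. f w * tker (\<lambda>i. U i (count_list is i)) y r w) / r ^ length is
      = (-1) ^ length is * (LINT w:V|lebesgue. g w * tker (\<lambda>i. U i 0) y r w)"
    unfolding tker_test_function(1)[of U, OF U r] by simp
  then show ?thesis
    using r glob[of f "\<lambda>i. count_list is i"] glob[of g "\<lambda>i. 0"]
    by (simp add: field_simps power_minus')
qed

section \<open>Lebesgue points and weak derivatives\<close>

lemma L1_loc_cbox: "f \<in> L1_loc \<Longrightarrow> set_integrable lebesgue (cbox a b) f"
  by (simp add: L1_loc_def)

lemma L1_loc_diff_const:
  assumes "f \<in> L1_loc" shows "(\<lambda>w. f w - c) \<in> L1_loc"
proof -
  have "set_integrable lebesgue K (\<lambda>w. c)" if "compact K" for K :: "(real^'n::finite) set"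
    using lmeasurable_compact[OF that] absolutely_integrable_on_const by blast
  then show ?thesis
    using assms by (auto simp: L1_loc_def intro!: set_integral_diff)
qed

lemma L1_loc_measurable:
  assumes "f \<in> L1_loc" shows "f \<in> borel_measurable lebesgue"
proof -
  have "(\<lambda>w. indicator (cball 0 (real m)) w * f w) \<in> borel_measurable lebesgue" for m
    using assms by (auto simp: L1_loc_def set_integrable_def dest!: spec[of _ "cball 0 (real m)"])
  moreover have "(\<lambda>m. indicator (cball 0 (real m)) w * f w) \<longlonglongrightarrow> f w" for w
  proof (rule tendsto_eventually)
    obtain M where "norm w \<le> real M" using real_arch_simple by blast
    then show "\<forall>\<^sub>F m in sequentially. indicator (cball 0 (real m)) w * f w = f w"
      by (intro eventually_sequentiallyI[of M]) (auto simp: indicator_def)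
  qed
  ultimately show ?thesis by (rule borel_measurable_LIMSEQ_real[rotated])
qed

definition bump :: "real \<Rightarrow> (real \<Rightarrow> real) \<Rightarrow> bool"
  where "bump M u \<longleftrightarrow> continuous_on UNIV u \<and> (\<forall>x. x \<notin> {0..1} \<longrightarrow> u x = 0) \<and> (\<forall>x. \<bar>u x\<bar> \<le> M)"

lemma
  fixes y :: "real^'n::finite"
  assumes f: "set_integrable lebesgue (corner_cube y r) f" and u: "\<And>i. bump M (u i)" and r: "r > 0"
  shows tker_integrable: "integrable lebesgue (\<lambda>w. f w * tker u y r w)"
    and tker_integral_bound: "\<bar>LINT w|lebesgue. f w * tker u y r w\<bar> \<le> M ^ CARD('n) * (LINT w:corner_cube y r|lebesgue. \<bar>f w\<bar>)"
    and tker_nn_integral_bound: "ennreal \<bar>LINT w|lebesgue. f w * tker u y r w\<bar>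
      \<le> ennreal (M ^ CARD('n)) * (\<integral>\<^sup>+w\<in>corner_cube y r. ennreal \<bar>f w\<bar> \<partial>lebesgue)"
proof -
  let ?Q = "corner_cube y r" and ?M = "M ^ CARD('n)"
  have M0: "0 \<le> M" using u unfolding bump_def by (meson abs_ge_zero order_trans)
  have eq: "f w * tker u y r w = indicator ?Q w *\<^sub>R f w * tker u y r w" for w
    using tker_outside[of u r w y] u r by (auto simp: indicator_def bump_def)
  have meas: "tker u y r \<in> borel_measurable lebesgue"
    using tker_cont[of u y r] u by (intro measurable_completion) (auto simp: bump_def intro: borel_measurable_continuous_onI)
  have bd: "\<bar>tker u y r w\<bar> \<le> ?M" for w
    by (rule tker_bound) (use u in \<open>simp add: bump_def\<close>)
  have bd': "\<bar>f w * tker u y r w\<bar> \<le> ?M * (indicator ?Q w * \<bar>f w\<bar>)" for w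
    unfolding eq abs_mult using mult_left_mono[OF bd, of "\<bar>indicator ?Q w *\<^sub>R f w\<bar>" w]
    by (simp add: abs_mult mult_ac)
  have f': "integrable lebesgue (\<lambda>w. indicator ?Q w *\<^sub>R f w)"
    using f by (simp add: set_integrable_def)
  then have fa: "integrable lebesgue (\<lambda>w. indicator ?Q w * \<bar>f w\<bar>)"
    using integrable_abs[OF f'] by (simp add: abs_mult)
  show int: "integrable lebesgue (\<lambda>w. f w * tker u y r w)"
  proof (rule Bochner_Integration.integrable_bound)
    show "integrable lebesgue (\<lambda>w. ?M * (indicator ?Q w * \<bar>f w\<bar>))" using fa by simp
    show "(\<lambda>w. f w * tker u y r w) \<in> borel_measurable lebesgue"
      unfolding eq using f' meas by (intro borel_measurable_times) auto
    show "AE w in lebesgue. norm (f w * tker u y r w) \<le> norm (?M * (indicator ?Q w * \<bar>f w\<bar>))"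
      using bd' by (intro AE_I2) (smt (verit) real_norm_def)
  qed
  have "\<bar>LINT w|lebesgue. f w * tker u y r w\<bar> \<le> (LINT w|lebesgue. ?M * (indicator ?Q w * \<bar>f w\<bar>))"
    by (rule integral_abs_bound_integral[OF int]) (use fa bd' in auto)
  then show "\<bar>LINT w|lebesgue. f w * tker u y r w\<bar> \<le> ?M * (LINT w:?Q|lebesgue. \<bar>f w\<bar>)"
    by (simp add: set_lebesgue_integral_def)
  have "ennreal \<bar>LINT w|lebesgue. f w * tker u y r w\<bar> \<le> (\<integral>\<^sup>+w. ennreal \<bar>f w * tker u y r w\<bar> \<partial>lebesgue)"
    using integral_norm_bound_ennreal[OF int] by simp
  also have "\<dots> \<le> (\<integral>\<^sup>+w. ennreal ?M * (ennreal \<bar>f w\<bar> * indicator ?Q w) \<partial>lebesgue)"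
  proof (rule nn_integral_mono)
    fix w
    have "ennreal \<bar>f w * tker u y r w\<bar> \<le> ennreal (?M * (indicator ?Q w * \<bar>f w\<bar>))"
      using bd' by (intro ennreal_leI)
    also have "\<dots> = ennreal ?M * (ennreal \<bar>f w\<bar> * indicator ?Q w)"
      using M0 by (auto simp: ennreal_mult indicator_def)
    finally show "ennreal \<bar>f w * tker u y r w\<bar> \<le> ennreal ?M * (ennreal \<bar>f w\<bar> * indicator ?Q w)" .
  qed
  also have "\<dots> = ennreal ?M * (\<integral>\<^sup>+w\<in>?Q. ennreal \<bar>f w\<bar> \<partial>lebesgue)"
  proof (rule nn_integral_cmult)
    have "(\<lambda>w. ennreal (indicator ?Q w * \<bar>f w\<bar>)) \<in> borel_measurable lebesgue" using fa by auto
    moreover have "ennreal (indicator ?Q w * \<bar>f w\<bar>) = ennreal \<bar>f w\<bar> * indicator ?Q w" for w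
      by (auto simp: indicator_def)
    ultimately show "(\<lambda>w. ennreal \<bar>f w\<bar> * indicator ?Q w) \<in> borel_measurable lebesgue" by simp
  qed
  finally show "ennreal \<bar>LINT w|lebesgue. f w * tker u y r w\<bar>
      \<le> ennreal ?M * (\<integral>\<^sup>+w\<in>?Q. ennreal \<bar>f w\<bar> \<partial>lebesgue)" .
qed

lemma bump_integrable: assumes "bump M a" shows "integrable lborel a"
proof -
  have "integrable lborel (\<lambda>x. indicator {0..1} x *\<^sub>R a x)"
    by (rule borel_integrable_compact) (use assms in \<open>auto simp: bump_def intro: continuous_on_subset\<close>)
  moreover have "(\<lambda>x. indicator {0..1} x *\<^sub>R a x) = a"
  proof
    fix x show "indicator {0..1} x *\<^sub>R a x = a x"
      using assms by (cases "x \<in> {0..1}") (auto simp: bump_def)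
  qed
  ultimately show ?thesis by simp
qed

lemma tker_integral_diff_const:
  fixes y :: "real^'n::finite"
  assumes f: "set_integrable lebesgue (corner_cube y r) f" and a: "bump M a" "(LINT x|lborel. a x) = 1"
    and r: "r > 0"
  shows "(LINT w|lebesgue. (f w - c) * tker (\<lambda>_. a) y r w)
    = (LINT w|lebesgue. f w * tker (\<lambda>_. a) y r w) - c * r ^ CARD('n)"
proof -
  have i: "integrable lebesgue (\<lambda>w. h w * tker (\<lambda>_. a) y r w)"
    if "set_integrable lebesgue (corner_cube y r) h" for h
    by (rule tker_integrable[OF that _ r]) (rule a(1))
  have "set_integrable lebesgue (corner_cube y r) (\<lambda>w. c)"
    by (rule absolutely_integrable_on_const) simp
  from i[OF f] i[OF this] show ?thesis
    using tker_integral[OF bump_integrable[OF a(1)] r, of y] a(2) by (simp add: left_diff_distrib)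
qed

lemma vec_eq_scaleR_One: "(\<chi> i. r) = r *\<^sub>R (One :: real^'n::finite)"
proof (rule euclidean_eqI)
  fix b :: "real^'n" assume "b \<in> Basis"
  then obtain i where b: "b = axis i 1" by (auto simp: Basis_vec_def)
  show "(\<chi> i. r) \<bullet> b = (r *\<^sub>R One) \<bullet> b"
    using \<open>b \<in> Basis\<close> by (simp add: inner_sum_left_Basis) (simp add: b inner_axis)
qed

text \<open>The kernel may change sign, so the means of |f - c| and not just those of f have to be
  controlled. Lebesgue differentiation is applied to these functions; restricting c to the rationals
  keeps the exceptional set negligible, and f(y) is then approximated by a rational c.\<close>

lemma mollification_tendsto_ae:
  fixes f :: "real^'n::finite \<Rightarrow> real"
  assumes f: "\<And>a b. set_integrable lebesgue (cbox a b) f" and a: "bump M a" "(LINT x|lborel. a x) = 1"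
  shows "AE y in lebesgue. ((\<lambda>r. (LINT w|lebesgue. f w * tker (\<lambda>_. a) y r w) / r ^ CARD('n)) \<longlongrightarrow> f y) (at_right 0)"
proof -
  have fc: "set_integrable lebesgue (cbox a b) (\<lambda>w. f w - c)" for a b c
    by (intro set_integral_diff f absolutely_integrable_on_const) auto
  have "\<exists>N. negligible N \<and> (\<forall>y e. y \<notin> N \<and> 0 < e \<longrightarrow> (\<exists>d>0. \<forall>h. 0 < h \<and> h < d \<longrightarrow>
      norm (integral (corner_cube y h) (\<lambda>w. \<bar>f w - c\<bar>) /\<^sub>R h ^ DIM(real^'n) - \<bar>f y - c\<bar>) < e))" for c
  proof -
    have "(\<lambda>w. \<bar>f w - c\<bar>) integrable_on cbox a b" for a b
      using fc[of a b c] unfolding absolutely_integrable_on_def by simp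
    then show ?thesis
      unfolding vec_eq_scaleR_One by (rule integrable_ccontinuous_explicit) blast
  qed
  then obtain N where N: "\<And>c. negligible (N c)" "\<And>c y e. y \<notin> N c \<Longrightarrow> 0 < e \<Longrightarrow> \<exists>d>0. \<forall>h. 0 < h \<and> h < d \<longrightarrow>
      norm (integral (corner_cube y h) (\<lambda>w. \<bar>f w - c\<bar>) /\<^sub>R h ^ DIM(real^'n) - \<bar>f y - c\<bar>) < e"
    by metis
  have "negligible (\<Union>c\<in>\<rat>. N c)"
    using N(1) countable_rat by (intro negligible_countable_Union) auto
  moreover have "((\<lambda>r. (LINT w|lebesgue. f w * tker (\<lambda>_. a) y r w) / r ^ CARD('n)) \<longlongrightarrow> f y) (at_right 0)"
    if y: "y \<notin> (\<Union>c\<in>\<rat>. N c)" for y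
  proof (rule tendstoI)
    fix e :: real assume e: "e > 0"
    have M0: "0 \<le> M" using a unfolding bump_def by (meson abs_ge_zero order_trans)
    \<comment> \<open>Chosen so that the kernel bound M^n times a mean of at most 2 e', plus the
      error of replacing c by f(y), stays below e.\<close>
    define e' where "e' = e / (2 * M ^ CARD('n) + 2)"
    have e': "e' > 0" using e M0 by (simp add: e'_def add_nonneg_pos)
    obtain c where c: "c \<in> \<rat>" "\<bar>f y - c\<bar> < e'"
      using Rats_dense_in_real[of "f y - e'" "f y + e'"] e' by (auto simp: abs_less_iff)
    obtain d where d: "d > 0" "\<And>h. 0 < h \<Longrightarrow> h < d \<Longrightarrow>
        norm (integral (corner_cube y h) (\<lambda>w. \<bar>f w - c\<bar>) /\<^sub>R h ^ DIM(real^'n) - \<bar>f y - c\<bar>) < e'"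
      using N(2)[of y c e'] y c e' by blast
    have "dist ((LINT w|lebesgue. f w * tker (\<lambda>_. a) y h w) / h ^ CARD('n)) (f y) < e" if h: "0 < h" "h < d" for h
    proof -
      let ?I = "LINT w:corner_cube y h|lebesgue. \<bar>f w - c\<bar>"
      have "?I = integral (corner_cube y h) (\<lambda>w. \<bar>f w - c\<bar>)"
        by (rule set_lebesgue_integral_eq_integral) (use set_integrable_abs[OF fc] in simp)
      then have I: "?I / h ^ CARD('n) \<le> 2 * e'"
        using d(2)[OF h] c(2) by (simp add: divide_inverse mult.commute)
      have "\<bar>(LINT w|lebesgue. f w * tker (\<lambda>_. a) y h w) / h ^ CARD('n) - c\<bar>
          = \<bar>LINT w|lebesgue. (f w - c) * tker (\<lambda>_. a) y h w\<bar> / h ^ CARD('n)"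
      proof -
        have "0 < h ^ CARD('n)" using h by simp
        then have "I / h ^ CARD('n) - c = (I - c * h ^ CARD('n)) / h ^ CARD('n)" for I
          using h(1) by (simp add: diff_divide_distrib)
        then show ?thesis
          unfolding tker_integral_diff_const[OF f a h(1)] using \<open>0 < h ^ CARD('n)\<close> by (simp add: abs_divide)
      qed
      also have "\<dots> \<le> M ^ CARD('n) * ?I / h ^ CARD('n)"
        using tker_integral_bound[of y h "\<lambda>w. f w - c" M "\<lambda>_. a", OF fc a(1) h(1)] h by (intro divide_right_mono) auto
      also have "\<dots> \<le> M ^ CARD('n) * (2 * e')"
        using mult_left_mono[OF I, of "M ^ CARD('n)"] M0 by simp
      finally have "\<bar>(LINT w|lebesgue. f w * tker (\<lambda>_. a) y h w) / h ^ CARD('n) - f y\<bar> < M ^ CARD('n) * (2 * e') + 2 * e'"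
        using c(2) e' by linarith
      also have "\<dots> = (2 * M ^ CARD('n) + 2) * e'" by (simp add: algebra_simps)
      also have "\<dots> = e"
      proof -
        have "2 * M ^ CARD('n) + 2 > 0" using M0 by (simp add: add_nonneg_pos)
        then show ?thesis by (simp add: e'_def)
      qed
      finally show ?thesis by (simp add: dist_real_def)
    qed
    then show "\<forall>\<^sub>F h in at_right 0. dist ((LINT w|lebesgue. f w * tker (\<lambda>_. a) y h w) / h ^ CARD('n)) (f y) < e"
      using d(1) by (auto simp: eventually_at_right_field)
  qed
  ultimately show ?thesis
    by (intro AE_I'[of "\<Union>c\<in>\<rat>. N c"]) (auto simp: negligible_iff_null_sets)
qed


section \<open>Weak derivatives: uniqueness, localisation and gluing\<close>

lemma bump_chain_bump:
  assumes "bump_chain U" obtains M where "bump M (U m)"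
  using assms bump_chain_bounded[OF assms, of m] deriv_chain_cont
  unfolding bump_def bump_chain_def by blast

lemma ex_count_list: "\<exists>is. count_list is = (\<alpha> :: 'n::finite \<Rightarrow> nat)"
proof -
  obtain xs :: "'n list" where xs: "set xs = UNIV" "distinct xs"
    using finite_distinct_list[of "UNIV :: 'n set"] by auto
  have "count_list (concat (map (\<lambda>i. replicate (\<alpha> i) i) ys)) j = (if j \<in> set ys then \<alpha> j else 0)"
    if "distinct ys" for ys j
  proof -
    have rep: "count_list (replicate m i) j = (if i = j then m else 0)" for m :: nat and i
      by (induction m) auto
    show ?thesis using that by (induction ys) (auto simp: rep)
  qed
  from this[OF xs(2)] show ?thesis using xs(1) by (intro exI) auto
qed

text \<open>The mollifying kernels are themselves admissible test functions. Tested against those of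
  small support, the difference of the two candidates gives 0, while the same integrals divided by
  r^n tend to the value of the difference almost everywhere.\<close>

lemma weak_deriv_unique_ae:
  fixes f g1 g2 :: "real^'n::finite \<Rightarrow> real"
  assumes V: "open V" and g: "set_integrable lebesgue V g1" "set_integrable lebesgue V g2"
    and wd: "has_weak_deriv V \<alpha> f g1" "has_weak_deriv V \<alpha> f g2"
  shows "AE x in lebesgue. x \<in> V \<longrightarrow> g1 x = g2 x"
proof -
  obtain "is" :: "'n list" where "is": "count_list is = \<alpha>" using ex_count_list by blast
  obtain a b where a: "bump_chain a" "bump_chain b" "\<And>x. b 1 x = 2 * a 0 (2 * x) - a 0 x"
    "integrable lborel (a 0)" "(LINT x|lborel. a 0 x) = 1"
    using mollifier_exists[of 1] by auto
  obtain M where M: "bump M (a 0)" using bump_chain_bump[OF a(1)] by blast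
  define D where "D w = indicator V w * (g1 w - g2 w)" for w
  have D: "integrable lebesgue D"
    using set_integral_diff(1)[OF g] by (simp add: D_def[abs_def] set_integrable_def)
  have "set_integrable lebesgue (cbox c d) D" for c d
    using integrable_mult_indicator[OF _ D, of "cbox c d"] by (simp add: set_integrable_def)
  from mollification_tendsto_ae[OF this M a(5)]
  have "AE y in lebesgue. ((\<lambda>r. (LINT w|lebesgue. D w * tker (\<lambda>_. a 0) y r w) / r ^ CARD('n)) \<longlongrightarrow> D y) (at_right 0)" .
  then show ?thesis
  proof (rule AE_mp, intro AE_I2 impI)
    fix y assume lim: "((\<lambda>r. (LINT w|lebesgue. D w * tker (\<lambda>_. a 0) y r w) / r ^ CARD('n)) \<longlongrightarrow> D y) (at_right 0)"
      and y: "y \<in> V"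
    obtain e where e: "e > 0" "ball y e \<subseteq> V" using V y open_contains_ball by blast
    \<comment> \<open>Points of the cube have distance at most n r from its corner, so this bound on
      r keeps the cube inside the ball of radius e.\<close>
    have zero: "(LINT w|lebesgue. D w * tker (\<lambda>_. a 0) y r w) = 0" if r: "0 < r" "r < e / (1 + real CARD('n))" for r
    proof -
      have sub: "corner_cube y r \<subseteq> V"
      proof
        fix w assume w: "w \<in> corner_cube y r"
        have "norm (w - y) \<le> (\<Sum>i\<in>UNIV. \<bar>(w - y) $ i\<bar>)" by (rule norm_le_l1_cart)
        also have "\<dots> \<le> (\<Sum>i\<in>(UNIV::'n set). r)"
          by (rule sum_mono) (use w in \<open>auto simp: mem_box_cart abs_le_iff; smt (verit)\<close>)
        also have "\<dots> < e" using r by (simp add: field_simps)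
        finally show "w \<in> V" using e(2) by (auto simp: dist_norm norm_minus_commute)
      qed
      have glob: "(LINT w:V|lebesgue. h w * tker (\<lambda>_. a 0) y r w) = (LINT w|lebesgue. h w * (indicator V w * tker (\<lambda>_. a 0) y r w))" for h
        unfolding set_lebesgue_integral_def by (simp add: mult_ac)
      have int: "integrable lebesgue (\<lambda>w. h w * tker (\<lambda>_. a 0) y r w)" if "set_integrable lebesgue V h" for h
        by (rule tker_integrable[OF set_integrable_subset[OF that _ sub] _ r(1)]) (auto intro: M)
      have phi: "tker (\<lambda>_. a 0) y r \<in> test_functions V"
        using tker_test_function(2)[of "\<lambda>_. a" r y V] a(1) r(1) sub by blast
      have "(LINT w:V|lebesgue. g1 w * tker (\<lambda>_. a 0) y r w) = (LINT w:V|lebesgue. g2 w * tker (\<lambda>_. a 0) y r w)"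
        using wd[unfolded has_weak_deriv_def, rule_format, OF phi, of "is"] "is" by simp
      moreover have out: "indicator V w * tker (\<lambda>_. a 0) y r w = tker (\<lambda>_. a 0) y r w" for w
        using tker_outside[of "\<lambda>_. a 0" r w y] M r(1) sub by (auto simp: bump_def indicator_def)
      ultimately have "(LINT w|lebesgue. g1 w * tker (\<lambda>_. a 0) y r w) = (LINT w|lebesgue. g2 w * tker (\<lambda>_. a 0) y r w)"
        unfolding glob by simp
      moreover have "D w * tker (\<lambda>_. a 0) y r w = g1 w * tker (\<lambda>_. a 0) y r w - g2 w * tker (\<lambda>_. a 0) y r w" for w
        using out[of w] by (auto simp: D_def algebra_simps indicator_def)
      ultimately show ?thesis using int[OF g(1)] int[OF g(2)] by simp
    qed
    have "((\<lambda>r. (LINT w|lebesgue. D w * tker (\<lambda>_. a 0) y r w) / r ^ CARD('n)) \<longlongrightarrow> 0) (at_right 0)"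
    proof (rule tendsto_eventually)
      have "e / (1 + real CARD('n)) > 0" using e(1) by (simp add: add_pos_nonneg)
      then show "\<forall>\<^sub>F r in at_right 0. (LINT w|lebesgue. D w * tker (\<lambda>_. a 0) y r w) / r ^ CARD('n) = 0"
        using zero by (auto simp: eventually_at_right_field)
    qed
    from tendsto_unique[OF _ lim this] have "D y = 0" by simp
    then show "g1 y = g2 y" using y by (simp add: D_def)
  qed
qed

lemma partials_outside:
  assumes "closed K" "\<And>x. x \<notin> K \<Longrightarrow> \<phi> x = 0" "x \<notin> K"
  shows "partials is \<phi> x = 0"
  using assms(3)
proof (induction "is" arbitrary: x)
  case (Cons i "is")
  have "((\<lambda>x. 0) has_derivative (\<lambda>_. 0)) (at x)" by simp
  then have "(partials is \<phi> has_derivative (\<lambda>_. 0)) (at x)"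
    by (rule has_derivative_transform_within_open[of _ _ _ _ "- K"]) (use Cons assms(1) in \<open>auto simp: open_Compl\<close>)
  then show ?case using frechet_derivative_at by (metis partials.simps(2))
qed (use assms in simp)

lemma has_weak_deriv_subset:
  assumes "has_weak_deriv V \<alpha> f g" "W \<subseteq> V"
  shows "has_weak_deriv W \<alpha> f g"
  unfolding has_weak_deriv_def
proof (intro ballI allI impI)
  fix \<phi> "is" assume phi: "\<phi> \<in> test_functions W" and c: "\<forall>i. count_list is i = \<alpha> i"
  then obtain K where K: "smooth \<phi>" "compact K" "K \<subseteq> W" "\<And>x. x \<notin> K \<Longrightarrow> \<phi> x = 0"
    by (auto simp: test_functions_def)
  have phiV: "\<phi> \<in> test_functions V" using K assms(2) by (auto simp: test_functions_def)
  have p: "partials is \<phi> x = 0" if "x \<notin> K" for x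
    using partials_outside[OF compact_imp_closed[OF K(2)] K(4) that] .
  have "(LINT x:W|lebesgue. h x * \<psi> x) = (LINT x:V|lebesgue. h x * \<psi> x)"
    if "\<And>x. x \<notin> K \<Longrightarrow> \<psi> x = 0" for h \<psi> :: "_ \<Rightarrow> real"
    unfolding set_lebesgue_integral_def
  proof (intro Bochner_Integration.integral_cong refl)
    fix x show "indicat_real W x *\<^sub>R (h x * \<psi> x) = indicat_real V x *\<^sub>R (h x * \<psi> x)"
      using that[of x] K(3) assms(2) by (cases "x \<in> K") (auto simp: indicator_def subset_iff)
  qed
  from this[of "partials is \<phi>" f, OF p] this[of \<phi> g, OF K(4)] assms(1) phiV c
  show "(LINT x:W|lebesgue. f x * partials is \<phi> x)
      = (- 1) ^ (\<Sum>i\<in>UNIV. \<alpha> i) * (LINT x:W|lebesgue. g x * \<phi> x)"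
    unfolding has_weak_deriv_def by simp
qed

text \<open>Licenses the choice made in \<open>weak_deriv\<close>. The definition of the Sobolev
  class gives an unrelated derivative on each ball; uniqueness makes the glued function agree almost
  everywhere with each of them, and a test function is supported in one of the balls.\<close>

lemma weak_deriv_exists:
  fixes f :: "real^'n::finite \<Rightarrow> real"
  assumes f: "f \<in> Sobolev1_loc k" and \<alpha>: "(\<Sum>i\<in>UNIV. \<alpha> i) \<le> k"
  shows "\<exists>g. g \<in> L1_loc \<and> has_weak_deriv UNIV \<alpha> f g"
proof -
  let ?V = "\<lambda>m. ball (0 :: real^'n) (real m + 1)"
  have "\<exists>g. set_integrable lebesgue (?V m) g \<and> has_weak_deriv (?V m) \<alpha> f g" for m
    using f \<alpha> unfolding Sobolev1_loc_def Sobolev1_def by (auto dest!: spec[of _ "?V m"])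
  then obtain G where G: "\<And>m. set_integrable lebesgue (?V m) (G m)" "\<And>m. has_weak_deriv (?V m) \<alpha> f (G m)"
    by metis
  \<comment> \<open>The least index m for which the open ball of radius m + 1 contains
    \<open>x\<close>.\<close>
  define i where "i x = nat \<lfloor>norm x\<rfloor>" for x :: "real^'n"
  have i: "norm x < real (i x) + 1" "norm x < real m + 1 \<Longrightarrow> i x \<le> m" for x m
    unfolding i_def by linarith+
  define g where "g x = G (i x) x" for x
  have "AE x in lebesgue. x \<in> ?V l \<longrightarrow> G l x = G m x" if "l \<le> m" for l m
  proof (rule weak_deriv_unique_ae[OF open_ball G(1) _ G(2)])
    have sub: "?V l \<subseteq> ?V m" using that by (intro subset_ball) simp
    show "set_integrable lebesgue (?V l) (G m)" by (rule set_integrable_subset[OF G(1) _ sub]) simp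
    show "has_weak_deriv (?V l) \<alpha> f (G m)" by (rule has_weak_deriv_subset[OF G(2) sub])
  qed
  then have "AE x in lebesgue. \<forall>l m. l \<le> m \<longrightarrow> x \<in> ?V l \<longrightarrow> G l x = G m x"
    by (simp add: AE_all_countable)
  then have "AE x in lebesgue. \<forall>m. x \<in> ?V m \<longrightarrow> G m x = g x"
  proof (rule AE_mp, intro AE_I2 impI allI)
    fix x m assume "\<forall>l m. l \<le> m \<longrightarrow> x \<in> ?V l \<longrightarrow> G l x = G m x" "x \<in> ?V m"
    moreover have "i x \<le> m" "x \<in> ?V (i x)" using i[of x] \<open>x \<in> ?V m\<close> by auto
    ultimately show "G m x = g x" unfolding g_def by metis
  qed
  then obtain T where T: "negligible T" "\<And>x m. x \<notin> T \<Longrightarrow> x \<in> ?V m \<Longrightarrow> g x = G m x"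
    by (auto simp: eventually_ae_filter negligible_iff_null_sets subset_iff; metis)
  have int: "set_integrable lebesgue (?V m) g" for m
    by (rule absolutely_integrable_spike[OF G(1) T(1)]) (use T(2) in auto)
  have L1: "g \<in> L1_loc"
    unfolding L1_loc_def
  proof (intro CollectI allI impI)
    fix K :: "(real^'n) set" assume K: "compact K"
    then obtain B where "\<forall>x\<in>K. norm x \<le> B" using bounded_iff compact_imp_bounded by blast
    moreover obtain m where "B \<le> real m" using real_arch_simple by blast
    ultimately have "K \<subseteq> ?V m" by force
    then show "set_integrable lebesgue K g"
      using set_integrable_subset[OF int] K by (meson lmeasurable_compact fmeasurableD)
  qed
  have "has_weak_deriv UNIV \<alpha> f g"
    unfolding has_weak_deriv_def
  proof (intro ballI allI impI)
    fix \<phi> "is" assume phi: "\<phi> \<in> test_functions (UNIV :: (real^'n) set)" and c: "\<forall>i. count_list is i = \<alpha> i"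
    then obtain K where K: "smooth \<phi>" "compact K" "\<And>x. x \<notin> K \<Longrightarrow> \<phi> x = 0"
      by (auto simp: test_functions_def)
    obtain B where "\<forall>x\<in>K. norm x \<le> B" using K(2) bounded_iff compact_imp_bounded by blast
    moreover obtain m where "B \<le> real m" using real_arch_simple by blast
    ultimately have sub: "K \<subseteq> ?V m" by force
    have phim: "\<phi> \<in> test_functions (?V m)" using K sub by (auto simp: test_functions_def)
    have p: "partials is \<phi> x = 0" if "x \<notin> K" for x
      using partials_outside[OF compact_imp_closed[OF K(2)] K(3) that] .
    have eq: "(LINT x:UNIV|lebesgue. h x * \<psi> x) = (LINT x:?V m|lebesgue. h x * \<psi> x)"
      if "\<And>x. x \<notin> K \<Longrightarrow> \<psi> x = 0" for h \<psi> :: "_ \<Rightarrow> real"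
      unfolding set_lebesgue_integral_def
    proof (intro Bochner_Integration.integral_cong refl)
      fix x show "indicat_real UNIV x *\<^sub>R (h x * \<psi> x) = indicat_real (?V m) x *\<^sub>R (h x * \<psi> x)"
        using that[of x] subsetD[OF sub, of x] by (cases "x \<in> K") auto
    qed
    have "(LINT x:?V m|lebesgue. G m x * \<phi> x) = (LINT x:?V m|lebesgue. g x * \<phi> x)"
    proof -
      have "\<phi> differentiable at x" for x
        using K(1) unfolding smooth_def by (metis partials.simps(1))
      then have "continuous_on UNIV \<phi>"
        by (simp add: continuous_at_imp_continuous_on differentiable_imp_continuous_within)
      then have [measurable]: "\<phi> \<in> borel_measurable lebesgue"
        by (intro measurable_completion) (auto intro: borel_measurable_continuous_onI)
      have [measurable]: "(\<lambda>x. indicat_real (?V m) x *\<^sub>R G m x) \<in> borel_measurable lebesgue"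
        "(\<lambda>x. indicat_real (?V m) x *\<^sub>R g x) \<in> borel_measurable lebesgue"
        using G(1)[of m] int[of m] by (auto simp: set_integrable_def)
      have "AE x in lebesgue. x \<notin> T"
        using T(1) by (intro AE_not_in) (simp add: negligible_iff_null_sets)
      then have ae: "AE x in lebesgue. (indicat_real (?V m) x *\<^sub>R G m x) * \<phi> x = (indicat_real (?V m) x *\<^sub>R g x) * \<phi> x"
        by (rule AE_mp) (use T(2) in \<open>auto intro!: AE_I2 simp: indicator_def\<close>)
      have "(LINT x|lebesgue. (indicat_real (?V m) x *\<^sub>R G m x) * \<phi> x) = (LINT x|lebesgue. (indicat_real (?V m) x *\<^sub>R g x) * \<phi> x)"
        by (rule integral_cong_AE[OF _ _ ae]) measurable
      then show ?thesis by (simp add: set_lebesgue_integral_def mult.assoc)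
    qed
    then show "(LINT x:UNIV|lebesgue. f x * partials is \<phi> x)
        = (- 1) ^ (\<Sum>i\<in>UNIV. \<alpha> i) * (LINT x:UNIV|lebesgue. g x * \<phi> x)"
      using eq[of "partials is \<phi>" f, OF p] eq[of \<phi> g, OF K(3)] G(2)[of m] phim c
      unfolding has_weak_deriv_def by simp
  qed
  with L1 show ?thesis by blast
qed

lemma weak_deriv_props:
  assumes "f \<in> Sobolev1_loc k" "(\<Sum>i\<in>UNIV. \<alpha> i) \<le> k"
  shows "weak_deriv \<alpha> f \<in> L1_loc" "has_weak_deriv UNIV \<alpha> f (weak_deriv \<alpha> f)"
  using someI_ex[OF weak_deriv_exists[OF assms]] by (simp_all add: weak_deriv_def)

lemma finite_multi_indices: "finite {\<alpha> :: 'n::finite \<Rightarrow> nat. (\<Sum>i\<in>UNIV. \<alpha> i) = k}"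
proof (rule finite_subset)
  show "finite (PiE (UNIV :: 'n set) (\<lambda>_. {..k}))" by (intro finite_PiE) auto
  show "{\<alpha> :: 'n \<Rightarrow> nat. (\<Sum>i\<in>UNIV. \<alpha> i) = k} \<subseteq> PiE UNIV (\<lambda>_. {..k})"
    by (auto simp: PiE_def intro: member_le_sum)
qed

lemma abs_weak_deriv_le_norm_nabla:
  assumes "(\<Sum>i\<in>UNIV. \<alpha> i) = k"
  shows "\<bar>weak_deriv \<alpha> f x\<bar> \<le> norm_nabla k f x"
  unfolding norm_nabla_def
proof (rule real_le_rsqrt)
  show "\<bar>weak_deriv \<alpha> f x\<bar>\<^sup>2 \<le> (\<Sum>\<alpha> | (\<Sum>i\<in>UNIV. \<alpha> i) = k. (weak_deriv \<alpha> f x)\<^sup>2)"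
    using member_le_sum[of \<alpha> _ "\<lambda>\<alpha>. (weak_deriv \<alpha> f x)\<^sup>2", OF _ _ finite_multi_indices] assms by simp
qed

lemma norm_nabla_measurable:
  assumes "f \<in> Sobolev1_loc k"
  shows "norm_nabla k f \<in> borel_measurable lebesgue"
proof -
  have "weak_deriv \<alpha> f \<in> borel_measurable lebesgue" if "(\<Sum>i\<in>UNIV. \<alpha> i) = k" for \<alpha>
    using weak_deriv_props(1)[OF assms] that by (intro L1_loc_measurable) simp
  then show ?thesis unfolding norm_nabla_def[abs_def] by measurable
qed

lemma Sobolev1_locD:
  assumes "f \<in> Sobolev1_loc k"
  shows "f \<in> L1_loc" "f \<in> borel_measurable lebesgue" "norm_nabla k f \<in> borel_measurable lebesgue"
  using assms L1_loc_measurable norm_nabla_measurable by (auto simp: Sobolev1_loc_def)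

section \<open>Mollification\<close>

lemma bump_mono: "bump M u \<Longrightarrow> M \<le> M' \<Longrightarrow> bump M' u"
  unfolding bump_def by (meson order_trans)

lemma fdiff_diff: "fdiff k h (\<lambda>y. f y - g y) x = fdiff k h f x - fdiff k h g x"
  by (simp add: fdiff_def right_diff_distrib sum_subtractf)

lemma fdiff_const: assumes "1 \<le> k" shows "fdiff k h (\<lambda>_. c) x = 0"
proof -
  obtain m where m: "k = Suc m" using assms by (cases k) auto
  have "(\<Sum>i\<le>k. (-1) ^ i * of_nat (k choose i)) = (0::real)" by (rule choose_alternating_sum) (use assms in simp)
  then have "(\<Sum>i=0..k. (-1) ^ i * real (k choose i)) = 0" by (simp add: atLeast0AtMost)
  moreover have "(-1) ^ (k - j) * real (k choose j) = (-1) ^ k * ((-1) ^ j * real (k choose j))" if "j \<in> {0..k}" for j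
  proof -
    have "(-1 :: real) ^ k = (-1) ^ (k - j) * (-1) ^ j" using that by (simp flip: power_add)
    then have "(-1 :: real) ^ k * (-1) ^ j = (-1) ^ (k - j) * ((-1) ^ j * (-1) ^ j)" by simp
    then show ?thesis by (simp flip: power_mult_distrib)
  qed
  then have "(\<Sum>j=0..k. (-1) ^ (k - j) * real (k choose j)) = (\<Sum>j=0..k. (-1) ^ k * ((-1) ^ j * real (k choose j)))"
    by (rule sum.cong[OF refl])
  ultimately have "(\<Sum>j=0..k. (-1) ^ (k - j) * real (k choose j)) = 0"
    by (simp only: sum_distrib_left[symmetric] mult_zero_right)
  then show ?thesis by (simp add: fdiff_def flip: sum_distrib_right)
qed


text \<open>One constant \<open>M\<close> dominates every profile that occurs as a factor of a
  kernel: the derivatives of \<open>a\<close> up to order k for finite differences, \<open>b\<close>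
  and the rescaled \<open>a\<close> for the passage from r to r / 2.\<close>

locale mollifier =
  fixes k :: nat and a b :: "nat \<Rightarrow> real \<Rightarrow> real" and M :: real
  assumes a: "bump_chain a" and b: "bump_chain b"
    and b_k: "b k x = 2 * a 0 (2 * x) - a 0 x"
    and int_a: "(LINT x|lborel. a 0 x) = 1"
    and bump_a: "m \<le> k \<Longrightarrow> bump M (a m)"
    and bump_b: "bump M (b 0)"
    and bump_a2: "bump M (\<lambda>x. 2 * a 0 (2 * x))"

lemma mollifier_locale_exists:
  assumes "k \<ge> 1" shows "\<exists>a b M. mollifier k a b M"
proof -
  obtain a b where a: "bump_chain a" and b: "bump_chain b" and bk: "\<And>x. b k x = 2 * a 0 (2 * x) - a 0 x"
    and i: "(LINT x|lborel. a 0 x) = 1"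
    using mollifier_exists[OF assms] by metis
  have "\<exists>M. bump M (a m)" for m using bump_chain_bump[OF a] by blast
  then obtain A where A: "\<And>m. bump (A m) (a m)" by metis
  obtain B where B: "bump B (b 0)" using bump_chain_bump[OF b] by blast
  \<comment> \<open>The maximum is counted twice because 2 a(2 x) is bounded by
    \<open>2 * A 0\<close>.\<close>
  define M where "M = Max (A ` {..k}) + Max (A ` {..k}) + \<bar>B\<bar>"
  have A0: "0 \<le> A m" for m using A unfolding bump_def by (meson abs_ge_zero order_trans)
  have Am: "A m \<le> Max (A ` {..k})" if "m \<le> k" for m using that by (intro Max_ge) auto
  have "0 \<le> Max (A ` {..k})" using A0 Am by (meson le0 order_trans)
  then have AM: "2 * A m \<le> M" if "m \<le> k" for m using Am[OF that] unfolding M_def by linarith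
  have a2: "bump (2 * A 0) (\<lambda>x. 2 * a 0 (2 * x))"
  proof -
    have "continuous_on UNIV (\<lambda>x. 2 * a 0 (2 * x))"
    proof (rule continuous_on_mult_left)
      have "continuous_on UNIV (\<lambda>x::real. 2 * x)" by (intro continuous_intros)
      then show "continuous_on UNIV (\<lambda>x. a 0 (2 * x))"
        using continuous_on_compose2[of UNIV "a 0" UNIV "\<lambda>x. 2 * x"] A[of 0] unfolding bump_def by auto
    qed
    moreover have "a 0 (2 * x) = 0" if "x \<notin> {0..1}" for x
    proof -
      have "2 * x \<notin> {0..1}" using that by auto
      then show ?thesis using A[of 0] unfolding bump_def by blast
    qed
    moreover have "\<bar>2 * a 0 (2 * x)\<bar> \<le> 2 * A 0" for x
      using A[of 0] unfolding bump_def by (simp add: abs_mult)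
    ultimately show ?thesis unfolding bump_def by auto
  qed
  have "mollifier k a b M"
  proof
    show "bump M (a m)" if "m \<le> k" for m using bump_mono[OF A] AM[OF that] A0[of m] by force
    show "bump M (b 0)" using bump_mono[OF B] AM[of 0] A0[of 0] \<open>0 \<le> Max (A ` {..k})\<close> unfolding M_def by force
    show "bump M (\<lambda>x. 2 * a 0 (2 * x))" using bump_mono[OF a2] AM[of 0] by force
  qed (use a b bk i in auto)
  then show ?thesis by blast
qed

lemma nn_set_integral_mono:
  assumes "\<And>w. w \<in> A \<Longrightarrow> g w \<le> h w" "A \<subseteq> B"
  shows "(\<integral>\<^sup>+w\<in>A. g w \<partial>L) \<le> (\<integral>\<^sup>+w\<in>B. h w \<partial>L)"
  using assms by (intro nn_integral_mono) (auto simp: indicator_def)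

lemma norm_corner_cube:
  fixes y :: "real^'n::finite"
  assumes "w \<in> corner_cube y r" shows "norm (w - y) \<le> real CARD('n) * r"
proof -
  have "norm (w - y) \<le> (\<Sum>i\<in>UNIV. \<bar>(w - y) $ i\<bar>)" by (rule norm_le_l1_cart)
  also have "\<dots> \<le> (\<Sum>i\<in>(UNIV::'n set). r)"
  proof (rule sum_mono)
    fix i have "y $ i \<le> w $ i" "w $ i \<le> y $ i + r" using assms by (auto simp: mem_box_cart)
    then show "\<bar>(w - y) $ i\<bar> \<le> r" by simp
  qed
  finally show ?thesis by simp
qed

text \<open>Dominated convergence: the mean value inequality bounds all difference quotients by
  \<open>B\<close>, and B |F| is integrable.\<close>

lemma has_real_derivative_integral:
  fixes \<phi> \<phi>' :: "real \<Rightarrow> 'b \<Rightarrow> real"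
  assumes F: "integrable L F"
    and d: "\<And>t w. ((\<lambda>t. \<phi> t w) has_real_derivative \<phi>' t w) (at t)"
    and int: "\<And>t. integrable L (\<lambda>w. F w * \<phi> t w)"
    and B: "\<And>t w. \<bar>\<phi>' t w\<bar> \<le> B"
  shows "((\<lambda>t. LINT w|L. F w * \<phi> t w) has_real_derivative (LINT w|L. F w * \<phi>' t0 w)) (at t0)"
proof -
  have lip: "\<bar>\<phi> t w - \<phi> t0 w\<bar> \<le> B * \<bar>t - t0\<bar>" for t w
    using field_differentiable_bound[of UNIV "\<lambda>t. \<phi> t w" "\<lambda>t. \<phi>' t w" B t t0] d B by simp
  have quot: "((LINT w|L. F w * \<phi> t w) - (LINT w|L. F w * \<phi> t0 w)) / (t - t0)
      = (LINT w|L. F w * ((\<phi> t w - \<phi> t0 w) / (t - t0)))" for t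
  proof -
    have "F w * ((\<phi> t w - \<phi> t0 w) / (t - t0)) = (F w * \<phi> t w - F w * \<phi> t0 w) / (t - t0)" for w
      by (simp add: right_diff_distrib)
    then have "(LINT w|L. F w * ((\<phi> t w - \<phi> t0 w) / (t - t0))) = (LINT w|L. (F w * \<phi> t w - F w * \<phi> t0 w) / (t - t0))"
      by presburger
    also have "\<dots> = ((LINT w|L. F w * \<phi> t w) - (LINT w|L. F w * \<phi> t0 w)) / (t - t0)"
      using int by (simp only: integral_divide_zero Bochner_Integration.integral_diff)
    finally show ?thesis by (rule sym)
  qed
  have "((\<lambda>t. LINT w|L. F w * ((\<phi> t w - \<phi> t0 w) / (t - t0))) \<longlongrightarrow> (LINT w|L. F w * \<phi>' t0 w)) (at t0)"
    unfolding tendsto_at_iff_sequentially comp_def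
  proof (intro allI impI)
    fix X assume X: "\<forall>i. X i \<in> UNIV - {t0}" "X \<longlonglongrightarrow> t0"
    have lim: "(\<lambda>i. F w * ((\<phi> (X i) w - \<phi> t0 w) / (X i - t0))) \<longlonglongrightarrow> F w * \<phi>' t0 w" for w
      using d[of w t0] X unfolding has_field_derivative_iff tendsto_at_iff_sequentially comp_def
      by (intro tendsto_mult tendsto_const) auto
    have m: "(\<lambda>w. F w * ((\<phi> (X i) w - \<phi> t0 w) / (X i - t0))) \<in> borel_measurable L" for i
    proof -
      have "(\<lambda>w. (F w * \<phi> (X i) w - F w * \<phi> t0 w) / (X i - t0)) \<in> borel_measurable L"
        using int by measurable
      then show ?thesis by (simp add: right_diff_distrib)
    qed
    show "(\<lambda>i. LINT w|L. F w * ((\<phi> (X i) w - \<phi> t0 w) / (X i - t0))) \<longlonglongrightarrow> (LINT w|L. F w * \<phi>' t0 w)"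
    proof (rule integral_dominated_convergence[where w = "\<lambda>w. B * \<bar>F w\<bar>"])
      show "(\<lambda>w. F w * \<phi>' t0 w) \<in> borel_measurable L"
        by (rule borel_measurable_LIMSEQ_real[OF lim m])
      show "integrable L (\<lambda>w. B * \<bar>F w\<bar>)" using F by simp
      show "AE w in L. (\<lambda>i. F w * ((\<phi> (X i) w - \<phi> t0 w) / (X i - t0))) \<longlonglongrightarrow> F w * \<phi>' t0 w"
        using lim by simp
      show "AE w in L. norm (F w * ((\<phi> (X i) w - \<phi> t0 w) / (X i - t0))) \<le> B * \<bar>F w\<bar>" for i
      proof (intro AE_I2)
        fix w
        have "\<bar>(\<phi> (X i) w - \<phi> t0 w) / (X i - t0)\<bar> \<le> B"
          using lip[of "X i" w] X(1) by (simp add: abs_divide divide_le_eq)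
        from mult_left_mono[OF this, of "\<bar>F w\<bar>"]
        show "norm (F w * ((\<phi> (X i) w - \<phi> t0 w) / (X i - t0))) \<le> B * \<bar>F w\<bar>"
          by (simp add: abs_mult mult.commute)
      qed
    qed (rule m)
  qed
  then show ?thesis unfolding has_field_derivative_iff quot .
qed

section \<open>The two bounds for one dyadic step of the mollification\<close>

context mollifier
begin

lemma M_nonneg: "0 \<le> M"
  using bump_b unfolding bump_def by (meson abs_ge_zero order_trans)

definition mollify :: "(real^'n::finite \<Rightarrow> real) \<Rightarrow> real^'n \<Rightarrow> real \<Rightarrow> real"
  where "mollify f y r = (LINT w|lebesgue. f w * tker (\<lambda>_. a 0) y r w) / r ^ CARD('n)"

lemma mollify_diff_const:
  fixes f :: "real^'n::finite \<Rightarrow> real"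
  assumes f: "f \<in> L1_loc" and r: "r > 0"
  shows "ennreal \<bar>mollify f y r - c\<bar> \<le> ennreal (M ^ CARD('n) / r ^ CARD('n)) * (\<integral>\<^sup>+w\<in>corner_cube y r. ennreal \<bar>f w - c\<bar> \<partial>lebesgue)"
proof -
  let ?I = "LINT w|lebesgue. (f w - c) * tker (\<lambda>_. a 0) y r w"
  have rn: "r ^ CARD('n) > 0" using r by simp
  have "mollify f y r - c = ?I / r ^ CARD('n)"
    unfolding mollify_def tker_integral_diff_const[OF L1_loc_cbox[OF f] bump_a[of 0] int_a r, simplified]
    using r by (simp add: diff_divide_distrib)
  then have "ennreal \<bar>mollify f y r - c\<bar> = ennreal (1 / r ^ CARD('n)) * ennreal \<bar>?I\<bar>"
    using rn by (simp add: abs_divide flip: ennreal_mult)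
  also have "\<dots> \<le> ennreal (1 / r ^ CARD('n)) * (ennreal (M ^ CARD('n)) * (\<integral>\<^sup>+w\<in>corner_cube y r. ennreal \<bar>f w - c\<bar> \<partial>lebesgue))"
    by (intro mult_left_mono tker_nn_integral_bound[of y r "\<lambda>w. f w - c" M] L1_loc_cbox L1_loc_diff_const f r)
      (use bump_a[of 0] in auto)
  also have "\<dots> = ennreal (M ^ CARD('n) / r ^ CARD('n)) * (\<integral>\<^sup>+w\<in>corner_cube y r. ennreal \<bar>f w - c\<bar> \<partial>lebesgue)"
    using rn M_nonneg by (simp flip: mult.assoc ennreal_mult)
  finally show ?thesis .
qed

text \<open>Both mollifications are compared with c. Cubes with the same corner are nested, and the
  smaller volume of the half cube accounts for the additional 2^n.\<close>

lemma mollify_step_const: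
  fixes f :: "real^'n::finite \<Rightarrow> real"
  assumes f: "f \<in> L1_loc" and r: "r > 0"
  shows "ennreal \<bar>mollify f y (r / 2) - mollify f y r\<bar>
    \<le> ennreal ((2 * M) ^ CARD('n) * 2 / r ^ CARD('n)) * (\<integral>\<^sup>+w\<in>corner_cube y r. ennreal \<bar>f w - c\<bar> \<partial>lebesgue)"
proof -
  let ?n = "CARD('n)" and ?I = "\<integral>\<^sup>+w\<in>corner_cube y r. ennreal \<bar>f w - c\<bar> \<partial>lebesgue"
  have rn: "r ^ ?n > 0" using r by simp
  have "(\<integral>\<^sup>+w\<in>corner_cube y (r / 2). ennreal \<bar>f w - c\<bar> \<partial>lebesgue) \<le> ?I"
  proof (rule nn_set_integral_mono)
    show "corner_cube y (r / 2) \<subseteq> corner_cube y r"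
    proof (clarsimp simp: mem_box_cart)
      fix w i assume "\<forall>i. y $ i \<le> w $ i \<and> w $ i \<le> y $ i + r / 2"
      then have "w $ i \<le> y $ i + r / 2" by blast
      then show "w $ i \<le> y $ i + r" using r by linarith
    qed
  qed simp
  then have 1: "ennreal \<bar>mollify f y (r / 2) - c\<bar> \<le> ennreal ((2 * M) ^ ?n / r ^ ?n) * ?I"
    using mollify_diff_const[OF f, of "r / 2" y c] r
    by (auto simp: power_mult_distrib power_divide mult_ac elim!: order_trans intro: mult_left_mono)
  have "M ^ ?n \<le> (2 * M) ^ ?n" using M_nonneg by (intro power_mono) auto
  then have "ennreal (M ^ ?n / r ^ ?n) * ?I \<le> ennreal ((2 * M) ^ ?n / r ^ ?n) * ?I"
    using rn by (intro mult_right_mono ennreal_leI divide_right_mono) auto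
  then have 2: "ennreal \<bar>mollify f y r - c\<bar> \<le> ennreal ((2 * M) ^ ?n / r ^ ?n) * ?I"
    using mollify_diff_const[OF f r, of y c] by (rule order_trans[rotated])
  have "ennreal \<bar>mollify f y (r / 2) - mollify f y r\<bar> \<le> ennreal (\<bar>mollify f y (r / 2) - c\<bar> + \<bar>mollify f y r - c\<bar>)"
    by (intro ennreal_leI) linarith
  also have "\<dots> = ennreal \<bar>mollify f y (r / 2) - c\<bar> + ennreal \<bar>mollify f y r - c\<bar>" by simp
  also have "\<dots> \<le> ennreal ((2 * M) ^ ?n / r ^ ?n) * ?I + ennreal ((2 * M) ^ ?n / r ^ ?n) * ?I"
    by (intro add_mono 1 2)
  also have "\<dots> = ennreal ((2 * M) ^ ?n * 2 / r ^ ?n) * ?I"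
  proof -
    have "ennreal ((2 * M) ^ ?n * 2 / r ^ ?n) = ennreal ((2 * M) ^ ?n / r ^ ?n) + ennreal ((2 * M) ^ ?n / r ^ ?n)"
      using rn M_nonneg by (subst ennreal_plus[symmetric]) auto
    then show ?thesis by (simp add: distrib_right)
  qed
  finally show ?thesis .
qed

definition a2 :: "nat \<Rightarrow> real \<Rightarrow> real" where "a2 m x = 2 * (2 ^ m * a m (2 * x + 0))"

lemma a2: "bump_chain a2" "bump M (a2 0)"
proof -
  show "bump M (a2 0)" using bump_a2 by (simp add: a2_def[abs_def])
  moreover have "deriv_chain a2"
    unfolding a2_def[abs_def] using a by (intro deriv_chain_cmult deriv_chain_scale) (simp add: bump_chain_def)
  ultimately show "bump_chain a2" by (intro bump_chainI) (auto simp: bump_def)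
qed

text \<open>The k derivatives may be distributed over the coordinates in any way: the dyadic step
  uses all of them in one coordinate, finite differences use every distribution.\<close>

lemma weak_deriv_tker_bound:
  fixes f :: "real^'n::finite \<Rightarrow> real"
  assumes f: "f \<in> Sobolev1_loc k" and r: "r > 0" and l: "length is = k"
    and U: "\<And>i. bump_chain (U i)" "\<And>i. bump M (U i 0)"
  shows "ennreal \<bar>LINT w|lebesgue. f w * tker (\<lambda>i. U i (count_list is i)) y r w\<bar>
    \<le> ennreal (r ^ k * M ^ CARD('n)) * (\<integral>\<^sup>+w\<in>corner_cube y r. ennreal (norm_nabla k f w) \<partial>lebesgue)"
proof -
  let ?g = "weak_deriv (count_list is) f" and ?N = "\<integral>\<^sup>+w\<in>corner_cube y r. ennreal (norm_nabla k f w) \<partial>lebesgue"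
  have s: "(\<Sum>i\<in>(UNIV::'n set). count_list is i) = k" by (simp add: sum_count_list_UNIV l)
  then have g: "?g \<in> L1_loc" "has_weak_deriv UNIV (count_list is) f ?g"
    using weak_deriv_props[OF f, of "count_list is"] by auto
  have "(LINT w|lebesgue. f w * tker (\<lambda>i. U i (count_list is i)) y r w)
      = (- r) ^ k * (LINT w|lebesgue. ?g w * tker (\<lambda>i. U i 0) y r w)"
    using weak_deriv_tker[of UNIV "is" f ?g U r y, OF g(2) U(1) r] l by simp
  then have "ennreal \<bar>LINT w|lebesgue. f w * tker (\<lambda>i. U i (count_list is i)) y r w\<bar>
      = ennreal (r ^ k) * ennreal \<bar>LINT w|lebesgue. ?g w * tker (\<lambda>i. U i 0) y r w\<bar>"
    using r by (simp add: abs_mult power_abs flip: ennreal_mult)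
  also have "\<dots> \<le> ennreal (r ^ k) * (ennreal (M ^ CARD('n)) * (\<integral>\<^sup>+w\<in>corner_cube y r. ennreal \<bar>?g w\<bar> \<partial>lebesgue))"
    using tker_nn_integral_bound[of y r ?g M "\<lambda>i. U i 0", OF L1_loc_cbox[OF g(1)] U(2) r]
    by (intro mult_left_mono) auto
  also have "\<dots> \<le> ennreal (r ^ k) * (ennreal (M ^ CARD('n)) * ?N)"
    using abs_weak_deriv_le_norm_nabla[OF s]
    by (intro mult_left_mono nn_set_integral_mono ennreal_leI) auto
  also have "\<dots> = ennreal (r ^ k * M ^ CARD('n)) * ?N"
    using r M_nonneg by (simp add: ennreal_mult mult.assoc)
  finally show ?thesis .
qed

text \<open>The kernel at scale r / 2 is 2^(-n) times the tensor product of the profiles 2 a(2 x) at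
  scale r. Converting the product coordinate by coordinate produces n differences, each having the
  k-th derivative of \<open>b\<close> in one factor.\<close>

lemma mollify_step_nabla:
  fixes f :: "real^'n::finite \<Rightarrow> real"
  assumes f: "f \<in> Sobolev1_loc k" and r: "r > 0"
  shows "ennreal \<bar>mollify f y (r / 2) - mollify f y r\<bar>
    \<le> ennreal (real CARD('n) * M ^ CARD('n) * r ^ k / r ^ CARD('n)) * (\<integral>\<^sup>+w\<in>corner_cube y r. ennreal (norm_nabla k f w) \<partial>lebesgue)"
proof -
  let ?n = "CARD('n)" and ?N = "\<integral>\<^sup>+w\<in>corner_cube y r. ennreal (norm_nabla k f w) \<partial>lebesgue"
  \<comment> \<open>\<open>S\<close> is the set of coordinates already converted to the profile of
    scale r / 2.\<close>
  define u where "u S i = (if i \<in> S then a2 0 else a 0)" for S and i :: 'n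
  define I where "I S = (LINT w|lebesgue. f w * tker (u S) y r w)" for S
  note fL = Sobolev1_locD(1)[OF f]
  have bump_u: "bump M (u S i)" for S i using bump_a[of 0] a2 by (simp add: u_def)
  have int: "integrable lebesgue (\<lambda>w. f w * tker (u S) y r w)" for S
    by (rule tker_integrable[OF L1_loc_cbox[OF fL] bump_u r])
  have step: "ennreal \<bar>I (insert j S) - I S\<bar> \<le> ennreal (r ^ k * M ^ ?n) * ?N" if j: "j \<notin> S" for j S
  proof -
    \<comment> \<open>The list \<open>replicate k j\<close> differentiates the j-th profile k times,
      which gives \<open>b k\<close>, and leaves the other factors as they are.\<close>
    define U where "U i = (if i = j then b else if i \<in> S then a2 else a)" for i
    have U: "bump_chain (U i)" "bump M (U i 0)" for i
      using a b a2 bump_b bump_a[of 0] by (simp_all add: U_def)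
    have rep: "count_list (replicate m j) i = (if i = j then m else 0)" for m i
      by (induction m) auto
    have "tker (u (insert j S)) y r w - tker (u S) y r w = tker (\<lambda>i. U i (count_list (replicate k j) i)) y r w" for w
    proof -
      let ?t = "\<lambda>i. (w $ i - y $ i) / r"
      have "tker (u (insert j S)) y r w = a2 0 (?t j) * (\<Prod>i\<in>UNIV - {j}. u S i (?t i))"
        unfolding tker_def by (subst prod.remove[of _ j]) (auto simp: u_def intro!: prod.cong)
      moreover have "tker (u S) y r w = a 0 (?t j) * (\<Prod>i\<in>UNIV - {j}. u S i (?t i))"
        unfolding tker_def by (subst prod.remove[of _ j]) (use j in \<open>auto simp: u_def\<close>)
      moreover have "tker (\<lambda>i. U i (count_list (replicate k j) i)) y r w = b k (?t j) * (\<Prod>i\<in>UNIV - {j}. u S i (?t i))"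
      proof -
        have "U i (count_list (replicate k j) i) = u S i" if "i \<noteq> j" for i
          using that by (auto simp: u_def U_def rep)
        moreover have "U j (count_list (replicate k j) j) = b k" by (simp add: U_def rep)
        ultimately show ?thesis unfolding tker_def by (subst prod.remove[of _ j]) auto
      qed
      ultimately show ?thesis by (simp add: b_k a2_def left_diff_distrib)
    qed
    then have "I (insert j S) - I S = (LINT w|lebesgue. f w * tker (\<lambda>i. U i (count_list (replicate k j) i)) y r w)"
      unfolding I_def using int by (simp flip: Bochner_Integration.integral_diff right_diff_distrib)
    then show ?thesis using weak_deriv_tker_bound[of f r "replicate k j" U y, OF f r _ U] by simp
  qed
  have sum: "ennreal \<bar>I S - I {}\<bar> \<le> of_nat (card S) * (ennreal (r ^ k * M ^ ?n) * ?N)" if "finite S" for S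
    using that
  proof induction
    case (insert j S)
    have "ennreal \<bar>I (insert j S) - I {}\<bar> \<le> ennreal (\<bar>I (insert j S) - I S\<bar> + \<bar>I S - I {}\<bar>)"
      by (intro ennreal_leI) linarith
    also have "\<dots> \<le> ennreal (r ^ k * M ^ ?n) * ?N + of_nat (card S) * (ennreal (r ^ k * M ^ ?n) * ?N)"
      using step[OF insert(2)] insert.IH by (simp add: add_mono)
    also have "\<dots> = of_nat (card (insert j S)) * (ennreal (r ^ k * M ^ ?n) * ?N)"
      using insert by (simp add: distrib_right)
    finally show ?case .
  qed simp
  have "(\<Prod>i\<in>UNIV. 2 * a 0 (2 * ((w $ i - y $ i) / r))) = 2 ^ ?n * tker (\<lambda>_. a 0) y (r / 2) w" for w
    by (simp add: tker_def prod.distrib mult.commute)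
  then have "f w * tker (u UNIV) y r w = 2 ^ ?n * (f w * tker (\<lambda>_. a 0) y (r / 2) w)" for w
    by (simp only: u_def tker_def[of "u UNIV"] a2_def if_True UNIV_I power_0 mult_1_left add_0_right mult.left_commute)
  then have IU: "I UNIV = 2 ^ ?n * (LINT w|lebesgue. f w * tker (\<lambda>_. a 0) y (r / 2) w)"
    unfolding I_def by (simp only: integral_mult_right_zero)
  then have "mollify f y (r / 2) - mollify f y r = (I UNIV - I {}) / r ^ ?n"
  proof -
    have "u {} = (\<lambda>_. a 0)" by (auto simp: u_def)
    then have "mollify f y r = I {} / r ^ ?n" by (simp add: mollify_def I_def)
    moreover have "mollify f y (r / 2) = I UNIV / r ^ ?n"
      unfolding IU mollify_def using r by (simp add: power_divide)
    ultimately show ?thesis by (simp add: diff_divide_distrib)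
  qed
  then have "ennreal \<bar>mollify f y (r / 2) - mollify f y r\<bar> = ennreal (1 / r ^ ?n) * ennreal \<bar>I UNIV - I {}\<bar>"
    using r by (simp add: abs_divide flip: ennreal_mult)
  also have "\<dots> \<le> ennreal (1 / r ^ ?n) * (of_nat ?n * (ennreal (r ^ k * M ^ ?n) * ?N))"
    using sum[of UNIV] by (intro mult_left_mono) auto
  also have "\<dots> = ennreal (1 / r ^ ?n * (real ?n * (r ^ k * M ^ ?n))) * ?N"
  proof -
    have "ennreal (1 / r ^ ?n * (real ?n * (r ^ k * M ^ ?n)))
        = ennreal (1 / r ^ ?n) * ennreal (real ?n * (r ^ k * M ^ ?n))"
      using r M_nonneg by (intro ennreal_mult) auto
    also have "ennreal (real ?n * (r ^ k * M ^ ?n)) = of_nat ?n * ennreal (r ^ k * M ^ ?n)"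
      using r M_nonneg unfolding ennreal_of_nat_eq_real_of_nat by (intro ennreal_mult) auto
    finally show ?thesis by (simp only: mult.assoc)
  qed
  also have "1 / r ^ ?n * (real ?n * (r ^ k * M ^ ?n)) = real ?n * M ^ ?n * r ^ k / r ^ ?n"
    by simp
  finally show ?thesis .
qed


section \<open>Finite differences of the mollified function along a line\<close>

definition line_conv :: "(real^'n::finite \<Rightarrow> real) \<Rightarrow> real^'n \<Rightarrow> real^'n \<Rightarrow> real \<Rightarrow> 'n list \<Rightarrow> real \<Rightarrow> real"
  where "line_conv f x h r is t = (LINT w|lebesgue. f w * tker (\<lambda>i. a (count_list is i)) (x + t *\<^sub>R h) r w)"

text \<open>The parameter t enters through the kernel argument (w - x - t h) / r only, so
  differentiation raises the order of one profile at the price -h_i / r; the list records the orders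
  reached so far.\<close>

lemma line_conv_DERIV:
  fixes f :: "real^'n::finite \<Rightarrow> real"
  assumes f: "f \<in> L1_loc" and r: "r > 0" and l: "length is < k"
  shows "(line_conv f x h r is has_real_derivative (\<Sum>i\<in>UNIV. - h $ i / r * line_conv f x h r (i # is) t0)) (at t0)"
proof -
  \<comment> \<open>For t within distance 1 of \<open>t0\<close> all supports lie in the ball of
    radius \<open>R\<close>, so \<open>f\<close> can be replaced by its integrable truncation
    \<open>F\<close>.\<close>
  define R where "R = norm x + (\<bar>t0\<bar> + 1) * norm h + real CARD('n) * r"
  define F where "F w = indicat_real (cball 0 R) w *\<^sub>R f w" for w
  have F: "integrable lebesgue F"
    using f by (simp add: L1_loc_def set_integrable_def F_def[abs_def])
  let ?T = "\<lambda>is t. tker (\<lambda>i. a (count_list is i)) (x + t *\<^sub>R h) r"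
  have cnt: "count_list is i \<le> length is" for "is" and i :: 'n by (induction "is") auto
  have bump: "bump M (a (count_list is i))" if "length is \<le> k" for "is" and i :: 'n
    using bump_a cnt[of "is" i] that by simp
  have Feq: "f w * ?T is t w = F w * ?T is t w" if t: "\<bar>t - t0\<bar> \<le> 1" for t "is" w
  proof (cases "w \<in> corner_cube (x + t *\<^sub>R h) r")
    case True
    have "norm w \<le> norm (x + t *\<^sub>R h) + norm (w - (x + t *\<^sub>R h))"
      using norm_triangle_ineq[of "x + t *\<^sub>R h" "w - (x + t *\<^sub>R h)"] by simp
    also have "\<dots> \<le> (norm x + \<bar>t\<bar> * norm h) + real CARD('n) * r"
      using norm_triangle_ineq[of x "t *\<^sub>R h"] norm_corner_cube[OF True] by (intro add_mono) auto
    also have "\<dots> \<le> R" using t r unfolding R_def by (intro add_mono mult_right_mono) auto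
    finally show ?thesis by (simp add: F_def)
  next
    case False
    have "?T is t w = 0" by (rule tker_outside[OF _ r False]) (use a in \<open>auto simp: bump_chain_def\<close>)
    then show ?thesis by simp
  qed
  have lc: "line_conv f x h r is t = (LINT w|lebesgue. F w * ?T is t w)" if "\<bar>t - t0\<bar> \<le> 1" for "is" t
    unfolding line_conv_def Feq[OF that] ..
  then have lc0: "line_conv f x h r is t0 = (LINT w|lebesgue. F w * ?T is t0 w)" for "is" by simp
  have d: "((\<lambda>t. ?T is t w) has_real_derivative (\<Sum>i\<in>UNIV. - h $ i / r * ?T (i # is) t w)) (at t)" for t w
  proof -
    let ?s = "\<lambda>i t. (w $ i - (x + t *\<^sub>R h) $ i) / r"
    have s: "((\<lambda>t. ?s i t) has_real_derivative - h $ i / r) (at t)" for i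
    proof -
      have "(\<lambda>t. ?s i t) = (\<lambda>t. - h $ i / r * t + (w $ i - x $ i) / r)"
        by (rule ext) (simp add: diff_divide_distrib add_divide_distrib)
      then show ?thesis using r by (auto intro!: derivative_eq_intros)
    qed
    have "((\<lambda>t. a (count_list is i) (?s i t)) has_real_derivative a (Suc (count_list is i)) (?s i t) * (- h $ i / r)) (at t)" for i
      by (rule DERIV_chain2[OF deriv_chain_DERIV s]) (use a in \<open>simp add: bump_chain_def\<close>)
    then have "((\<lambda>t. \<Prod>i\<in>UNIV. a (count_list is i) (?s i t)) has_real_derivative
        (\<Sum>i\<in>UNIV. (a (Suc (count_list is i)) (?s i t) * (- h $ i / r)) * (\<Prod>j\<in>UNIV - {i}. a (count_list is j) (?s j t)))) (at t)"
      by (intro has_field_derivative_prod) auto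
    moreover have "?T (i # is) t w = a (Suc (count_list is i)) (?s i t) * (\<Prod>j\<in>UNIV - {i}. a (count_list is j) (?s j t))" for i
      unfolding tker_def by (subst prod.remove[of _ i]) (auto intro!: prod.cong)
    ultimately show ?thesis by (simp add: tker_def mult_ac)
  qed
  have meas: "?T is t \<in> borel_measurable lebesgue" if "length is \<le> k" for "is" t
    using tker_cont[of "\<lambda>i. a (count_list is i)" "x + t *\<^sub>R h" r] bump[OF that]
    by (intro measurable_completion) (auto simp: bump_def intro: borel_measurable_continuous_onI)
  have bd: "\<bar>?T is t w\<bar> \<le> M ^ CARD('n)" if "length is \<le> k" for "is" t w
    by (rule tker_bound) (use bump[OF that] in \<open>simp add: bump_def\<close>)
  have int: "integrable lebesgue (\<lambda>w. F w * ?T is t w)" if "length is \<le> k" for "is" t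
  proof (rule Bochner_Integration.integrable_bound)
    show "integrable lebesgue (\<lambda>w. M ^ CARD('n) * F w)" using F by simp
    show "(\<lambda>w. F w * ?T is t w) \<in> borel_measurable lebesgue" using F meas[OF that] by measurable
    show "AE w in lebesgue. norm (F w * ?T is t w) \<le> norm (M ^ CARD('n) * F w)"
      using mult_right_mono[OF bd[OF that], of "\<bar>F _\<bar>"] M_nonneg by (intro AE_I2) (simp add: abs_mult mult.commute)
  qed
  have "((\<lambda>t. LINT w|lebesgue. F w * ?T is t w) has_real_derivative (LINT w|lebesgue. F w * (\<Sum>i\<in>UNIV. - h $ i / r * ?T (i # is) t0 w))) (at t0)"
  proof (rule has_real_derivative_integral[OF F d])
    show "integrable lebesgue (\<lambda>w. F w * ?T is t w)" for t using int l by simp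
    show "\<bar>\<Sum>i\<in>UNIV. - h $ i / r * ?T (i # is) t w\<bar> \<le> (\<Sum>i\<in>UNIV. \<bar>h $ i / r\<bar> * M ^ CARD('n))" for t w
    proof (intro order_trans[OF sum_abs] sum_mono)
      fix i
      show "\<bar>- h $ i / r * ?T (i # is) t w\<bar> \<le> \<bar>h $ i / r\<bar> * M ^ CARD('n)"
        unfolding abs_mult by (intro mult_mono bd) (use l M_nonneg in auto)
    qed
  qed
  moreover have "(LINT w|lebesgue. F w * (\<Sum>i\<in>UNIV. - h $ i / r * ?T (i # is) t0 w))
      = (\<Sum>i\<in>UNIV. - h $ i / r * line_conv f x h r (i # is) t0)"
  proof -
    have "(LINT w|lebesgue. F w * (\<Sum>i\<in>UNIV. - h $ i / r * ?T (i # is) t0 w))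
        = (LINT w|lebesgue. (\<Sum>i\<in>UNIV. - h $ i / r * (F w * ?T (i # is) t0 w)))"
      by (simp add: sum_distrib_left mult.left_commute)
    also have "\<dots> = (\<Sum>i\<in>UNIV. - h $ i / r * (LINT w|lebesgue. F w * ?T (i # is) t0 w))"
    proof -
      have "integrable lebesgue (\<lambda>w. - h $ i / r * (F w * ?T (i # is) t0 w))" for i
        by (intro integrable_mult_right int) (use l in simp)
      then show ?thesis
        by (subst Bochner_Integration.integral_sum) (simp_all only: integral_mult_right_zero)
    qed
    finally show ?thesis unfolding lc0 .
  qed
  ultimately have "((\<lambda>t. LINT w|lebesgue. F w * ?T is t w) has_real_derivative (\<Sum>i\<in>UNIV. - h $ i / r * line_conv f x h r (i # is) t0)) (at t0)"
    by simp
  then show ?thesis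
    by (rule has_field_derivative_transform_within_open[of _ _ _ "ball t0 1"])
      (auto simp: dist_real_def abs_minus_commute intro!: lc[symmetric])
qed

definition fwd_diff :: "nat \<Rightarrow> (real \<Rightarrow> real) \<Rightarrow> real \<Rightarrow> real"
  where "fwd_diff m g u = (\<Sum>j=0..m. (-1) ^ (m - j) * real (m choose j) * g (u + real j))"

text \<open>Pascal's rule; it allows the mean value theorem to be used on one unit step at a
  time.\<close>

lemma fwd_diff_Suc: "fwd_diff (Suc m) g u = fwd_diff m g (u + 1) - fwd_diff m g u"
proof -
  let ?c = "\<lambda>m j. (-1) ^ (m - j) * real (m choose j)"
  have 1: "fwd_diff (Suc m) g u = (- 1) ^ Suc m * g u
      + (\<Sum>j=0..m. ((-1) ^ (m - j) * real (m choose j) + (-1) ^ (m - j) * real (m choose Suc j)) * g (u + real (Suc j)))"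
    unfolding fwd_diff_def sum.atLeast0_atMost_Suc_shift by (simp add: distrib_left)
  have 2: "fwd_diff m g u = (- 1) ^ m * g u - (\<Sum>j=0..m. (-1) ^ (m - j) * real (m choose Suc j) * g (u + real (Suc j)))"
  proof (cases m)
    case (Suc p)
    have "(\<Sum>j=0..p. (-1) ^ (p - j) * real (m choose Suc j) * g (u + real (Suc j)))
       = - (\<Sum>j=0..p. (-1) ^ (m - j) * real (m choose Suc j) * g (u + real (Suc j)))"
      unfolding sum_negf[symmetric] by (intro sum.cong) (auto simp: Suc Suc_diff_le)
    moreover have "(\<Sum>j=0..m. (-1) ^ (m - j) * real (m choose Suc j) * g (u + real (Suc j)))
       = (\<Sum>j=0..p. (-1) ^ (m - j) * real (m choose Suc j) * g (u + real (Suc j)))"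
      by (simp add: Suc binomial_eq_0)
    ultimately show ?thesis unfolding fwd_diff_def Suc sum.atLeast0_atMost_Suc_shift by simp
  qed (simp add: fwd_diff_def)
  have 3: "fwd_diff m g (u + 1) = (\<Sum>j=0..m. (-1) ^ (m - j) * real (m choose j) * g (u + real (Suc j)))"
    unfolding fwd_diff_def by (intro sum.cong refl) (simp add: add_ac)
  show ?thesis unfolding 1 2 3 by (simp add: distrib_right sum.distrib)
qed

lemma fwd_diff_DERIV:
  assumes "\<And>t. (g has_real_derivative g' t) (at t)"
  shows "(fwd_diff m g has_real_derivative fwd_diff m g' t) (at t)"
  unfolding fwd_diff_def[abs_def]
proof (intro DERIV_sum DERIV_cmult)
  fix j show "((\<lambda>u. g (u + real j)) has_real_derivative g' (t + real j)) (at t)"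
    using DERIV_shift[of g "g' (t + real j)" t "real j"] assms by simp
qed

lemma fwd_diff_sum: "fwd_diff m (\<lambda>t. \<Sum>i\<in>A. c i * g i t) u = (\<Sum>i\<in>A. c i * fwd_diff m (g i) u)"
  unfolding fwd_diff_def sum_distrib_left by (subst sum.swap) (simp add: mult_ac)

text \<open>The mean value theorem trades one difference for one derivative of the kernel. By the
  invariant \<open>length is + m = k\<close> exactly k derivatives have been collected when no
  difference is left, and the intermediate points stay in [0, k], where \<open>K\<close> is a
  bound.\<close>

lemma fwd_diff_line_conv:
  fixes f :: "real^'n::finite \<Rightarrow> real"
  assumes f: "f \<in> L1_loc" and r: "r > 0" and K0: "K \<ge> 0"
    and K: "\<And>is t. length is = k \<Longrightarrow> 0 \<le> t \<Longrightarrow> t \<le> real k \<Longrightarrow> \<bar>line_conv f x h r is t\<bar> \<le> K"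
  shows "length is + m = k \<Longrightarrow> 0 \<le> u \<Longrightarrow> u + real m \<le> real k \<Longrightarrow>
    \<bar>fwd_diff m (line_conv f x h r is) u\<bar> \<le> (real CARD('n) * norm h / r) ^ m * K"
proof (induction m arbitrary: "is" u)
  case 0
  then show ?case using K[of "is" u] by (simp add: fwd_diff_def)
next
  case (Suc m)
  let ?g' = "\<lambda>t. \<Sum>i\<in>UNIV. - h $ i / r * line_conv f x h r (i # is) t"
  have "length is < k" using Suc.prems by simp
  note d = fwd_diff_DERIV[OF line_conv_DERIV[OF f r this, of x h], of m]
  obtain z where z: "z > u" "z < u + 1" "fwd_diff m (line_conv f x h r is) (u + 1) - fwd_diff m (line_conv f x h r is) u
      = (u + 1 - u) * fwd_diff m ?g' z"
    using MVT2[of u "u + 1" "fwd_diff m (line_conv f x h r is)" "fwd_diff m ?g'"] d by auto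
  then have "\<bar>fwd_diff (Suc m) (line_conv f x h r is) u\<bar> = \<bar>\<Sum>i\<in>UNIV. - h $ i / r * fwd_diff m (line_conv f x h r (i # is)) z\<bar>"
    unfolding fwd_diff_Suc by (subst (asm) fwd_diff_sum) simp
  also have "\<dots> \<le> (\<Sum>i\<in>(UNIV::'n set). norm h / r * ((real CARD('n) * norm h / r) ^ m * K))"
  proof (intro order_trans[OF sum_abs] sum_mono)
    fix i :: 'n
    have "\<bar>fwd_diff m (line_conv f x h r (i # is)) z\<bar> \<le> (real CARD('n) * norm h / r) ^ m * K"
      by (rule Suc.IH) (use Suc.prems z in auto)
    then show "\<bar>- h $ i / r * fwd_diff m (line_conv f x h r (i # is)) z\<bar> \<le> norm h / r * ((real CARD('n) * norm h / r) ^ m * K)"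
      unfolding abs_mult using r component_le_norm_cart[of h i] by (intro mult_mono) (auto simp: divide_right_mono)
  qed
  also have "\<dots> = (real CARD('n) * norm h / r) ^ Suc m * K" by simp
  finally show ?case .
qed

text \<open>The r^(-k) from differentiating the kernel k times cancels the r^k from the integration
  by parts, and |h|^k remains. Finiteness of the integral over \<open>S\<close> lets the mean value
  argument run with a real bound.\<close>

lemma fdiff_mollify_nabla:
  fixes f :: "real^'n::finite \<Rightarrow> real"
  assumes f: "f \<in> Sobolev1_loc k" and r: "r > 0"
    and S: "\<And>t. 0 \<le> t \<Longrightarrow> t \<le> real k \<Longrightarrow> corner_cube (x + t *\<^sub>R h) r \<subseteq> S"
    and fin: "(\<integral>\<^sup>+w\<in>S. ennreal (norm_nabla k f w) \<partial>lebesgue) < top"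
  shows "ennreal \<bar>fdiff k h (\<lambda>y. mollify f y r) x\<bar>
    \<le> ennreal ((real CARD('n) * norm h) ^ k * M ^ CARD('n) / r ^ CARD('n)) * (\<integral>\<^sup>+w\<in>S. ennreal (norm_nabla k f w) \<partial>lebesgue)"
proof -
  let ?n = "CARD('n)"
  obtain I where I: "I \<ge> 0" "(\<integral>\<^sup>+w\<in>S. ennreal (norm_nabla k f w) \<partial>lebesgue) = ennreal I"
    using fin by (cases "\<integral>\<^sup>+w\<in>S. ennreal (norm_nabla k f w) \<partial>lebesgue" rule: ennreal_cases) auto
  let ?K = "r ^ k * M ^ ?n * I"
  note fL = Sobolev1_locD(1)[OF f]
  have K: "\<bar>line_conv f x h r is t\<bar> \<le> ?K" if l: "length is = k" and t: "0 \<le> t" "t \<le> real k" for "is" t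
  proof -
    have "ennreal \<bar>line_conv f x h r is t\<bar>
        \<le> ennreal (r ^ k * M ^ ?n) * (\<integral>\<^sup>+w\<in>corner_cube (x + t *\<^sub>R h) r. ennreal (norm_nabla k f w) \<partial>lebesgue)"
      unfolding line_conv_def using a bump_a[of 0] by (intro weak_deriv_tker_bound f r l) auto
    also have "\<dots> \<le> ennreal (r ^ k * M ^ ?n) * ennreal I"
      unfolding I(2)[symmetric] by (intro mult_left_mono nn_set_integral_mono S t) auto
    also have "\<dots> = ennreal ?K"
      using r M_nonneg I(1) by (simp add: ennreal_mult)
    finally show ?thesis using r M_nonneg I(1) by (subst (asm) ennreal_le_iff) auto
  qed
  have "fdiff k h (\<lambda>y. mollify f y r) x = fwd_diff k (line_conv f x h r []) 0 / r ^ ?n"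
    by (simp add: fdiff_def fwd_diff_def mollify_def line_conv_def sum_divide_distrib)
  moreover have "\<bar>fwd_diff k (line_conv f x h r []) 0\<bar> \<le> (real ?n * norm h / r) ^ k * ?K"
    by (rule fwd_diff_line_conv[OF fL r _ K]) (use r M_nonneg I(1) in auto)
  ultimately have "\<bar>fdiff k h (\<lambda>y. mollify f y r) x\<bar> \<le> (real ?n * norm h / r) ^ k * ?K / r ^ ?n"
    using r by (simp add: abs_divide divide_right_mono)
  also have "\<dots> = (real ?n * norm h) ^ k * M ^ ?n / r ^ ?n * I"
    using r by (simp add: power_divide)
  finally have "ennreal \<bar>fdiff k h (\<lambda>y. mollify f y r) x\<bar> \<le> ennreal ((real ?n * norm h) ^ k * M ^ ?n / r ^ ?n * I)"
    by (rule ennreal_leI)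
  also have "ennreal ((real ?n * norm h) ^ k * M ^ ?n / r ^ ?n * I) = ennreal ((real ?n * norm h) ^ k * M ^ ?n / r ^ ?n) * ennreal I"
    using r M_nonneg I(1) by (intro ennreal_mult) auto
  finally show ?thesis unfolding I(2) .
qed

text \<open>Differences of order at least 1 annihilate c, and 2^k is the sum of the binomial
  coefficients.\<close>

lemma fdiff_mollify_const:
  fixes f :: "real^'n::finite \<Rightarrow> real"
  assumes f: "f \<in> L1_loc" and r: "r > 0" and k: "k \<ge> 1"
    and S: "\<And>t. 0 \<le> t \<Longrightarrow> t \<le> real k \<Longrightarrow> corner_cube (x + t *\<^sub>R h) r \<subseteq> S"
  shows "ennreal \<bar>fdiff k h (\<lambda>y. mollify f y r) x\<bar>
    \<le> ennreal (2 ^ k * M ^ CARD('n) / r ^ CARD('n)) * (\<integral>\<^sup>+w\<in>S. ennreal \<bar>f w - c\<bar> \<partial>lebesgue)"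
proof -
  let ?n = "CARD('n)" and ?I = "\<integral>\<^sup>+w\<in>S. ennreal \<bar>f w - c\<bar> \<partial>lebesgue"
  let ?G = "\<lambda>j. mollify f (x + real j *\<^sub>R h) r"
  have "fdiff k h (\<lambda>y. mollify f y r) x = fdiff k h (\<lambda>y. mollify f y r - c) x"
    by (simp add: fdiff_diff fdiff_const[OF k])
  also have "\<dots> = (\<Sum>j=0..k. (-1) ^ (k - j) * real (k choose j) * (?G j - c))"
    by (simp add: fdiff_def)
  finally have "\<bar>fdiff k h (\<lambda>y. mollify f y r) x\<bar> \<le> (\<Sum>j=0..k. real (k choose j) * \<bar>?G j - c\<bar>)"
    by (auto intro!: order_trans[OF sum_abs] sum_mono simp: abs_mult power_abs)
  then have "ennreal \<bar>fdiff k h (\<lambda>y. mollify f y r) x\<bar> \<le> (\<Sum>j=0..k. ennreal (real (k choose j)) * ennreal \<bar>?G j - c\<bar>)"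
    by (simp add: ennreal_leI sum_ennreal flip: ennreal_mult)
  also have "\<dots> \<le> (\<Sum>j=0..k. ennreal (real (k choose j)) * (ennreal (M ^ ?n / r ^ ?n) * ?I))"
  proof (intro sum_mono mult_left_mono)
    fix j assume j: "j \<in> {0..k}"
    have "ennreal \<bar>?G j - c\<bar> \<le> ennreal (M ^ ?n / r ^ ?n) * (\<integral>\<^sup>+w\<in>corner_cube (x + real j *\<^sub>R h) r. ennreal \<bar>f w - c\<bar> \<partial>lebesgue)"
      by (rule mollify_diff_const[OF f r])
    also have "\<dots> \<le> ennreal (M ^ ?n / r ^ ?n) * ?I"
      using j by (intro mult_left_mono nn_set_integral_mono S) auto
    finally show "ennreal \<bar>?G j - c\<bar> \<le> ennreal (M ^ ?n / r ^ ?n) * ?I" .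
  qed simp
  also have "\<dots> = ennreal (2 ^ k) * (ennreal (M ^ ?n / r ^ ?n) * ?I)"
  proof -
    have "(\<Sum>j=0..k. real (k choose j)) = 2 ^ k"
      using choose_row_sum[of k] by (simp add: atLeast0AtMost flip: of_nat_sum of_nat_power)
    then show ?thesis by (simp add: sum_ennreal flip: sum_distrib_right)
  qed
  also have "\<dots> = ennreal (2 ^ k * M ^ ?n / r ^ ?n) * ?I"
  proof -
    have "ennreal (2 ^ k * M ^ ?n / r ^ ?n) = ennreal (2 ^ k) * ennreal (M ^ ?n / r ^ ?n)"
      using r M_nonneg by (simp flip: ennreal_mult)
    then show ?thesis by (simp add: mult.assoc)
  qed
  finally show ?thesis .
qed

end

section \<open>Interpolation between the two bounds\<close>

lemma powr_interpolate:
  fixes D C X Y \<theta> :: real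
  assumes D: "0 \<le> D" "D \<le> C * X" "D \<le> C * Y" and pos: "0 < C" "0 < X" "0 < Y" and \<theta>: "0 \<le> \<theta>" "\<theta> \<le> 1"
  shows "D \<le> C * (X powr (1 - \<theta>) * Y powr \<theta>)"
proof (cases "D = 0")
  case False
  then have "D = D powr (1 - \<theta>) * D powr \<theta>" using D(1) by (simp flip: powr_add)
  also have "\<dots> \<le> (C * X) powr (1 - \<theta>) * (C * Y) powr \<theta>"
    using D \<theta> by (intro mult_mono powr_mono2) auto
  also have "\<dots> = C powr (1 - \<theta>) * C powr \<theta> * (X powr (1 - \<theta>) * Y powr \<theta>)"
    using pos by (simp add: powr_mult)
  also have "C powr (1 - \<theta>) * C powr \<theta> = C" using pos by (simp flip: powr_add)
  finally show ?thesis .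
qed (use pos in simp)

text \<open>Truncating \<open>g\<close> at the level \<open>c v\<^bsup>1/p\<^esup>\<close> replaces Jensen's inequality, at the cost of the factor 2.\<close>

lemma nn_set_integral_le_powr:
  fixes g :: "'b \<Rightarrow> real"
  assumes [measurable]: "g \<in> borel_measurable L" "S \<in> sets L"
    and S: "emeasure L S = ennreal s" and s: "0 \<le> s" and p: "1 \<le> p" and c: "0 < c" and v: "1 \<le> v"
    and le: "(\<integral>\<^sup>+w\<in>S. ennreal ((\<bar>g w\<bar> / c) powr p) \<partial>L) \<le> ennreal (s * v)"
  shows "(\<integral>\<^sup>+w\<in>S. ennreal \<bar>g w\<bar> \<partial>L) \<le> ennreal (2 * c * s * v powr (1 / p))"
proof -
  define l where "l = v powr (1 / p)"
  have l: "0 < l" "l powr p = v" using v p by (auto simp: l_def powr_powr)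
  have pt: "t \<le> l + l powr (1 - p) * t powr p" if "0 \<le> t" for t
  proof (cases "t \<le> l")
    case False
    then have "t = t powr (1 - p) * t powr p" using l by (simp flip: powr_add)
    also have "\<dots> \<le> l powr (1 - p) * t powr p"
      using False l p by (intro mult_right_mono powr_mono2') auto
    finally show ?thesis using l by simp
  qed (use l in \<open>simp add: add_increasing2\<close>)
  have "ennreal \<bar>g w\<bar> * indicator S w
      \<le> ennreal (c * l) * indicator S w + ennreal (c * l powr (1 - p)) * (ennreal ((\<bar>g w\<bar> / c) powr p) * indicator S w)" for w
  proof -
    have "\<bar>g w\<bar> = c * (\<bar>g w\<bar> / c)" using c by simp
    also have "\<dots> \<le> c * (l + l powr (1 - p) * (\<bar>g w\<bar> / c) powr p)"
      using c by (intro mult_left_mono pt) auto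
    finally have "ennreal \<bar>g w\<bar> \<le> ennreal (c * l + c * l powr (1 - p) * (\<bar>g w\<bar> / c) powr p)"
      by (intro ennreal_leI) (simp add: algebra_simps)
    also have "\<dots> = ennreal (c * l) + ennreal (c * l powr (1 - p)) * ennreal ((\<bar>g w\<bar> / c) powr p)"
    proof -
      have "ennreal (c * l powr (1 - p) * (\<bar>g w\<bar> / c) powr p) = ennreal (c * l powr (1 - p)) * ennreal ((\<bar>g w\<bar> / c) powr p)"
        using c by (intro ennreal_mult) auto
      then show ?thesis using c l by (subst ennreal_plus) auto
    qed
    finally show ?thesis by (auto simp: indicator_def)
  qed
  then have "(\<integral>\<^sup>+w\<in>S. ennreal \<bar>g w\<bar> \<partial>L) \<le> (\<integral>\<^sup>+w. ennreal (c * l) * indicator S w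
      + ennreal (c * l powr (1 - p)) * (ennreal ((\<bar>g w\<bar> / c) powr p) * indicator S w) \<partial>L)"
    by (rule nn_integral_mono)
  also have "\<dots> = ennreal (c * l) * ennreal s + ennreal (c * l powr (1 - p)) * (\<integral>\<^sup>+w\<in>S. ennreal ((\<bar>g w\<bar> / c) powr p) \<partial>L)"
    using S by (subst nn_integral_add) (auto simp: nn_integral_cmult nn_integral_cmult_indicator)
  also have "\<dots> \<le> ennreal (c * l) * ennreal s + ennreal (c * l powr (1 - p)) * ennreal (s * v)"
    by (intro add_left_mono mult_left_mono le) simp
  also have "\<dots> = ennreal (c * l * s + c * l powr (1 - p) * (s * v))"
  proof -
    have "ennreal (c * l * s) = ennreal (c * l) * ennreal s"
      using c l s by (intro ennreal_mult) auto
    moreover have "ennreal (c * l powr (1 - p) * (s * v)) = ennreal (c * l powr (1 - p)) * ennreal (s * v)"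
      using c s v by (intro ennreal_mult) auto
    ultimately show ?thesis using c l s v by (subst ennreal_plus) auto
  qed
  also have "c * l * s + c * l powr (1 - p) * (s * v) = 2 * c * s * v powr (1 / p)"
  proof -
    have "l powr (1 - p) * v = l" using l powr_add[of l "1 - p" p] by simp
    then have "c * l powr (1 - p) * (s * v) = c * s * l" by (metis mult.assoc mult.commute)
    then show ?thesis by (simp add: l_def)
  qed
  finally show ?thesis .
qed

text \<open>A pigeonhole substitute for Hoelder's inequality: some index carries at least its share
  w_i of the whole sum, and its term alone dominates. Geometric weights will serve for the sum over
  scales, equal weights for the k + 1 terms of a difference.\<close>

lemma sum_powr_le_weighted:
  fixes u w :: "'i \<Rightarrow> real"
  assumes I: "finite I" and w: "\<And>i. i \<in> I \<Longrightarrow> 0 < w i" "sum w I \<le> 1"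
    and u: "\<And>i. i \<in> I \<Longrightarrow> 0 \<le> u i" and q: "0 < q"
  shows "(sum u I) powr q \<le> (\<Sum>i\<in>I. w i powr (- q) * u i powr q)"
proof (cases "sum u I = 0")
  case True
  then show ?thesis by (simp add: sum_nonneg)
next
  case False
  then have pos: "0 < sum u I" using u by (simp add: sum_nonneg less_le)
  obtain i where i: "i \<in> I" "w i * sum u I \<le> u i"
  proof (rule ccontr)
    assume "\<not> thesis"
    then have "u i < w i * sum u I" if "i \<in> I" for i using that that[THEN \<open>\<And>i. i \<in> I \<Longrightarrow> w i * sum u I \<le> u i \<Longrightarrow> thesis\<close>] by force
    moreover have "I \<noteq> {}" using pos by auto
    ultimately have "sum u I < (\<Sum>i\<in>I. w i * sum u I)" using I by (intro sum_strict_mono) auto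
    also have "\<dots> = sum w I * sum u I" by (simp add: sum_distrib_right)
    also have "\<dots> \<le> 1 * sum u I" using w(2) pos by (intro mult_right_mono) auto
    finally show False by simp
  qed
  have "sum u I \<le> u i / w i" using i w(1) by (simp add: field_simps)
  then have "(sum u I) powr q \<le> (u i / w i) powr q" using pos q by (intro powr_mono2) auto
  also have "\<dots> = w i powr (- q) * u i powr q"
    using powr_divide[of "u i" "w i" q] i u w(1)
    by (simp add: powr_minus less_imp_le) (simp add: divide_inverse mult.commute)
  also have "\<dots> \<le> (\<Sum>i\<in>I. w i powr (- q) * u i powr q)"
    using i I by (intro member_le_sum) auto
  finally show ?thesis .
qed

lemma emeasure_corner_cube:
  assumes "0 \<le> r" shows "emeasure lebesgue (corner_cube (y :: real^'n::finite) r) = ennreal (r ^ CARD('n))"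
proof -
  have "emeasure lborel (corner_cube y r) = (\<Prod>b\<in>Basis. ((\<chi> i. r) :: real^'n) \<bullet> b)"
    using assms by (subst emeasure_lborel_cbox) (auto simp: inner_left_distrib Basis_vec_def inner_axis)
  also have "\<dots> = r ^ CARD('n)" by (simp add: prod_Basis_vec inner_axis)
  finally show ?thesis by simp
qed

lemma corner_cube_subset:
  assumes "\<And>i. z $ i \<le> y $ i" "\<And>i. y $ i + r \<le> z $ i + s"
  shows "corner_cube y r \<subseteq> corner_cube (z :: real^'n::finite) s"
proof
  fix w assume w: "w \<in> corner_cube y r"
  have "z $ i \<le> w $ i \<and> w $ i \<le> z $ i + s" for i
    using w assms(1)[of i] assms(2)[of i] by (auto simp: mem_box_cart dest!: spec[of _ i])
  then show "w \<in> corner_cube z s" by (simp add: mem_box_cart)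
qed

lemma powe_less_imp:
  assumes "x powe (1 / p) < ennreal A" "0 < p"
  shows "x < ennreal (A powr p)"
proof (cases x rule: ennreal_cases)
  case (real t)
  then have "t powr (1 / p) < A" using assms by (simp add: ennpow_def ennreal_less_iff)
  then have "(t powr (1 / p)) powr p < A powr p" using assms(2) by (intro powr_less_mono2) auto
  then show ?thesis using real assms(2) by (simp add: powr_powr ennreal_less_iff)
qed (use assms in \<open>simp add: ennpow_def\<close>)

lemma powe_le_imp:
  assumes "x powe (1 / p) \<le> ennreal A" "0 < p" "0 \<le> A"
  shows "x \<le> ennreal (A powr p)"
proof (cases x rule: ennreal_cases)
  case (real t)
  then have "t powr (1 / p) \<le> A" using assms by (simp add: ennpow_def)
  then have "(t powr (1 / p)) powr p \<le> A powr p" using assms(2) by (intro powr_mono2) auto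
  then show ?thesis using real assms(2) by (simp add: powr_powr)
qed (use assms in \<open>simp add: ennpow_def top_unique\<close>)

section \<open>Both maximal functions in one weight\<close>

lemma avg_pow_corner_cube_le:
  fixes g :: "real^'n::finite \<Rightarrow> real"
  assumes [measurable]: "g \<in> borel_measurable lebesgue" and s: "0 < s" and A: "0 < A"
    and le: "avg_pow p (corner_cube z s) g \<le> ennreal (A powr p)"
  shows "(\<integral>\<^sup>+w\<in>corner_cube z s. ennreal ((\<bar>g w\<bar> / A) powr p) \<partial>lebesgue) \<le> ennreal (s ^ CARD('n))"
proof -
  let ?S = "corner_cube z s" and ?I = "\<integral>\<^sup>+w\<in>corner_cube z s. ennreal (\<bar>g w\<bar> powr p) \<partial>lebesgue"
  let ?sn = "s ^ CARD('n)"
  have [measurable]: "?S \<in> sets lebesgue" by simp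
  have sn: "0 < ?sn" using s by simp
  have "?I = ?I / ennreal ?sn * ennreal ?sn"
    using s by (simp add: ennreal_divide_times divide_ennreal)
  also have "\<dots> \<le> ennreal (A powr p) * ennreal ?sn"
    using le[unfolded avg_pow_def emeasure_corner_cube[OF less_imp_le[OF s]]] by (intro mult_right_mono) auto
  finally have I: "?I \<le> ennreal (A powr p * ?sn)" using sn by (simp add: ennreal_mult)
  have "(\<integral>\<^sup>+w\<in>?S. ennreal ((\<bar>g w\<bar> / A) powr p) \<partial>lebesgue) = (\<integral>\<^sup>+w. ennreal (1 / A powr p) * (ennreal (\<bar>g w\<bar> powr p) * indicator ?S w) \<partial>lebesgue)"
  proof -
    have "ennreal ((\<bar>g w\<bar> / A) powr p) = ennreal (1 / A powr p) * ennreal (\<bar>g w\<bar> powr p)" for w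
      using A by (simp add: powr_divide flip: ennreal_mult)
    then show ?thesis by (simp add: mult.assoc)
  qed
  also have "\<dots> = ennreal (1 / A powr p) * ?I" by (rule nn_integral_cmult) measurable
  also have "\<dots> \<le> ennreal (1 / A powr p) * ennreal (A powr p * ?sn)" by (intro mult_left_mono I) simp
  also have "\<dots> = ennreal ?sn" using A sn by (simp flip: ennreal_mult)
  finally show ?thesis .
qed

text \<open>Adding the two normalised powers lets a single number v control both means on a cube,
  and a single function be passed to Tonelli's theorem. Away from x the constant c is the one
  belonging to the large cube about x and is kept on all small cubes.\<close>

definition weight_fun :: "real \<Rightarrow> real \<Rightarrow> real \<Rightarrow> real \<Rightarrow> nat \<Rightarrow> (real^'n::finite \<Rightarrow> real) \<Rightarrow> real \<Rightarrow> real^'n \<Rightarrow> real"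
  where "weight_fun p1 p2 A B k f c w = (\<bar>f w - c\<bar> / A) powr p1 + (norm_nabla k f w / B) powr p2"

lemma norm_nabla_nonneg: "0 \<le> norm_nabla k f x"
  by (simp add: norm_nabla_def sum_nonneg)

lemma weight_fun_measurable:
  assumes "f \<in> Sobolev1_loc k"
  shows "weight_fun p1 p2 A B k f c \<in> borel_measurable lebesgue"
proof -
  note [measurable] = Sobolev1_locD(2,3)[OF assms]
  show ?thesis unfolding weight_fun_def[abs_def] by measurable
qed

lemma weight_fun_integrals:
  fixes f :: "real^'n::finite \<Rightarrow> real"
  assumes f: "f \<in> Sobolev1_loc k" and AB: "0 < A" "0 < B" and p: "1 \<le> p1" "1 \<le> p2" and v: "1 \<le> v" and s: "0 \<le> s"
    and W: "(\<integral>\<^sup>+w\<in>corner_cube z s. ennreal (weight_fun p1 p2 A B k f c w) \<partial>lebesgue) \<le> ennreal (s ^ CARD('n) * v)"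
  shows "(\<integral>\<^sup>+w\<in>corner_cube z s. ennreal \<bar>f w - c\<bar> \<partial>lebesgue) \<le> ennreal (2 * A * s ^ CARD('n) * v powr (1 / p1))"
    and "(\<integral>\<^sup>+w\<in>corner_cube z s. ennreal (norm_nabla k f w) \<partial>lebesgue) \<le> ennreal (2 * B * s ^ CARD('n) * v powr (1 / p2))"
proof -
  note [measurable] = Sobolev1_locD(2,3)[OF f]
  have "(\<integral>\<^sup>+w\<in>corner_cube z s. ennreal ((\<bar>f w - c\<bar> / A) powr p1) \<partial>lebesgue) \<le> ennreal (s ^ CARD('n) * v)"
    by (rule order_trans[OF nn_set_integral_mono W]) (auto simp: weight_fun_def intro!: ennreal_leI)
  then show "(\<integral>\<^sup>+w\<in>corner_cube z s. ennreal \<bar>f w - c\<bar> \<partial>lebesgue) \<le> ennreal (2 * A * s ^ CARD('n) * v powr (1 / p1))"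
    using s AB p v by (intro nn_set_integral_le_powr emeasure_corner_cube) auto
  have "(\<integral>\<^sup>+w\<in>corner_cube z s. ennreal ((\<bar>norm_nabla k f w\<bar> / B) powr p2) \<partial>lebesgue) \<le> ennreal (s ^ CARD('n) * v)"
    by (rule order_trans[OF nn_set_integral_mono W]) (auto simp: weight_fun_def norm_nabla_nonneg intro!: ennreal_leI)
  then have "(\<integral>\<^sup>+w\<in>corner_cube z s. ennreal \<bar>norm_nabla k f w\<bar> \<partial>lebesgue) \<le> ennreal (2 * B * s ^ CARD('n) * v powr (1 / p2))"
    using s AB p v by (intro nn_set_integral_le_powr emeasure_corner_cube) auto
  then show "(\<integral>\<^sup>+w\<in>corner_cube z s. ennreal (norm_nabla k f w) \<partial>lebesgue) \<le> ennreal (2 * B * s ^ CARD('n) * v powr (1 / p2))"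
    by (simp add: norm_nabla_nonneg)
qed

text \<open>The strict inequality for \<open>A\<close> turns the infimum over c into an actual c for
  this cube, so attainment is never discussed. Each summand of the weight contributes one unit to
  the 2.\<close>

lemma weight_fun_maximal:
  fixes f :: "real^'n::finite \<Rightarrow> real"
  assumes f: "f \<in> Sobolev1_loc k" and s: "0 < s" and x: "x \<in> corner_cube z s" and AB: "0 < A" "0 < B"
    and p: "1 \<le> p1" "1 \<le> p2"
    and max: "sharp_maxfun p1 f x < ennreal A" "maxfun p2 (norm_nabla k f) x \<le> ennreal B"
  shows "\<exists>c. (\<integral>\<^sup>+w\<in>corner_cube z s. ennreal (weight_fun p1 p2 A B k f c w) \<partial>lebesgue) \<le> ennreal (s ^ CARD('n) * 2)"
proof -
  let ?S = "corner_cube z s"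
  note [measurable] = Sobolev1_locD(2,3)[OF f]
  have S: "?S \<in> {Q\<in>cubes. x \<in> Q}" using s x by (auto simp: cubes_def)
  have "(INF c. avg_pow p1 ?S (\<lambda>y. f y - c)) powe (1 / p1) \<le> sharp_maxfun p1 f x"
    unfolding sharp_maxfun_def by (rule SUP_upper[OF S])
  then have "(INF c. avg_pow p1 ?S (\<lambda>y. f y - c)) < ennreal (A powr p1)"
    using max(1) p by (intro powe_less_imp) auto
  then obtain c where c: "avg_pow p1 ?S (\<lambda>y. f y - c) \<le> ennreal (A powr p1)"
    unfolding INF_less_iff by (blast intro: less_imp_le)
  have "avg_pow p2 ?S (norm_nabla k f) powe (1 / p2) \<le> maxfun p2 (norm_nabla k f) x"
    unfolding maxfun_def by (rule SUP_upper[OF S])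
  then have N: "avg_pow p2 ?S (norm_nabla k f) \<le> ennreal (B powr p2)"
    using max(2) p AB by (intro powe_le_imp) auto
  have "(\<integral>\<^sup>+w\<in>?S. ennreal (weight_fun p1 p2 A B k f c w) \<partial>lebesgue)
     = (\<integral>\<^sup>+w. ennreal ((\<bar>f w - c\<bar> / A) powr p1) * indicator ?S w + ennreal ((\<bar>norm_nabla k f w\<bar> / B) powr p2) * indicator ?S w \<partial>lebesgue)"
    by (intro nn_integral_cong) (auto simp: weight_fun_def indicator_def norm_nabla_nonneg)
  also have "\<dots> = (\<integral>\<^sup>+w\<in>?S. ennreal ((\<bar>f w - c\<bar> / A) powr p1) \<partial>lebesgue) + (\<integral>\<^sup>+w\<in>?S. ennreal ((\<bar>norm_nabla k f w\<bar> / B) powr p2) \<partial>lebesgue)"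
  proof (rule nn_integral_add)
    define N where "N = norm_nabla k f"
    have [measurable]: "N \<in> borel_measurable lebesgue" by (simp add: N_def)
    have [measurable]: "?S \<in> sets lebesgue" by simp
    show "(\<lambda>w. ennreal ((\<bar>f w - c\<bar> / A) powr p1) * indicator ?S w) \<in> borel_measurable lebesgue" by measurable
    have "(\<lambda>w. ennreal ((\<bar>N w\<bar> / B) powr p2) * indicator ?S w) \<in> borel_measurable lebesgue" by measurable
    then show "(\<lambda>w. ennreal ((\<bar>norm_nabla k f w\<bar> / B) powr p2) * indicator ?S w) \<in> borel_measurable lebesgue"
      unfolding N_def .
  qed
  also have "\<dots> \<le> ennreal (s ^ CARD('n)) + ennreal (s ^ CARD('n))"
    using s AB c N by (intro add_mono avg_pow_corner_cube_le) auto
  also have "\<dots> = ennreal (s ^ CARD('n) * 2)" using s by (simp flip: ennreal_plus)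
  finally show ?thesis by blast
qed

text \<open>For fixed w, the corners y of the cubes of side r that contain w again form a cube of
  side r, of measure r^n.\<close>

lemma tonelli_corner_cube:
  fixes G :: "real^'n::finite \<Rightarrow> ennreal"
  assumes [measurable]: "G \<in> borel_measurable borel" "Q \<in> sets borel" "S \<in> sets borel" and r: "0 \<le> r"
    and sub: "\<And>y. y \<in> Q \<Longrightarrow> corner_cube y r \<subseteq> S"
  shows "(\<lambda>y. \<integral>\<^sup>+w\<in>corner_cube y r. G w \<partial>lborel) \<in> borel_measurable borel"
    and "(\<integral>\<^sup>+y\<in>Q. (\<integral>\<^sup>+w\<in>corner_cube y r. G w \<partial>lborel) \<partial>lborel) \<le> ennreal (r ^ CARD('n)) * (\<integral>\<^sup>+w\<in>S. G w \<partial>lborel)"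
proof -
  let ?E = "{p :: (real^'n) \<times> (real^'n). \<forall>i. fst p $ i \<le> snd p $ i \<and> snd p $ i \<le> fst p $ i + r}"
  have "closed ?E" by (intro closed_Collect_all closed_Collect_conj closed_Collect_le continuous_intros)
  then have [measurable]: "?E \<in> sets (borel \<Otimes>\<^sub>M borel)" unfolding borel_prod by (rule borel_closed)
  have ind: "indicator (corner_cube y r) w = indicator ?E (y, w)" for y w
    by (auto simp: indicator_def mem_box_cart)
  show "(\<lambda>y. \<integral>\<^sup>+w\<in>corner_cube y r. G w \<partial>lborel) \<in> borel_measurable borel"
    unfolding ind by measurable
  have "(\<integral>\<^sup>+y\<in>Q. (\<integral>\<^sup>+w\<in>corner_cube y r. G w \<partial>lborel) \<partial>lborel)
      = (\<integral>\<^sup>+y. (\<integral>\<^sup>+w. G w * indicator ?E (y, w) * indicator Q y \<partial>lborel) \<partial>lborel)"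
    unfolding ind by (simp add: nn_integral_multc)
  also have "\<dots> = (\<integral>\<^sup>+w. (\<integral>\<^sup>+y. G w * indicator ?E (y, w) * indicator Q y \<partial>lborel) \<partial>lborel)"
    using lborel_pair.Fubini[of "\<lambda>(w, y). G w * indicator ?E (y, w) * indicator Q y"] by simp
  also have "\<dots> \<le> (\<integral>\<^sup>+w. (\<integral>\<^sup>+y. (G w * indicator S w) * indicator (corner_cube (w - (\<chi> i. r)) r) y \<partial>lborel) \<partial>lborel)"
  proof (intro nn_integral_mono)
    fix w y
    show "G w * indicator ?E (y, w) * indicator Q y \<le> (G w * indicator S w) * indicator (corner_cube (w - (\<chi> i. r)) r) y"
    proof (cases "(y, w) \<in> ?E \<and> y \<in> Q")
      case True
      then have "w \<in> corner_cube y r" by (simp add: mem_box_cart)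
      then have "w \<in> S" using sub True by blast
      moreover have "w $ i - r \<le> y $ i" for i using True by (simp add: algebra_simps)
      then have "y \<in> corner_cube (w - (\<chi> i. r)) r" using True by (auto simp: mem_box_cart)
      ultimately show ?thesis by (simp add: indicator_def)
    qed (auto simp: indicator_def)
  qed
  also have "\<dots> = (\<integral>\<^sup>+w. ennreal (r ^ CARD('n)) * (G w * indicator S w) \<partial>lborel)"
  proof -
    have "emeasure lborel (corner_cube (w - (\<chi> i. r)) r) = ennreal (r ^ CARD('n))" for w :: "real^'n"
      using emeasure_corner_cube[OF r, of "w - (\<chi> i. r)"] by simp
    then show ?thesis by (simp only: nn_integral_cmult_indicator sets_lborel borel_closed closed_cbox mult.commute)
  qed
  also have "\<dots> = ennreal (r ^ CARD('n)) * (\<integral>\<^sup>+w\<in>S. G w \<partial>lborel)"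
    by (rule nn_integral_cmult) measurable
  finally show "(\<integral>\<^sup>+y\<in>Q. (\<integral>\<^sup>+w\<in>corner_cube y r. G w \<partial>lborel) \<partial>lborel) \<le> ennreal (r ^ CARD('n)) * (\<integral>\<^sup>+w\<in>S. G w \<partial>lborel)" .
qed


context mollifier
begin

text \<open>The first two summands of \<open>C0\<close> are the constants of the two bounds, doubled
  by the truncation inequality; the third makes it positive. The number v remains free, because the
  cube at y need not contain the point of the maximal functions.\<close>

lemma mollify_step_interpolated:
  fixes f :: "real^'n::finite \<Rightarrow> real"
  defines "C0 \<equiv> 4 * (2 * M) ^ CARD('n) + 2 * real CARD('n) * M ^ CARD('n) + 1"
  assumes f: "f \<in> Sobolev1_loc k" and r: "0 < r" and AB: "0 < A" "0 < B" and p: "1 \<le> p1" "1 \<le> p2"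
    and \<theta>: "0 \<le> \<theta>" "\<theta> \<le> 1" and v: "1 \<le> v"
    and W: "(\<integral>\<^sup>+w\<in>corner_cube y r. ennreal (weight_fun p1 p2 A B k f c w) \<partial>lebesgue) \<le> ennreal (r ^ CARD('n) * v)"
  shows "\<bar>mollify f y (r / 2) - mollify f y r\<bar>
    \<le> C0 * (A powr (1 - \<theta>) * (r ^ k * B) powr \<theta>) * v powr ((1 - \<theta>) / p1 + \<theta> / p2)"
proof -
  let ?n = "CARD('n)" and ?D = "\<bar>mollify f y (r / 2) - mollify f y r\<bar>"
  note fL = Sobolev1_locD(1)[OF f]
  have rn: "0 < r ^ ?n" "0 < r ^ k" using r by auto
  have M0: "0 \<le> (2 * M) ^ ?n" "0 \<le> real ?n * M ^ ?n" using M_nonneg by auto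
  note 12 = weight_fun_integrals[OF f AB p v less_imp_le[OF r] W]
  have "ennreal ?D \<le> ennreal ((2 * M) ^ ?n * 2 / r ^ ?n) * ennreal (2 * A * r ^ ?n * v powr (1 / p1))"
    by (rule order_trans[OF mollify_step_const[OF fL r, of y c] mult_left_mono[OF 12(1)]]) simp
  also have "\<dots> = ennreal ((2 * M) ^ ?n * 2 / r ^ ?n * (2 * A * r ^ ?n * v powr (1 / p1)))"
    using rn M0 AB by (intro ennreal_mult[symmetric]) auto
  also have "(2 * M) ^ ?n * 2 / r ^ ?n * (2 * A * r ^ ?n * v powr (1 / p1)) = 4 * (2 * M) ^ ?n * (A * v powr (1 / p1))"
    using r by simp
  finally have "?D \<le> 4 * (2 * M) ^ ?n * (A * v powr (1 / p1))"
    using M0 AB by (subst (asm) ennreal_le_iff) auto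
  also have "\<dots> \<le> C0 * (A * v powr (1 / p1))"
    using M0 AB unfolding C0_def by (intro mult_right_mono) auto
  finally have D1: "?D \<le> C0 * (A * v powr (1 / p1))" .
  have "ennreal ?D \<le> ennreal (real ?n * M ^ ?n * r ^ k / r ^ ?n) * ennreal (2 * B * r ^ ?n * v powr (1 / p2))"
    by (rule order_trans[OF mollify_step_nabla[OF f r, of y] mult_left_mono[OF 12(2)]]) simp
  also have "\<dots> = ennreal (real ?n * M ^ ?n * r ^ k / r ^ ?n * (2 * B * r ^ ?n * v powr (1 / p2)))"
    using rn M0 AB by (intro ennreal_mult[symmetric]) auto
  also have "real ?n * M ^ ?n * r ^ k / r ^ ?n * (2 * B * r ^ ?n * v powr (1 / p2)) = 2 * (real ?n * M ^ ?n) * (r ^ k * B * v powr (1 / p2))"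
    using r by simp
  finally have "?D \<le> 2 * (real ?n * M ^ ?n) * (r ^ k * B * v powr (1 / p2))"
    using M0 AB rn by (subst (asm) ennreal_le_iff) auto
  also have "\<dots> \<le> C0 * (r ^ k * B * v powr (1 / p2))"
    using M0 AB rn unfolding C0_def by (intro mult_right_mono) auto
  finally have D2: "?D \<le> C0 * (r ^ k * B * v powr (1 / p2))" .
  have "0 < C0" using M0 unfolding C0_def by linarith
  then have "?D \<le> C0 * ((A * v powr (1 / p1)) powr (1 - \<theta>) * (r ^ k * B * v powr (1 / p2)) powr \<theta>)"
    using rn AB v by (intro powr_interpolate D1 D2 \<theta>) auto
  also have "(A * v powr (1 / p1)) powr (1 - \<theta>) * (r ^ k * B * v powr (1 / p2)) powr \<theta>
      = A powr (1 - \<theta>) * (r ^ k * B) powr \<theta> * v powr ((1 - \<theta>) / p1 + \<theta> / p2)"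
    using AB rn v by (simp add: powr_mult powr_powr powr_add mult_ac)
  finally show ?thesis by (simp only: mult.assoc)
qed

text \<open>\<open>L\<close> is chosen so that the cube of side L r centred at x contains all cubes
  of side r with corner x + t h, 0 <= t <= k. It contains x, so \<open>weight_fun_maximal\<close>
  supplies the hypothesis on the weight. The 4 is the 2 of the truncation times 2^(1/p) <=
  2.\<close>

lemma fdiff_mollify_interpolated:
  fixes f :: "real^'n::finite \<Rightarrow> real"
  defines "L \<equiv> 2 * (real k + 1)"
  defines "C1 \<equiv> 4 * L ^ CARD('n) * M ^ CARD('n) * (2 ^ k + real CARD('n) ^ k) + 1"
  assumes f: "f \<in> Sobolev1_loc k" and r: "0 < r" and k: "1 \<le> k" and AB: "0 < A" "0 < B" and p: "1 \<le> p1" "1 \<le> p2"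
    and \<theta>: "0 \<le> \<theta>" "\<theta> \<le> 1" and h: "norm h \<le> r"
    and W: "(\<integral>\<^sup>+w\<in>corner_cube (x - (\<chi> i. (real k + 1) * r)) (L * r). ennreal (weight_fun p1 p2 A B k f c w) \<partial>lebesgue)
      \<le> ennreal ((L * r) ^ CARD('n) * 2)"
  shows "\<bar>fdiff k h (\<lambda>y. mollify f y r) x\<bar> \<le> C1 * (A powr (1 - \<theta>) * (r ^ k * B) powr \<theta>)"
proof -
  let ?n = "CARD('n)" and ?D = "\<bar>fdiff k h (\<lambda>y. mollify f y r) x\<bar>"
  let ?S = "corner_cube (x - (\<chi> i. (real k + 1) * r)) (L * r)"
  note fL = Sobolev1_locD(1)[OF f]
  have rn: "0 < r ^ ?n" "0 < r ^ k" "0 < L" "0 < L * r" "0 < (L * r) ^ ?n" using r by (auto simp: L_def)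
  have pw: "2 powr (1 / p) \<le> 2" if "1 \<le> p" for p :: real
    using powr_mono[of "1 / p" 1 2] that by simp
  have sub: "corner_cube (x + t *\<^sub>R h) r \<subseteq> ?S" if t: "0 \<le> t" "t \<le> real k" for t
  proof (rule corner_cube_subset)
    fix i
    have "\<bar>t * h $ i\<bar> \<le> real k * r"
      unfolding abs_mult using t order_trans[OF component_le_norm_cart h] by (intro mult_mono) auto
    then have "t * h $ i \<le> real k * r" "- (real k * r) \<le> t * h $ i" by linarith+
    then show "(x - (\<chi> i. (real k + 1) * r)) $ i \<le> (x + t *\<^sub>R h) $ i"
      "(x + t *\<^sub>R h) $ i + r \<le> (x - (\<chi> i. (real k + 1) * r)) $ i + L * r"
      using r by (simp_all add: L_def algebra_simps)
  qed
  note S = weight_fun_integrals[OF f AB p _ _ W]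
  have 1: "(\<integral>\<^sup>+w\<in>?S. ennreal \<bar>f w - c\<bar> \<partial>lebesgue) \<le> ennreal (2 * A * (L * r) ^ ?n * 2)"
    using rn AB pw[OF p(1)] by (intro order_trans[OF S(1)] ennreal_leI mult_left_mono) auto
  have 2: "(\<integral>\<^sup>+w\<in>?S. ennreal (norm_nabla k f w) \<partial>lebesgue) \<le> ennreal (2 * B * (L * r) ^ ?n * 2)"
    using rn AB pw[OF p(2)] by (intro order_trans[OF S(2)] ennreal_leI mult_left_mono) auto
  have Cpos: "0 \<le> L ^ ?n * M ^ ?n" using M_nonneg rn by simp
  have "ennreal ?D \<le> ennreal (2 ^ k * M ^ ?n / r ^ ?n) * ennreal (2 * A * (L * r) ^ ?n * 2)"
    by (rule order_trans[OF fdiff_mollify_const[OF fL r k sub, where c = c] mult_left_mono[OF 1]]) simp_all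
  also have "\<dots> = ennreal (2 ^ k * M ^ ?n / r ^ ?n * (2 * A * (L * r) ^ ?n * 2))"
    using rn M_nonneg AB by (intro ennreal_mult[symmetric]) auto
  also have "2 ^ k * M ^ ?n / r ^ ?n * (2 * A * (L * r) ^ ?n * 2) = 4 * (L ^ ?n * M ^ ?n) * 2 ^ k * A"
    using r by (simp add: power_mult_distrib)
  finally have "?D \<le> 4 * (L ^ ?n * M ^ ?n) * 2 ^ k * A"
    using Cpos AB by (subst (asm) ennreal_le_iff) auto
  also have "\<dots> \<le> C1 * A"
  proof (rule mult_right_mono)
    have "0 \<le> 4 * (L ^ ?n * M ^ ?n) * real ?n ^ k" using Cpos by simp
    then show "4 * (L ^ ?n * M ^ ?n) * 2 ^ k \<le> C1" unfolding C1_def by (simp add: algebra_simps)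
  qed (use AB in simp)
  finally have D1: "?D \<le> C1 * A" .
  have "ennreal ?D \<le> ennreal ((real ?n * norm h) ^ k * M ^ ?n / r ^ ?n) * (\<integral>\<^sup>+w\<in>?S. ennreal (norm_nabla k f w) \<partial>lebesgue)"
    by (rule fdiff_mollify_nabla[OF f r sub]) (use 2 in \<open>auto intro: le_less_trans\<close>)
  also have "\<dots> \<le> ennreal ((real ?n * r) ^ k * M ^ ?n / r ^ ?n) * ennreal (2 * B * (L * r) ^ ?n * 2)"
    using rn M_nonneg h by (intro mult_mono 2 ennreal_leI divide_right_mono mult_right_mono power_mono mult_left_mono) auto
  also have "\<dots> = ennreal ((real ?n * r) ^ k * M ^ ?n / r ^ ?n * (2 * B * (L * r) ^ ?n * 2))"
    using r rn M_nonneg AB by (intro ennreal_mult[symmetric]) auto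
  also have "(real ?n * r) ^ k * M ^ ?n / r ^ ?n * (2 * B * (L * r) ^ ?n * 2) = 4 * (L ^ ?n * M ^ ?n) * real ?n ^ k * (r ^ k * B)"
    using r by (simp add: power_mult_distrib)
  finally have "?D \<le> 4 * (L ^ ?n * M ^ ?n) * real ?n ^ k * (r ^ k * B)"
    using Cpos AB rn by (subst (asm) ennreal_le_iff) auto
  also have "\<dots> \<le> C1 * (r ^ k * B)"
  proof (rule mult_right_mono)
    have "0 \<le> 4 * (L ^ ?n * M ^ ?n) * 2 ^ k" using Cpos by simp
    then show "4 * (L ^ ?n * M ^ ?n) * real ?n ^ k \<le> C1" unfolding C1_def by (simp add: algebra_simps)
  qed (use AB rn in simp)
  finally have D2: "?D \<le> C1 * (r ^ k * B)" .
  have "0 \<le> 4 * L ^ ?n * M ^ ?n * (2 ^ k + real ?n ^ k)"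
    using rn M_nonneg by (intro mult_nonneg_nonneg) auto
  then have "0 < C1" unfolding C1_def by linarith
  then show ?thesis using AB rn by (intro powr_interpolate D1 D2 \<theta>) auto
qed

end

section \<open>Summation over the dyadic scales, at the point and on average\<close>

lemma dyadic_scale_powr:
  fixes r B \<theta> :: real
  assumes "0 < r" "0 < B"
  shows "((r / 2 ^ i) ^ k * B) powr \<theta> = (r ^ k * B) powr \<theta> * (2 powr (- (real k * \<theta>))) ^ i"
proof -
  have "(r / 2 ^ i) ^ k * B = r ^ k * B * 2 powr (- (real i * real k))"
  proof -
    have "2 powr (real (i * k)) = (2 :: real) ^ (i * k)" by (rule powr_realpow) simp
    then have "2 powr (- (real i * real k)) = 1 / (2 ^ i) ^ k"
      by (simp add: powr_minus_divide power_mult)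
    then show ?thesis by (simp add: power_divide)
  qed
  then have "((r / 2 ^ i) ^ k * B) powr \<theta> = (r ^ k * B) powr \<theta> * 2 powr (- (real i * real k) * \<theta>)"
    using assms by (simp add: powr_mult powr_powr)
  moreover have "(2 powr (- (real k * \<theta>))) ^ i = 2 powr (- (real i * real k) * \<theta>)"
    by (simp add: powr_power mult_ac)
  ultimately show ?thesis by simp
qed

lemma sum_geometric_le:
  fixes \<mu> :: real
  assumes "0 \<le> \<mu>" "\<mu> < 1"
  shows "(\<Sum>i<I. \<mu> ^ i) \<le> 1 / (1 - \<mu>)"
proof -
  have "(\<Sum>i<I. \<mu> ^ i) = (1 - \<mu> ^ I) / (1 - \<mu>)" using assms by (simp add: sum_gp_strict)
  also have "\<dots> \<le> 1 / (1 - \<mu>)" using assms by (intro divide_right_mono) auto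
  finally show ?thesis .
qed

context mollifier
begin

lemma mollify_dyadic_LIMSEQ:
  assumes "((\<lambda>r. mollify f y r) \<longlongrightarrow> f y) (at_right 0)" "0 < r"
  shows "(\<lambda>I. mollify f y (r / 2 ^ I)) \<longlonglongrightarrow> f y"
proof (rule filterlim_compose[OF assms(1)])
  have "(\<lambda>I. r / 2 ^ I) \<longlonglongrightarrow> 0" by (rule LIMSEQ_divide_realpow_zero) simp
  then show "filterlim (\<lambda>I. r / 2 ^ I) (at_right 0) sequentially"
    using assms(2) by (auto simp: filterlim_at)
qed

lemma mollify_telescope:
  "mollify f y (r / 2 ^ I) - mollify f y r = (\<Sum>i<I. mollify f y (r / 2 ^ i / 2) - mollify f y (r / 2 ^ i))"
  using sum_lessThan_telescope[of "\<lambda>i. mollify f y (r / 2 ^ i)" I] by (simp add: mult.commute)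

text \<open>This serves the term of the difference at x, which is independent of h. There all cubes
  contain x, so the steps decay like 2^(-k \<theta> i) with no loss, and \<theta> > 0 makes the
  series converge.\<close>

lemma mollify_error_pointwise:
  assumes lim: "((\<lambda>r. mollify f x r) \<longlongrightarrow> f x) (at_right 0)" and r: "0 < r" and B: "0 < B"
    and k: "1 \<le> k" and \<theta>: "0 < \<theta>" and C: "0 \<le> C"
    and step: "\<And>\<rho>. 0 < \<rho> \<Longrightarrow> \<bar>mollify f x (\<rho> / 2) - mollify f x \<rho>\<bar> \<le> C * (A powr (1 - \<theta>) * (\<rho> ^ k * B) powr \<theta>)"
  shows "\<bar>f x - mollify f x r\<bar> \<le> C / (1 - 2 powr (- (real k * \<theta>))) * (A powr (1 - \<theta>) * (r ^ k * B) powr \<theta>)"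
proof -
  define \<mu> :: real where "\<mu> = 2 powr (- (real k * \<theta>))"
  define Z where "Z = A powr (1 - \<theta>) * (r ^ k * B) powr \<theta>"
  have \<mu>: "0 \<le> \<mu>" "\<mu> < 1" using k \<theta> powr_less_mono[of "- (real k * \<theta>)" 0 2] by (auto simp: \<mu>_def)
  have Z: "0 \<le> Z" by (simp add: Z_def)
  have "\<bar>mollify f x (r / 2 ^ I) - mollify f x r\<bar> \<le> C / (1 - \<mu>) * Z" for I
  proof -
    have "\<bar>mollify f x (r / 2 ^ I) - mollify f x r\<bar> \<le> (\<Sum>i<I. C * Z * \<mu> ^ i)"
      unfolding mollify_telescope
    proof (intro order_trans[OF sum_abs] sum_mono)
      fix i
      show "\<bar>mollify f x (r / 2 ^ i / 2) - mollify f x (r / 2 ^ i)\<bar> \<le> C * Z * \<mu> ^ i"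
        using step[of "r / 2 ^ i"] r unfolding dyadic_scale_powr[OF r B] by (simp add: Z_def \<mu>_def mult_ac)
    qed
    also have "\<dots> = C * Z * (\<Sum>i<I. \<mu> ^ i)" by (simp add: sum_distrib_left)
    also have "\<dots> \<le> C * Z * (1 / (1 - \<mu>))"
      using C Z by (intro mult_left_mono sum_geometric_le \<mu>) auto
    finally show ?thesis by simp
  qed
  moreover have "(\<lambda>I. \<bar>mollify f x (r / 2 ^ I) - mollify f x r\<bar>) \<longlonglongrightarrow> \<bar>f x - mollify f x r\<bar>"
    by (intro tendsto_intros mollify_dyadic_LIMSEQ lim r)
  ultimately show ?thesis
    unfolding \<mu>_def Z_def by (intro LIMSEQ_le_const2) auto
qed

text \<open>\<open>E - 1\<close> counts the powers of a local mean beyond the one that Tonelli's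
  theorem can integrate, and \<delta> is what is left of the decay k \<theta> q after paying n for
  each of them. Half of \<delta> goes into the weights that separate the scales; the other half is
  the decay of the final series. The error enters only pointwise, below a Borel majorant
  \<open>H\<close> that can be integrated.\<close>

lemma mollify_error_integral:
  fixes f :: "real^'n::finite \<Rightarrow> real" and p1 p2 q \<theta> :: real
  defines "L \<equiv> 2 * (real k + 1)" and "C0 \<equiv> 4 * (2 * M) ^ CARD('n) + 2 * real CARD('n) * M ^ CARD('n) + 1"
    and "e \<equiv> (1 - \<theta>) / p1 + \<theta> / p2"
  defines "E \<equiv> max (e * q) 1"
  defines "\<delta> \<equiv> real k * \<theta> * q - real CARD('n) * (E - 1)"
  defines "l \<equiv> 2 powr (- \<delta> / (2 * q))"
  defines "K0 \<equiv> (1 - l) powr (- q) * C0 powr q * (3 * L ^ CARD('n)) powr (E - 1)"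
  assumes f: "f \<in> Sobolev1_loc k" and r: "0 < r" and AB: "0 < A" "0 < B" and p: "1 \<le> p1" "1 \<le> p2" and q: "1 \<le> q"
    and \<theta>: "0 \<le> \<theta>" "\<theta> \<le> 1" and \<delta>: "0 < \<delta>"
    and W: "(\<integral>\<^sup>+w\<in>corner_cube (x - (\<chi> i. (real k + 1) * r)) (L * r). ennreal (weight_fun p1 p2 A B k f c w) \<partial>lebesgue)
      \<le> ennreal ((L * r) ^ CARD('n) * 2)"
  shows "\<exists>H\<in>borel_measurable borel.
    (\<forall>y\<in>cbox (x - (\<chi> i. real k * r)) (x + (\<chi> i. real k * r)). ((\<lambda>r. mollify f y r) \<longlongrightarrow> f y) (at_right 0) \<longrightarrow>
      ennreal (\<bar>f y - mollify f y r\<bar> powr q) \<le> H y) \<and>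
    (\<integral>\<^sup>+y\<in>cbox (x - (\<chi> i. real k * r)) (x + (\<chi> i. real k * r)). H y \<partial>lborel)
      \<le> ennreal (3 * L ^ CARD('n) * K0 / (1 - 2 powr (- \<delta> / 2)) * r ^ CARD('n) * (A powr (1 - \<theta>) * (r ^ k * B) powr \<theta>) powr q)"
proof -
  let ?n = "CARD('n)" and ?S = "corner_cube (x - (\<chi> i. (real k + 1) * r)) (L * r)"
  let ?Q = "cbox (x - (\<chi> i. real k * r)) (x + (\<chi> i. real k * r))"
  let ?W = "weight_fun p1 p2 A B k f c"
  define Z where "Z = A powr (1 - \<theta>) * (r ^ k * B) powr \<theta>"
  define \<nu> :: real where "\<nu> = 2 powr (- \<delta> / 2)"
  define \<rho> where "\<rho> i = r / 2 ^ i" for i :: nat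
  \<comment> \<open>Weights of total mass at most 1; \<open>l\<close> is such that w_i^(-q) grows
    only like 2^(\<delta> i / 2).\<close>
  define w where "w i = (1 - l) * l ^ i" for i
  define cc where "cc i = K0 * Z powr q * \<nu> ^ i" for i
  have L: "1 \<le> L ^ ?n" "0 < L" by (auto simp: L_def)
  have \<rho>: "0 < \<rho> i" "\<rho> i \<le> r" for i
    using r by (auto simp: \<rho>_def divide_le_eq intro: mult_right_le_one_le simp: mult_le_cancel_left1)
  have e: "0 \<le> e" using \<theta> p by (auto simp: e_def)
  have E: "1 \<le> E" "e * q \<le> E" by (auto simp: E_def)
  have l: "0 < l" "l < 1" using \<delta> q powr_less_mono[of "- \<delta> / (2 * q)" 0 2] by (auto simp: l_def)
  have \<nu>: "0 < \<nu>" "\<nu> < 1" using \<delta> powr_less_mono[of "- \<delta> / 2" 0 2] by (auto simp: \<nu>_def)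
  have C0: "0 < C0" using M_nonneg unfolding C0_def by (simp add: add_nonneg_pos)
  have K0: "0 \<le> K0" by (simp add: K0_def)
  have Z: "0 < Z" using AB r by (simp add: Z_def)
  have cc: "0 \<le> cc i" for i using K0 \<nu> by (simp add: cc_def)
  have "?W \<in> borel_measurable lebesgue" by (rule weight_fun_measurable[OF f])
  \<comment> \<open>Tonelli's theorem is used on the product of Borel spaces, so the Lebesgue
    measurable weight is replaced by a Borel function equal to it almost everywhere.\<close>
  then obtain G' where G'[measurable]: "G' \<in> borel_measurable lborel" "AE w in lborel. ?W w = G' w"
    using completion_ex_borel_measurable_real by blast
  define G where "G w = ennreal (G' w)" for w
  have G[measurable]: "G \<in> borel_measurable borel" unfolding G_def[abs_def] by measurable
  have WG: "(\<integral>\<^sup>+w\<in>T. ennreal (?W w) \<partial>lebesgue) = (\<integral>\<^sup>+w\<in>T. G w \<partial>lborel)" for T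
    unfolding nn_integral_completion using G'(2) by (intro nn_integral_cong_AE) (auto simp: G_def)
  define V where "V i y = (\<integral>\<^sup>+w\<in>corner_cube y (\<rho> i). G w \<partial>lborel)" for i y
  define H where "H y = (\<Sum>i. ennreal (cc i) * (1 + V i y / ennreal (\<rho> i ^ ?n)))" for y
  have sub: "corner_cube y (\<rho> i) \<subseteq> ?S" if "y \<in> ?Q" for y i
  proof (rule corner_cube_subset)
    fix j
    have "x $ j - real k * r \<le> y $ j" "y $ j \<le> x $ j + real k * r"
      using that by (auto simp: mem_box_cart)
    then show "(x - (\<chi> i. (real k + 1) * r)) $ j \<le> y $ j" "y $ j + \<rho> i \<le> (x - (\<chi> i. (real k + 1) * r)) $ j + L * r"
      using r \<rho>(2)[of i] by (simp_all add: L_def algebra_simps)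
  qed
  have Sint: "(\<integral>\<^sup>+w\<in>?S. G w \<partial>lborel) \<le> ennreal ((L * r) ^ ?n * 2)" using W unfolding WG .
  have V_meas[measurable]: "V i \<in> borel_measurable borel" for i
    unfolding V_def[abs_def] using \<rho>(1)[of i]
    by (intro tonelli_corner_cube(1)[where Q = "{}" and S = "{}"]) auto
  have V_int: "(\<integral>\<^sup>+y\<in>?Q. V i y \<partial>lborel) \<le> ennreal (\<rho> i ^ ?n * ((L * r) ^ ?n * 2))" for i
  proof -
    have "(\<integral>\<^sup>+y\<in>?Q. V i y \<partial>lborel) \<le> ennreal (\<rho> i ^ ?n) * (\<integral>\<^sup>+w\<in>?S. G w \<partial>lborel)"
      unfolding V_def using \<rho>(1)[of i] sub by (intro tonelli_corner_cube(2)) auto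
    also have "\<dots> \<le> ennreal (\<rho> i ^ ?n) * ennreal ((L * r) ^ ?n * 2)" by (intro mult_left_mono Sint) simp
    finally show ?thesis using \<rho>(1)[of i] by (simp add: ennreal_mult')
  qed
  have summand: "w i powr (- q) * \<bar>mollify f y (\<rho> i / 2) - mollify f y (\<rho> i)\<bar> powr q \<le> cc i * (1 + enn2real (V i y) / \<rho> i ^ ?n)"
    and Vfin: "V i y < top" if y: "y \<in> ?Q" for y i
  proof -
    \<comment> \<open>The summand 1 ensures v >= 1, so that powers of v increase with the exponent;
      after integration it costs only the volume of \<open>?Q\<close>.\<close>
    define v where "v = 1 + enn2real (V i y) / \<rho> i ^ ?n"
    have Vle: "V i y \<le> ennreal ((L * r) ^ ?n * 2)"
      unfolding V_def by (rule order_trans[OF nn_set_integral_mono Sint]) (use sub[OF y] in auto)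
    then show "V i y < top" by (rule le_less_trans) simp
    have \<rho>n: "0 < \<rho> i ^ ?n" using \<rho>(1) by simp
    have v1: "1 \<le> v" using \<rho>n by (simp add: v_def)
    have "enn2real (V i y) \<le> (L * r) ^ ?n * 2"
      using Vle L r by (intro enn2real_leI) auto
    \<comment> \<open>Crude bound: the small cube receives at most the whole integral over the large
      cube, which multiplies the mean by at most L^n 2^(n i).\<close>
    then have "v \<le> 1 + ((L * r) ^ ?n * 2) / \<rho> i ^ ?n"
      unfolding v_def using \<rho>n by (intro add_left_mono divide_right_mono) auto
    also have "((L * r) ^ ?n * 2) / \<rho> i ^ ?n = 2 * (L ^ ?n * (2 ^ i) ^ ?n)"
      using r by (simp add: \<rho>_def power_mult_distrib power_divide)
    also have "1 + 2 * (L ^ ?n * (2 ^ i) ^ ?n) \<le> 3 * L ^ ?n * (2 ^ i) ^ ?n"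
    proof -
      have "1 \<le> L ^ ?n * (2 ^ i) ^ ?n" using mult_mono[OF L(1) one_le_power[of "2 ^ i :: real" ?n]] L by simp
      then show ?thesis by simp
    qed
    finally have v2: "v \<le> 3 * L ^ ?n * (2 ^ i) ^ ?n" .
    have "(\<integral>\<^sup>+w\<in>corner_cube y (\<rho> i). ennreal (?W w) \<partial>lebesgue) = ennreal (enn2real (V i y))"
      unfolding WG V_def[symmetric] using \<open>V i y < top\<close> by simp
    also have "\<dots> \<le> ennreal (\<rho> i ^ ?n * v)"
      using \<rho>(1)[of i] by (intro ennreal_leI) (simp add: v_def distrib_left)
    finally have "(\<integral>\<^sup>+w\<in>corner_cube y (\<rho> i). ennreal (?W w) \<partial>lebesgue) \<le> ennreal (\<rho> i ^ ?n * v)" .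
    from mollify_step_interpolated[OF f \<rho>(1) AB p \<theta> v1 this]
    have u: "\<bar>mollify f y (\<rho> i / 2) - mollify f y (\<rho> i)\<bar> \<le> C0 * (Z * (2 powr (- (real k * \<theta>))) ^ i) * v powr e"
      unfolding \<rho>_def dyadic_scale_powr[OF r AB(2)] by (simp add: C0_def Z_def e_def mult_ac)
    have "\<bar>mollify f y (\<rho> i / 2) - mollify f y (\<rho> i)\<bar> powr q \<le> (C0 * (Z * (2 powr (- (real k * \<theta>))) ^ i) * v powr e) powr q"
      using q by (intro powr_mono2 u) auto
    also have "\<dots> = C0 powr q * Z powr q * (2 powr (- (real k * \<theta> * q))) ^ i * v powr (e * q)"
      using C0 Z v1 by (simp add: powr_mult powr_powr powr_power mult_ac)
    \<comment> \<open>One power of v is kept for the integration in y; the remaining E - 1 powers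
      are estimated by the crude bound.\<close>
    also have "v powr (e * q) \<le> v * (3 * L ^ ?n * (2 ^ i) ^ ?n) powr (E - 1)"
    proof -
      have "v powr (e * q) \<le> v powr E" using v1 E by (intro powr_mono) auto
      also have "\<dots> = v * v powr (E - 1)" using v1 by (simp add: powr_diff)
      also have "\<dots> \<le> v * (3 * L ^ ?n * (2 ^ i) ^ ?n) powr (E - 1)"
        using v1 v2 E by (intro mult_left_mono powr_mono2) auto
      finally show ?thesis .
    qed
    also have "(3 * L ^ ?n * (2 ^ i) ^ ?n) powr (E - 1) = (3 * L ^ ?n) powr (E - 1) * (2 powr (real ?n * (E - 1))) ^ i"
    proof -
      have "((2 ^ i) ^ ?n :: real) powr (E - 1) = (2 powr (real ?n * (E - 1))) ^ i"
      proof -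
        have "((2 ^ i) ^ ?n :: real) = 2 powr (real i * real ?n)"
          by (simp add: powr_realpow flip: power_mult of_nat_mult)
        then show ?thesis by (simp add: powr_powr powr_power mult_ac)
      qed
      then show ?thesis using L by (simp add: powr_mult)
    qed
    finally have u2: "\<bar>mollify f y (\<rho> i / 2) - mollify f y (\<rho> i)\<bar> powr q
      \<le> C0 powr q * Z powr q * (2 powr (- (real k * \<theta> * q))) ^ i * (v * ((3 * L ^ ?n) powr (E - 1) * (2 powr (real ?n * (E - 1))) ^ i))"
      using C0 Z by (simp add: mult_left_mono)
    have wq: "w i powr (- q) = (1 - l) powr (- q) * (2 powr (\<delta> / 2)) ^ i"
    proof -
      have "(l ^ i) powr (- q) = (l powr (- q)) ^ i"
        using l by (simp add: powr_power powr_powr mult.commute flip: powr_realpow)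
      also have "l powr (- q) = 2 powr (\<delta> / 2)" using q by (simp add: l_def powr_powr)
      finally show ?thesis using l by (simp add: w_def powr_mult)
    qed
    \<comment> \<open>The exponents are \<delta>/2 from the weights, -k \<theta> q from the decay
      and n (E - 1) from the crude bound; by definition of \<delta> they add up to
      -\<delta>/2.\<close>
    have \<nu>eq: "2 powr (\<delta> / 2) * (2 powr (- (real k * \<theta> * q)) * 2 powr (real ?n * (E - 1))) = \<nu>"
      by (simp add: \<nu>_def \<delta>_def flip: powr_add) (simp add: field_simps)
    have "w i powr (- q) * \<bar>mollify f y (\<rho> i / 2) - mollify f y (\<rho> i)\<bar> powr q
      \<le> w i powr (- q) * (C0 powr q * Z powr q * (2 powr (- (real k * \<theta> * q))) ^ i * (v * ((3 * L ^ ?n) powr (E - 1) * (2 powr (real ?n * (E - 1))) ^ i)))"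
      by (intro mult_left_mono u2) simp
    also have "\<dots> = K0 * Z powr q * (2 powr (\<delta> / 2) * (2 powr (- (real k * \<theta> * q)) * 2 powr (real ?n * (E - 1)))) ^ i * v"
      unfolding wq K0_def power_mult_distrib by (simp only: mult_ac)
    finally show "w i powr (- q) * \<bar>mollify f y (\<rho> i / 2) - mollify f y (\<rho> i)\<bar> powr q \<le> cc i * (1 + enn2real (V i y) / \<rho> i ^ ?n)"
      unfolding \<nu>eq cc_def v_def .
  qed
  have summand': "ennreal (w i powr (- q) * \<bar>mollify f y (\<rho> i / 2) - mollify f y (\<rho> i)\<bar> powr q)
      \<le> ennreal (cc i) * (1 + V i y / ennreal (\<rho> i ^ ?n))" if y: "y \<in> ?Q" for y i
  proof -
    have \<rho>n: "0 < \<rho> i ^ ?n" using \<rho>(1) by simp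
    have "ennreal (cc i * (1 + enn2real (V i y) / \<rho> i ^ ?n)) = ennreal (cc i) * ennreal (1 + enn2real (V i y) / \<rho> i ^ ?n)"
      using cc \<rho>n by (intro ennreal_mult) auto
    also have "ennreal (1 + enn2real (V i y) / \<rho> i ^ ?n) = 1 + ennreal (enn2real (V i y)) / ennreal (\<rho> i ^ ?n)"
      using \<rho>n by (subst ennreal_plus) (auto simp: divide_ennreal)
    also have "ennreal (enn2real (V i y)) = V i y" using Vfin[OF y] by simp
    finally show ?thesis using ennreal_leI[OF summand[OF y, of i]] by simp
  qed
  have bound: "ennreal (\<bar>f y - mollify f y r\<bar> powr q) \<le> H y"
    if y: "y \<in> ?Q" and lim: "((\<lambda>r. mollify f y r) \<longlongrightarrow> f y) (at_right 0)" for y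
  proof -
    have part: "ennreal (\<bar>mollify f y (r / 2 ^ I) - mollify f y r\<bar> powr q) \<le> H y" for I
    proof -
      let ?u = "\<lambda>i. \<bar>mollify f y (\<rho> i / 2) - mollify f y (\<rho> i)\<bar>"
      have "\<bar>mollify f y (r / 2 ^ I) - mollify f y r\<bar> \<le> (\<Sum>i<I. ?u i)"
        unfolding mollify_telescope \<rho>_def by (rule sum_abs)
      then have "\<bar>mollify f y (r / 2 ^ I) - mollify f y r\<bar> powr q \<le> (\<Sum>i<I. ?u i) powr q"
        using q by (intro powr_mono2) auto
      also have "\<dots> \<le> (\<Sum>i<I. w i powr (- q) * ?u i powr q)"
      proof (rule sum_powr_le_weighted)
        have "sum w {..<I} = (1 - l) * (\<Sum>i<I. l ^ i)" by (simp add: w_def sum_distrib_left)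
        also have "\<dots> \<le> (1 - l) * (1 / (1 - l))"
          using l by (intro mult_left_mono sum_geometric_le) auto
        finally show "sum w {..<I} \<le> 1" using l by simp
      qed (use l q in \<open>auto simp: w_def\<close>)
      finally have "ennreal (\<bar>mollify f y (r / 2 ^ I) - mollify f y r\<bar> powr q) \<le> (\<Sum>i<I. ennreal (w i powr (- q) * ?u i powr q))"
        by (simp add: ennreal_leI sum_ennreal)
      also have "\<dots> \<le> (\<Sum>i<I. ennreal (cc i) * (1 + V i y / ennreal (\<rho> i ^ ?n)))"
        by (intro sum_mono summand' y)
      also have "\<dots> \<le> H y" unfolding H_def by (rule sum_le_suminf) auto
      finally show ?thesis .
    qed
    have "(\<lambda>I. \<bar>mollify f y (r / 2 ^ I) - mollify f y r\<bar> powr q) \<longlonglongrightarrow> \<bar>f y - mollify f y r\<bar> powr q"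
      using q by (intro tendsto_powr' tendsto_intros mollify_dyadic_LIMSEQ lim r) auto
    then have "(\<lambda>I. ennreal (\<bar>mollify f y (r / 2 ^ I) - mollify f y r\<bar> powr q)) \<longlonglongrightarrow> ennreal (\<bar>f y - mollify f y r\<bar> powr q)"
      by (rule tendsto_ennrealI)
    then show ?thesis by (rule LIMSEQ_le_const2) (use part in blast)
  qed
  have H_meas[measurable]: "H \<in> borel_measurable borel" unfolding H_def[abs_def] by measurable
  have Qvol: "emeasure lborel ?Q \<le> ennreal ((L * r) ^ ?n)"
  proof -
    have "?Q \<subseteq> ?S" using r by (auto simp: subset_iff mem_box_cart L_def algebra_simps; smt (verit))
    then have "emeasure lborel ?Q \<le> emeasure lborel ?S" by (intro emeasure_mono) auto
    then show ?thesis using emeasure_corner_cube[of "L * r" "x - (\<chi> i. (real k + 1) * r)"] L r by simp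
  qed
  have "(\<integral>\<^sup>+y\<in>?Q. H y \<partial>lborel) = (\<integral>\<^sup>+y. (\<Sum>i. ennreal (cc i) * (indicator ?Q y + V i y * indicator ?Q y / ennreal (\<rho> i ^ ?n))) \<partial>lborel)"
    unfolding H_def by (intro nn_integral_cong) (auto simp: indicator_def)
  also have "\<dots> = (\<Sum>i. \<integral>\<^sup>+y. ennreal (cc i) * (indicator ?Q y + V i y * indicator ?Q y / ennreal (\<rho> i ^ ?n)) \<partial>lborel)"
    by (rule nn_integral_suminf) measurable
  \<comment> \<open>The volume of \<open>?Q\<close> counts once and the integral of the weight over
    the large cube twice; the rho_i^n produced by Tonelli's theorem cancels the normalisation of the
    mean.\<close>
  also have "\<dots> \<le> (\<Sum>i. ennreal (3 * (L * r) ^ ?n * cc i))"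
  proof (rule suminf_le)
    fix i
    have \<rho>n: "0 < \<rho> i ^ ?n" using \<rho>(1) by simp
    have "(\<integral>\<^sup>+y. ennreal (cc i) * (indicator ?Q y + V i y * indicator ?Q y / ennreal (\<rho> i ^ ?n)) \<partial>lborel)
        = ennreal (cc i) * (emeasure lborel ?Q + (\<integral>\<^sup>+y\<in>?Q. V i y \<partial>lborel) / ennreal (\<rho> i ^ ?n))"
      by (simp add: nn_integral_cmult nn_integral_add nn_integral_divide)
    also have "\<dots> \<le> ennreal (cc i) * (ennreal ((L * r) ^ ?n) + ennreal (\<rho> i ^ ?n * ((L * r) ^ ?n * 2)) / ennreal (\<rho> i ^ ?n))"
      by (intro mult_left_mono add_mono Qvol divide_right_mono_ennreal V_int) simp
    also have "ennreal (\<rho> i ^ ?n * ((L * r) ^ ?n * 2)) / ennreal (\<rho> i ^ ?n) = ennreal ((L * r) ^ ?n * 2)"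
      using \<rho>n \<rho>(1)[of i] L r by (simp add: divide_ennreal)
    also have "ennreal (cc i) * (ennreal ((L * r) ^ ?n) + ennreal ((L * r) ^ ?n * 2)) = ennreal (3 * (L * r) ^ ?n * cc i)"
      using cc L r by (simp add: mult_ac flip: ennreal_plus ennreal_mult)
    finally show "(\<integral>\<^sup>+y. ennreal (cc i) * (indicator ?Q y + V i y * indicator ?Q y / ennreal (\<rho> i ^ ?n)) \<partial>lborel)
        \<le> ennreal (3 * (L * r) ^ ?n * cc i)" .
  qed auto
  also have "\<dots> = ennreal (3 * L ^ ?n * K0 / (1 - \<nu>) * r ^ ?n * Z powr q)"
  proof -
    have "(\<lambda>i. 3 * (L * r) ^ ?n * (K0 * Z powr q) * \<nu> ^ i) sums (3 * (L * r) ^ ?n * (K0 * Z powr q) * (1 / (1 - \<nu>)))"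
      using \<nu> by (intro sums_mult geometric_sums) auto
    then have "(\<lambda>i. 3 * (L * r) ^ ?n * cc i) sums (3 * L ^ ?n * K0 / (1 - \<nu>) * r ^ ?n * Z powr q)"
      by (simp add: cc_def power_mult_distrib mult_ac)
    then show ?thesis using cc L r by (intro suminf_ennreal_eq) auto
  qed
  finally have "(\<integral>\<^sup>+y\<in>?Q. H y \<partial>lborel) \<le> ennreal (3 * L ^ ?n * K0 / (1 - \<nu>) * r ^ ?n * Z powr q)" .
  then show ?thesis using bound H_meas unfolding Z_def \<nu>_def by blast
qed

end

section \<open>Differences averaged over balls\<close>

lemma scaleR_affine_euclidean:
  "(\<lambda>h. x + c *\<^sub>R h) = (\<lambda>h :: 'a::euclidean_space. x + (\<Sum>j\<in>Basis. (c * (h \<bullet> j)) *\<^sub>R j))"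
  by (rule ext) (simp add: scaleR_scaleR[symmetric] scaleR_sum_right[symmetric] euclidean_representation del: scaleR_scaleR)

lemma lebesgue_measurable_affine:
  assumes "c \<noteq> 0" shows "(\<lambda>h :: 'a::euclidean_space. x + c *\<^sub>R h) \<in> lebesgue \<rightarrow>\<^sub>M lebesgue"
  unfolding scaleR_affine_euclidean by (rule lebesgue_affine_measurable) (use assms in simp)

text \<open>The Jacobian c^n is at least 1 and is dropped. This covers the substitutions y = x + j h
  with j >= 1, without constants depending on j.\<close>

lemma nn_integral_affine_le:
  fixes x :: "'a::euclidean_space"
  assumes G[measurable]: "G \<in> borel_measurable lebesgue" and c: "1 \<le> c"
  shows "(\<integral>\<^sup>+h. G (x + c *\<^sub>R h) \<partial>lebesgue) \<le> (\<integral>\<^sup>+y. G y \<partial>lebesgue)"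
proof -
  note T[measurable] = lebesgue_measurable_affine[of c x]
  have T': "(\<lambda>h. x + c *\<^sub>R h) \<in> lebesgue \<rightarrow>\<^sub>M lebesgue" using c by (intro lebesgue_measurable_affine) auto
  have "(\<integral>\<^sup>+y. G y \<partial>lebesgue) = (\<integral>\<^sup>+y. G y \<partial>density (distr lebesgue lebesgue (\<lambda>h. x + c *\<^sub>R h)) (\<lambda>_. ennreal (\<Prod>j\<in>(Basis::'a set). \<bar>c\<bar>)))"
    using lebesgue_affine_euclidean[of "\<lambda>_::'a. c" x] c unfolding scaleR_affine_euclidean by simp
  also have "\<dots> = (\<integral>\<^sup>+y. ennreal (\<Prod>j\<in>(Basis::'a set). \<bar>c\<bar>) * G y \<partial>distr lebesgue lebesgue (\<lambda>h. x + c *\<^sub>R h))"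
    by (rule nn_integral_density) auto
  also have "\<dots> = (\<integral>\<^sup>+h. ennreal (\<Prod>j\<in>(Basis::'a set). \<bar>c\<bar>) * G (x + c *\<^sub>R h) \<partial>lebesgue)"
    by (rule nn_integral_distr[OF T']) auto
  finally have eq: "(\<integral>\<^sup>+y. G y \<partial>lebesgue) = (\<integral>\<^sup>+h. ennreal (\<Prod>j\<in>(Basis::'a set). \<bar>c\<bar>) * G (x + c *\<^sub>R h) \<partial>lebesgue)" .
  have "1 \<le> (\<Prod>j\<in>(Basis::'a set). \<bar>c\<bar>)" using c by (intro prod_ge_1) auto
  then have "1 * G (x + c *\<^sub>R h) \<le> ennreal (\<Prod>j\<in>(Basis::'a set). \<bar>c\<bar>) * G (x + c *\<^sub>R h)" for h
    by (intro mult_right_mono) (simp_all del: prod_constant)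
  then show ?thesis unfolding eq by (intro nn_integral_mono) simp
qed

lemma AE_affine:
  fixes x :: "'a::euclidean_space"
  assumes P: "AE y in lebesgue. P y" and c: "c \<noteq> 0"
  shows "AE h in lebesgue. P (x + c *\<^sub>R h)"
proof -
  obtain N where N: "negligible N" "\<And>y. y \<notin> N \<Longrightarrow> P y"
    using P by (auto simp: eventually_ae_filter negligible_iff_null_sets)
  have "negligible ((\<lambda>y. (1 / c) *\<^sub>R (y - x)) ` N)"
    by (rule negligible_differentiable_image_negligible[OF _ N(1)]) (auto intro!: derivative_intros simp: differentiable_on_def)
  moreover have "h \<in> (\<lambda>y. (1 / c) *\<^sub>R (y - x)) ` N" if "\<not> P (x + c *\<^sub>R h)" for h
    using N(2) that c by (intro image_eqI[of _ _ "x + c *\<^sub>R h"]) auto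
  ultimately show ?thesis
    by (intro AE_I'[of "(\<lambda>y. (1 / c) *\<^sub>R (y - x)) ` N"]) (auto simp: negligible_iff_null_sets)
qed

lemma cball_measure_le:
  fixes r :: real assumes "0 \<le> r"
  shows "emeasure lebesgue (cball (0 :: real^'n::finite) r) \<le> ennreal ((2 * r) ^ CARD('n))"
proof -
  have "cball (0 :: real^'n) r \<subseteq> corner_cube (- (\<chi> i. r)) (2 * r)"
  proof
    fix h :: "real^'n" assume "h \<in> cball 0 r"
    then have "\<bar>h $ i\<bar> \<le> r" for i using component_le_norm_cart[of h i] by simp
    then have "- r \<le> h $ i \<and> h $ i \<le> r" for i by (simp add: abs_le_iff minus_le_iff)
    then show "h \<in> corner_cube (- (\<chi> i. r)) (2 * r)" by (simp add: mem_box_cart)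
  qed
  then have "emeasure lebesgue (cball (0 :: real^'n) r) \<le> emeasure lebesgue (corner_cube (- (\<chi> i. r)) (2 * r) :: (real^'n) set)"
    by (intro emeasure_mono) auto
  then show ?thesis using emeasure_corner_cube[of "2 * r" "- (\<chi> i. r) :: real^'n"] assms by simp
qed

text \<open>\<open>c\<close> collects what is uniform in h: the difference of the mollified function
  and the error at x. The errors at x + j h are integrated through their majorant \<open>G\<close>
  by substituting y = x + j h, which maps the ball of radius r into \<open>Q\<close>.\<close>

lemma fdiff_powr_integral_le:
  fixes f g :: "real^'n::finite \<Rightarrow> real" and q :: real
  defines "Q \<equiv> \<lambda>x k r. cbox (x - (\<chi> i. real k * r)) (x + (\<chi> i. real k * r))"
  assumes q: "1 \<le> q" and r: "0 < r" and c: "0 \<le> c" and g: "\<And>y. 0 \<le> g y"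
    and G[measurable]: "G \<in> borel_measurable lebesgue" and I: "0 \<le> I"
    and pt: "AE h in lebesgue. norm h \<le> r \<longrightarrow> \<bar>fdiff k h f x\<bar> \<le> c + (\<Sum>j=1..k. 2 ^ k * g (x + real j *\<^sub>R h))"
    and gG: "AE y in lebesgue. y \<in> Q x k r \<longrightarrow> ennreal (g y powr q) \<le> G y"
    and GI: "(\<integral>\<^sup>+y\<in>Q x k r. G y \<partial>lebesgue) \<le> ennreal I"
  shows "(\<integral>\<^sup>+h\<in>cball 0 r. ennreal (\<bar>fdiff k h f x\<bar> powr q) \<partial>lebesgue)
    \<le> ennreal ((real k + 1) powr q * c powr q * (2 * r) ^ CARD('n) + real k * (((real k + 1) * 2 ^ k) powr q * I))"
proof -
  let ?n = "CARD('n)" and ?k = "real k + 1"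
  define Gi where "Gi y = G y * indicator (Q x k r) y" for y
  define D where "D = (?k * 2 ^ k) powr q"
  have [measurable]: "Q x k r \<in> sets lebesgue" by (simp add: Q_def)
  have [measurable]: "Gi \<in> borel_measurable lebesgue" unfolding Gi_def[abs_def] by measurable
  have Gj: "(\<lambda>h. Gi (x + real j *\<^sub>R h)) \<in> borel_measurable lebesgue" if "j \<in> {1..k}" for j
    using measurable_compose[OF lebesgue_measurable_affine[of "real j" x], of Gi borel] that by simp
  have AEj: "AE h in lebesgue. \<forall>j\<in>{1..k}. x + real j *\<^sub>R h \<in> Q x k r \<longrightarrow> ennreal (g (x + real j *\<^sub>R h) powr q) \<le> G (x + real j *\<^sub>R h)"
    by (intro AE_finite_allI AE_affine[OF gG]) auto
  have "AE h in lebesgue. ennreal (\<bar>fdiff k h f x\<bar> powr q) * indicator (cball 0 r) h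
      \<le> ennreal (?k powr q * c powr q) * indicator (cball 0 r) h + (\<Sum>j=1..k. ennreal D * Gi (x + real j *\<^sub>R h))"
    using pt AEj
  proof eventually_elim
    case (elim h)
    show ?case
    proof (cases "norm h \<le> r")
      case True
      define T where "T j = (if j = 0 then c else 2 ^ k * g (x + real j *\<^sub>R h))" for j
      have in_Q: "x + real j *\<^sub>R h \<in> Q x k r" if "j \<in> {1..k}" for j
      proof -
        have "\<bar>real j * h $ i\<bar> \<le> real k * r" for i
          unfolding abs_mult using that order_trans[OF component_le_norm_cart True] by (intro mult_mono) auto
        then have "real j * h $ i \<le> real k * r \<and> - (real k * r) \<le> real j * h $ i" for i by (simp add: abs_le_iff minus_le_iff)
        then show ?thesis unfolding Q_def by (auto simp: mem_box_cart)
      qed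
      have split: "(\<Sum>j\<in>{0..k}. F j) = F 0 + (\<Sum>j=1..k. F j)" for F :: "nat \<Rightarrow> real"
        by (simp add: sum.atLeast_Suc_atMost)
      have "\<bar>fdiff k h f x\<bar> \<le> (\<Sum>j\<in>{0..k}. T j)"
        using elim(1) True unfolding split by (simp add: T_def)
      then have "\<bar>fdiff k h f x\<bar> powr q \<le> (\<Sum>j\<in>{0..k}. T j) powr q" using q by (intro powr_mono2) auto
      also have "\<dots> \<le> (\<Sum>j\<in>{0..k}. (1 / ?k) powr (- q) * T j powr q)"
        using q c g by (intro sum_powr_le_weighted) (auto simp: T_def)
      also have "\<dots> = (\<Sum>j\<in>{0..k}. ?k powr q * T j powr q)"
        by (simp add: powr_divide powr_minus_divide)
      also have "\<dots> = ?k powr q * c powr q + (\<Sum>j=1..k. D * g (x + real j *\<^sub>R h) powr q)"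
        unfolding split using g by (auto simp: T_def D_def powr_mult intro!: sum.cong)
      finally have "ennreal (\<bar>fdiff k h f x\<bar> powr q) \<le> ennreal (?k powr q * c powr q + (\<Sum>j=1..k. D * g (x + real j *\<^sub>R h) powr q))"
        by (rule ennreal_leI)
      also have "\<dots> = ennreal (?k powr q * c powr q) + (\<Sum>j=1..k. ennreal D * ennreal (g (x + real j *\<^sub>R h) powr q))"
        by (subst ennreal_plus) (auto simp: sum_nonneg D_def sum_ennreal ennreal_mult simp flip: ennreal_mult)
      also have "\<dots> \<le> ennreal (?k powr q * c powr q) + (\<Sum>j=1..k. ennreal D * Gi (x + real j *\<^sub>R h))"
        using elim(2) in_Q by (intro add_left_mono sum_mono mult_left_mono) (auto simp: Gi_def)
      finally show ?thesis using True by (simp add: indicator_def)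
    qed (simp add: indicator_def)
  qed
  then have "(\<integral>\<^sup>+h\<in>cball 0 r. ennreal (\<bar>fdiff k h f x\<bar> powr q) \<partial>lebesgue)
      \<le> (\<integral>\<^sup>+h. ennreal (?k powr q * c powr q) * indicator (cball 0 r) h + (\<Sum>j=1..k. ennreal D * Gi (x + real j *\<^sub>R h)) \<partial>lebesgue)"
    by (rule nn_integral_mono_AE)
  also have "\<dots> = (\<integral>\<^sup>+h. ennreal (?k powr q * c powr q) * indicator (cball (0::real^'n) r) h \<partial>lebesgue) + (\<integral>\<^sup>+h. (\<Sum>j=1..k. ennreal D * Gi (x + real j *\<^sub>R h)) \<partial>lebesgue)"
  proof (rule nn_integral_add)
    show "(\<lambda>h. ennreal (?k powr q * c powr q) * indicator (cball (0::real^'n) r) h) \<in> borel_measurable lebesgue"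
      by (intro borel_measurable_times_ennreal borel_measurable_const borel_measurable_indicator) simp
    show "(\<lambda>h. \<Sum>j=1..k. ennreal D * Gi (x + real j *\<^sub>R h)) \<in> borel_measurable lebesgue"
      by (intro borel_measurable_sum borel_measurable_times_ennreal borel_measurable_const Gj)
  qed
  also have "(\<integral>\<^sup>+h. (\<Sum>j=1..k. ennreal D * Gi (x + real j *\<^sub>R h)) \<partial>lebesgue) = (\<Sum>j=1..k. \<integral>\<^sup>+h. ennreal D * Gi (x + real j *\<^sub>R h) \<partial>lebesgue)"
    by (rule nn_integral_sum) (intro borel_measurable_times_ennreal borel_measurable_const Gj)
  also have "\<dots> = (\<Sum>j=1..k. ennreal D * (\<integral>\<^sup>+h. Gi (x + real j *\<^sub>R h) \<partial>lebesgue))"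
    by (intro sum.cong refl nn_integral_cmult Gj)
  also have "(\<integral>\<^sup>+h. ennreal (?k powr q * c powr q) * indicator (cball (0::real^'n) r) h \<partial>lebesgue) + \<dots>
      \<le> ennreal (?k powr q * c powr q) * ennreal ((2 * r) ^ ?n) + (\<Sum>j=1..k. ennreal D * ennreal I)"
  proof (intro add_mono sum_mono mult_left_mono)
    show "(\<integral>\<^sup>+h. ennreal (?k powr q * c powr q) * indicator (cball (0::real^'n) r) h \<partial>lebesgue)
        \<le> ennreal (?k powr q * c powr q) * ennreal ((2 * r) ^ ?n)"
      using cball_measure_le[of r, where 'n = 'n] r by (subst nn_integral_cmult_indicator) (auto intro: mult_left_mono)
    fix j assume j: "j \<in> {1..k}"
    have "(\<integral>\<^sup>+h. Gi (x + real j *\<^sub>R h) \<partial>lebesgue) \<le> (\<integral>\<^sup>+y. Gi y \<partial>lebesgue)"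
      by (rule nn_integral_affine_le) (use j in auto)
    also have "\<dots> \<le> ennreal I" using GI by (simp add: Gi_def)
    finally show "(\<integral>\<^sup>+h. Gi (x + real j *\<^sub>R h) \<partial>lebesgue) \<le> ennreal I" .
  qed auto
  also have "\<dots> = ennreal (?k powr q * c powr q * (2 * r) ^ ?n + real k * (D * I))"
  proof -
    have "(\<Sum>j=1..k. ennreal D * ennreal I) = ennreal (real k * (D * I))"
      using I by (simp add: D_def ennreal_mult ennreal_of_nat_eq_real_of_nat)
    moreover have "ennreal (?k powr q * c powr q) * ennreal ((2 * r) ^ ?n) = ennreal (?k powr q * c powr q * (2 * r) ^ ?n)"
      using r by (intro ennreal_mult[symmetric]) auto
    ultimately show ?thesis using r I by (simp add: D_def flip: ennreal_plus)
  qed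
  finally show ?thesis unfolding D_def .
qed

lemma abs_fdiff_le: "\<bar>fdiff k h g x\<bar> \<le> \<bar>g x\<bar> + (\<Sum>j=1..k. 2 ^ k * \<bar>g (x + real j *\<^sub>R h)\<bar>)"
proof -
  have ch: "real (k choose j) \<le> 2 ^ k" for j
  proof -
    have "real (k choose j) \<le> real (2 ^ k)" using binomial_le_pow2[of k j] by (simp only: of_nat_le_iff)
    then show ?thesis by simp
  qed
  have "\<bar>fdiff k h g x\<bar> \<le> (\<Sum>j=0..k. real (k choose j) * \<bar>g (x + real j *\<^sub>R h)\<bar>)"
    unfolding fdiff_def by (intro order_trans[OF sum_abs] sum_mono) (simp add: abs_mult power_abs)
  also have "\<dots> = \<bar>g x\<bar> + (\<Sum>j=1..k. real (k choose j) * \<bar>g (x + real j *\<^sub>R h)\<bar>)"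
    by (simp add: sum.atLeast_Suc_atMost)
  also have "\<dots> \<le> \<bar>g x\<bar> + (\<Sum>j=1..k. 2 ^ k * \<bar>g (x + real j *\<^sub>R h)\<bar>)"
    by (intro add_left_mono sum_mono mult_right_mono ch) auto
  finally show ?thesis .
qed

lemma corner_cube_in_cubes: "0 < s \<Longrightarrow> corner_cube z s \<in> cubes"
  unfolding cubes_def by blast

text \<open>The endpoint \<theta> = 0 is reached without mollification: f(x) is subtracted, the
  substitution y = x + j h is made, and t^q <= 1 + t^p for q <= p brings in the mean over the cube
  of side 2 k r about x.\<close>

lemma ball_estimate_zero:
  fixes f :: "real^'n::finite \<Rightarrow> real" and p q :: real
  assumes f: "f \<in> borel_measurable lebesgue" and k: "1 \<le> k" and q: "1 \<le> q" "q \<le> p" and r: "0 < r" and A: "0 < A"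
    and max: "maxfun p (\<lambda>y. f y - f x) x \<le> ennreal A"
  shows "(\<integral>\<^sup>+h\<in>cball 0 r. ennreal (\<bar>fdiff k h f x\<bar> powr q) \<partial>lebesgue)
    \<le> ennreal (real k * (((real k + 1) * 2 ^ k) powr q * (2 * (2 * real k) ^ CARD('n))) * r ^ CARD('n) * A powr q)"
proof -
  let ?n = "CARD('n)" and ?g = "\<lambda>y. f y - f x"
  let ?S = "corner_cube (x - (\<chi> i. real k * r)) (2 * real k * r)"
  let ?Q = "cbox (x - (\<chi> i. real k * r)) (x + (\<chi> i. real k * r))"
  have g[measurable]: "?g \<in> borel_measurable lebesgue" using f by measurable
  have s: "0 < 2 * real k * r" using k r by simp
  have QS: "?Q = ?S"
    by (rule arg_cong2[where f = cbox]) (auto simp: vec_eq_iff algebra_simps)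
  have x: "?S \<in> {Q\<in>cubes. x \<in> Q}"
  proof -
    have "x \<in> ?Q" using r by (simp add: mem_box_cart)
    then have "x \<in> ?S" unfolding QS .
    then show ?thesis using corner_cube_in_cubes[OF s] by blast
  qed
  have "avg_pow p ?S ?g powe (1 / p) \<le> maxfun p ?g x"
    unfolding maxfun_def by (rule SUP_upper[OF x])
  then have "avg_pow p ?S ?g \<le> ennreal (A powr p)"
    using max A q by (intro powe_le_imp) auto
  then have W: "(\<integral>\<^sup>+w\<in>?S. ennreal ((\<bar>?g w\<bar> / A) powr p) \<partial>lebesgue) \<le> ennreal ((2 * real k * r) ^ ?n)"
    by (rule avg_pow_corner_cube_le[OF g s A])
  define G where "G y = ennreal (A powr q) * (1 + ennreal ((\<bar>?g y\<bar> / A) powr p))" for y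
  have G[measurable]: "G \<in> borel_measurable lebesgue" unfolding G_def[abs_def] by measurable
  have gG: "ennreal (\<bar>?g y\<bar> powr q) \<le> G y" for y
  proof -
    let ?t = "\<bar>?g y\<bar> / A"
    have "?t powr q \<le> 1 + ?t powr p"
    proof (cases "?t \<le> 1")
      case True
      then have "?t powr q \<le> 1 powr q" using q A by (intro powr_mono2) auto
      then show ?thesis by (simp add: add_increasing2)
    next
      case False
      then have "?t powr q \<le> ?t powr p" using q by (intro powr_mono) auto
      then show ?thesis by simp
    qed
    then have "A powr q * ?t powr q \<le> A powr q * (1 + ?t powr p)" by (rule mult_left_mono) simp
    moreover have "A powr q * ?t powr q = \<bar>?g y\<bar> powr q" using A by (simp add: powr_divide)
    ultimately have "ennreal (\<bar>?g y\<bar> powr q) \<le> ennreal (A powr q * (1 + ?t powr p))" by (simp add: ennreal_leI)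
    also have "\<dots> = G y" by (simp add: G_def ennreal_mult)
    finally show ?thesis .
  qed
  have [measurable]: "?S \<in> sets lebesgue" by simp
  have "(\<integral>\<^sup>+y\<in>?Q. G y \<partial>lebesgue) = (\<integral>\<^sup>+y. ennreal (A powr q) * (indicator ?S y + ennreal ((\<bar>?g y\<bar> / A) powr p) * indicator ?S y) \<partial>lebesgue)"
    unfolding QS G_def by (intro nn_integral_cong) (auto simp: indicator_def)
  also have "\<dots> = ennreal (A powr q) * (emeasure lebesgue ?S + (\<integral>\<^sup>+w\<in>?S. ennreal ((\<bar>?g w\<bar> / A) powr p) \<partial>lebesgue))"
  proof -
    have S: "?S \<in> sets lebesgue" by simp
    have i: "indicator ?S \<in> borel_measurable lebesgue" by (rule borel_measurable_indicator[OF S])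
    have X: "(\<lambda>y. ennreal ((\<bar>?g y\<bar> / A) powr p) * indicator ?S y) \<in> borel_measurable lebesgue"
      by (intro borel_measurable_times_ennreal i) (use g in measurable)
    show ?thesis
      unfolding nn_integral_cmult[OF borel_measurable_add[OF i X]] nn_integral_add[OF i X] nn_integral_indicator[OF S] ..
  qed
  also have "\<dots> \<le> ennreal (A powr q) * (ennreal ((2 * real k * r) ^ ?n) + ennreal ((2 * real k * r) ^ ?n))"
    using s by (intro mult_left_mono add_mono W) (simp_all add: emeasure_corner_cube del: emeasure_completion)
  also have "\<dots> = ennreal (A powr q * (2 * (2 * real k * r) ^ ?n))"
  proof -
    have "ennreal ((2 * real k * r) ^ ?n) + ennreal ((2 * real k * r) ^ ?n) = ennreal (2 * (2 * real k * r) ^ ?n)"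
      using s by (subst ennreal_plus[symmetric]) auto
    then show ?thesis using s by (simp add: ennreal_mult)
  qed
  finally have GI: "(\<integral>\<^sup>+y\<in>?Q. G y \<partial>lebesgue) \<le> ennreal (A powr q * (2 * (2 * real k * r) ^ ?n))" .
  have pt: "\<bar>fdiff k h f x\<bar> \<le> 0 + (\<Sum>j=1..k. 2 ^ k * \<bar>?g (x + real j *\<^sub>R h)\<bar>)" for h
    using abs_fdiff_le[of k h ?g x] fdiff_diff[of k h f "\<lambda>_. f x" x] fdiff_const[OF k, of h "f x" x] by simp
  have "(\<integral>\<^sup>+h\<in>cball 0 r. ennreal (\<bar>fdiff k h f x\<bar> powr q) \<partial>lebesgue)
    \<le> ennreal ((real k + 1) powr q * 0 powr q * (2 * r) ^ ?n + real k * (((real k + 1) * 2 ^ k) powr q * (A powr q * (2 * (2 * real k * r) ^ ?n))))"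
    using s by (intro fdiff_powr_integral_le[where g = "\<lambda>y. \<bar>?g y\<bar>", OF q(1) r _ _ G _ _ _ GI]) (use pt gG in auto)
  also have "(real k + 1) powr q * 0 powr q * (2 * r) ^ ?n + real k * (((real k + 1) * 2 ^ k) powr q * (A powr q * (2 * (2 * real k * r) ^ ?n)))
      = real k * (((real k + 1) * 2 ^ k) powr q * (2 * (2 * real k) ^ ?n)) * r ^ ?n * A powr q"
    by (simp add: power_mult_distrib mult_ac)
  finally show ?thesis .
qed

text \<open>Finite positive majorants \<open>A\<close>, \<open>B\<close> of the extended values \<open>\<alpha>\<close>, \<open>\<beta>\<close> make this an estimate between
  real numbers.\<close>

definition ball_bound :: "nat \<Rightarrow> real \<Rightarrow> real \<Rightarrow> real \<Rightarrow> ennreal \<Rightarrow> ennreal \<Rightarrow> (real^'n::finite \<Rightarrow> real) \<Rightarrow> real^'n \<Rightarrow> bool"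
  where "ball_bound k q \<theta> C \<alpha> \<beta> f x \<longleftrightarrow> (\<forall>A B r. 0 < A \<longrightarrow> 0 < B \<longrightarrow> 0 < r \<longrightarrow> \<alpha> < ennreal A \<longrightarrow> \<beta> \<le> ennreal B \<longrightarrow>
    (\<integral>\<^sup>+h\<in>cball 0 r. ennreal (\<bar>fdiff k h f x\<bar> powr q) \<partial>lebesgue)
      \<le> ennreal (C * r ^ CARD('n) * (A powr (1 - \<theta>) * (r ^ k * B) powr \<theta>) powr q))"

text \<open>Enlarging \<alpha> leaves fewer admissible \<open>A\<close>. In part (ii) this replaces
  the sharp maximal function by that of f - f(x).\<close>

lemma ball_bound_mono:
  assumes "ball_bound k q \<theta> C \<alpha> \<beta> f x" "C \<le> C'" "\<alpha> \<le> \<alpha>'"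
  shows "ball_bound k q \<theta> C' \<alpha>' \<beta> (f :: real^'n::finite \<Rightarrow> real) x"
  unfolding ball_bound_def
proof (intro allI impI)
  fix A B r :: real
  assume *: "0 < A" "0 < B" "0 < r" "\<alpha>' < ennreal A" "\<beta> \<le> ennreal B"
  let ?Z = "(A powr (1 - \<theta>) * (r ^ k * B) powr \<theta>) powr q"
  have "C * r ^ CARD('n) * ?Z \<le> C' * r ^ CARD('n) * ?Z"
    using assms(2) *(3) by (intro mult_right_mono) auto
  then show "(\<integral>\<^sup>+h\<in>cball 0 r. ennreal (\<bar>fdiff k h f x\<bar> powr q) \<partial>lebesgue) \<le> ennreal (C' * r ^ CARD('n) * ?Z)"
    using assms(1)[unfolded ball_bound_def, rule_format, OF *(1-3) le_less_trans[OF assms(3) *(4)] *(5)]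
    by (elim order_trans) (rule ennreal_leI)
qed

section \<open>The estimate on balls and the degenerate case\<close>

context mollifier
begin

lemma mollify_tendsto_ae:
  fixes f :: "real^'n::finite \<Rightarrow> real"
  assumes "f \<in> L1_loc"
  shows "AE y in lebesgue. ((\<lambda>r. mollify f y r) \<longlongrightarrow> f y) (at_right 0)"
  unfolding mollify_def
  by (rule mollification_tendsto_ae[OF L1_loc_cbox[OF assms] bump_a[of 0] int_a]) simp

text \<open>Convergence of the mollifications at x is the only condition imposed on x, so one null
  set serves all \<open>A\<close>, \<open>B\<close> and r at once.\<close>

lemma ball_estimate:
  fixes p1 p2 q \<theta> :: real
  assumes k: "1 \<le> k" and p: "1 \<le> p1" "1 \<le> p2" and q: "1 \<le> q" and \<theta>: "0 < \<theta>" "\<theta> \<le> 1"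
    and cond: "real CARD('n::finite) * ((1 - \<theta>) / p1 + \<theta> / p2 - 1 / q) < \<theta> * real k"
  shows "\<exists>C>0. \<forall>f :: real^'n \<Rightarrow> real. f \<in> Sobolev1_loc k \<longrightarrow>
    (AE x in lebesgue. ball_bound k q \<theta> C (sharp_maxfun p1 f x) (maxfun p2 (norm_nabla k f) x) f x)"
proof -
  let ?n = "CARD('n)"
  define L where "L = 2 * (real k + 1)"
  define C0 where "C0 = 4 * (2 * M) ^ ?n + 2 * real ?n * M ^ ?n + 1"
  define C1 where "C1 = 4 * L ^ ?n * M ^ ?n * (2 ^ k + real ?n ^ k) + 1"
  define e where "e = (1 - \<theta>) / p1 + \<theta> / p2"
  define E where "E = max (e * q) 1"
  define \<delta> where "\<delta> = real k * \<theta> * q - real ?n * (E - 1)"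
  define l where "l = 2 powr (- \<delta> / (2 * q))"
  define K0 where "K0 = (1 - l) powr (- q) * C0 powr q * (3 * L ^ ?n) powr (E - 1)"
  define C2 where "C2 = 3 * L ^ ?n * K0 / (1 - 2 powr (- \<delta> / 2))"
  \<comment> \<open>The contributions uniform in h: the difference of the mollified function, and
    the error at x, whose steps have v = 2.\<close>
  define C3 where "C3 = C1 + C0 * 2 powr e / (1 - 2 powr (- (real k * \<theta>)))"
  define C where "C = (real k + 1) powr q * C3 powr q * 2 ^ ?n + real k * (((real k + 1) * 2 ^ k) powr q * C2) + 1"
  \<comment> \<open>If e q >= 1, then \<delta> is q times the gap in \<open>cond\<close>; otherwise
    there is no excess and \<delta> is the full decay k \<theta> q.\<close>
  have \<delta>: "0 < \<delta>"
  proof (cases "1 \<le> e * q")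
    case True
    have "q * (real ?n * (e - 1 / q)) < q * (\<theta> * real k)" using cond q by (intro mult_strict_left_mono) (auto simp: e_def)
    moreover have "q * (real ?n * (e - 1 / q)) = real ?n * (e * q - 1)" using q by (simp add: field_simps)
    ultimately show ?thesis using True by (simp add: \<delta>_def E_def mult_ac)
  next
    case False
    then show ?thesis using k \<theta> q by (simp add: \<delta>_def E_def)
  qed
  have L: "0 < L" by (simp add: L_def)
  have C0: "0 < C0" using M_nonneg unfolding C0_def by (simp add: add_nonneg_pos)
  have C1: "0 < C1" using M_nonneg L unfolding C1_def by (simp add: add_nonneg_pos)
  have \<mu>: "2 powr (- (real k * \<theta>)) < (1 :: real)" using k \<theta> powr_less_mono[of "- (real k * \<theta>)" 0 2] by simp
  have "2 powr (- \<delta> / 2) < (1 :: real)" using \<delta> powr_less_mono[of "- \<delta> / 2" 0 2] by simp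
  then have C2: "0 \<le> C2" using L by (simp add: C2_def K0_def)
  have C3: "0 \<le> C3" using C0 C1 \<mu> by (simp add: C3_def)
  have C: "0 < C" using C2 C3 unfolding C_def by (intro add_nonneg_pos add_nonneg_nonneg) auto
  have "AE x in lebesgue. ball_bound k q \<theta> C (sharp_maxfun p1 f x) (maxfun p2 (norm_nabla k f) x) f x"
    if f: "f \<in> Sobolev1_loc k" for f :: "real^'n \<Rightarrow> real"
  proof -
    note fL = Sobolev1_locD(1)[OF f]
    note lim = mollify_tendsto_ae[OF fL]
    show ?thesis
      using lim
    proof eventually_elim
      case (elim x)
      show ?case
        unfolding ball_bound_def
      proof (intro allI impI)
        fix A B r :: real
        assume AB: "0 < A" "0 < B" and r: "0 < r" and max: "sharp_maxfun p1 f x < ennreal A" "maxfun p2 (norm_nabla k f) x \<le> ennreal B"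
        let ?Q = "cbox (x - (\<chi> i. real k * r)) (x + (\<chi> i. real k * r))"
        define Z where "Z = A powr (1 - \<theta>) * (r ^ k * B) powr \<theta>"
        have Z: "0 \<le> Z" by (simp add: Z_def)
        have "x \<in> corner_cube (x - (\<chi> i. (real k + 1) * r)) (L * r)"
          using r by (simp add: mem_box_cart L_def algebra_simps)
        moreover have "0 < L * r" using L r by simp
        ultimately obtain c where W: "(\<integral>\<^sup>+w\<in>corner_cube (x - (\<chi> i. (real k + 1) * r)) (L * r). ennreal (weight_fun p1 p2 A B k f c w) \<partial>lebesgue)
            \<le> ennreal ((L * r) ^ ?n * 2)"
          using weight_fun_maximal[OF f _ _ AB p max] by blast
        obtain H where H: "H \<in> borel_measurable borel"
          "\<And>y. y \<in> ?Q \<Longrightarrow> ((\<lambda>r. mollify f y r) \<longlongrightarrow> f y) (at_right 0) \<Longrightarrow> ennreal (\<bar>f y - mollify f y r\<bar> powr q) \<le> H y"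
          "(\<integral>\<^sup>+y\<in>?Q. H y \<partial>lborel) \<le> ennreal (C2 * r ^ ?n * Z powr q)"
          using mollify_error_integral[OF f r AB p q less_imp_le[OF \<theta>(1)] \<theta>(2), where x = x and c = c] \<delta> W
          unfolding C2_def K0_def l_def \<delta>_def E_def e_def C0_def L_def Z_def by blast
        \<comment> \<open>At x each scale may choose its own constant c, because every cube used
          contains x.\<close>
        have step: "\<bar>mollify f x (\<rho> / 2) - mollify f x \<rho>\<bar> \<le> C0 * 2 powr e * (A powr (1 - \<theta>) * (\<rho> ^ k * B) powr \<theta>)"
          if \<rho>: "0 < \<rho>" for \<rho>
        proof -
          have "x \<in> corner_cube x \<rho>" using \<rho> by (simp add: mem_box_cart)
          then obtain c where "(\<integral>\<^sup>+w\<in>corner_cube x \<rho>. ennreal (weight_fun p1 p2 A B k f c w) \<partial>lebesgue) \<le> ennreal (\<rho> ^ ?n * 2)"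
            using weight_fun_maximal[OF f \<rho> _ AB p max] by blast
          from mollify_step_interpolated[OF f \<rho> AB p less_imp_le[OF \<theta>(1)] \<theta>(2) _ this]
          show ?thesis by (simp add: C0_def e_def mult_ac)
        qed
        have xerr: "\<bar>f x - mollify f x r\<bar> \<le> C0 * 2 powr e / (1 - 2 powr (- (real k * \<theta>))) * Z"
          unfolding Z_def by (rule mollify_error_pointwise[OF elim r AB(2) k \<theta>(1) _ step]) (use C0 in auto)
        have pt: "\<bar>fdiff k h f x\<bar> \<le> C3 * Z + (\<Sum>j=1..k. 2 ^ k * \<bar>f (x + real j *\<^sub>R h) - mollify f (x + real j *\<^sub>R h) r\<bar>)" if h: "norm h \<le> r" for h
        proof -
          have "\<bar>fdiff k h (\<lambda>y. mollify f y r) x\<bar> \<le> C1 * Z"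
            unfolding Z_def C1_def L_def
            by (rule fdiff_mollify_interpolated[OF f r k AB p less_imp_le[OF \<theta>(1)] \<theta>(2) h]) (use W in \<open>simp only: L_def\<close>)
          moreover have "fdiff k h f x = fdiff k h (\<lambda>y. f y - mollify f y r) x + fdiff k h (\<lambda>y. mollify f y r) x"
            by (simp add: fdiff_diff)
          moreover have "C3 * Z = C1 * Z + C0 * 2 powr e / (1 - 2 powr (- (real k * \<theta>))) * Z"
            by (simp add: C3_def distrib_right)
          ultimately show ?thesis
            using abs_fdiff_le[of k h "\<lambda>y. f y - mollify f y r" x] xerr by linarith
        qed
        have Hm: "H \<in> borel_measurable lebesgue" using H(1) by (intro measurable_completion) simp
        have HI: "(\<integral>\<^sup>+y\<in>?Q. H y \<partial>lebesgue) \<le> ennreal (C2 * r ^ ?n * Z powr q)"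
          using H(3) by (simp add: nn_integral_completion)
        have gG: "AE y in lebesgue. y \<in> ?Q \<longrightarrow> ennreal (\<bar>f y - mollify f y r\<bar> powr q) \<le> H y"
          using lim H(2) by (auto elim: eventually_mono)
        have "(\<integral>\<^sup>+h\<in>cball 0 r. ennreal (\<bar>fdiff k h f x\<bar> powr q) \<partial>lebesgue)
          \<le> ennreal ((real k + 1) powr q * (C3 * Z) powr q * (2 * r) ^ ?n + real k * (((real k + 1) * 2 ^ k) powr q * (C2 * r ^ ?n * Z powr q)))"
          using C2 C3 Z r
          by (intro fdiff_powr_integral_le[where g = "\<lambda>y. \<bar>f y - mollify f y r\<bar>", OF q r _ _ Hm _ _ gG HI]) (use pt in auto)
        also have "(real k + 1) powr q * (C3 * Z) powr q * (2 * r) ^ ?n + real k * (((real k + 1) * 2 ^ k) powr q * (C2 * r ^ ?n * Z powr q))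
          = (C - 1) * r ^ ?n * Z powr q"
          using C3 Z by (simp add: C_def powr_mult power_mult_distrib algebra_simps)
        also have "ennreal ((C - 1) * r ^ ?n * Z powr q) \<le> ennreal (C * r ^ ?n * Z powr q)"
          using r by (intro ennreal_leI mult_right_mono) auto
        finally show "(\<integral>\<^sup>+h\<in>cball 0 r. ennreal (\<bar>fdiff k h f x\<bar> powr q) \<partial>lebesgue)
          \<le> ennreal (C * r ^ ?n * (A powr (1 - \<theta>) * (r ^ k * B) powr \<theta>) powr q)"
          unfolding Z_def .
      qed
    qed
  qed
  then show ?thesis using C by blast
qed

text \<open>If one of the two maximal functions vanishes, the bound \<open>C A\<^sup>1\<^sup>-\<^sup>s B\<^sup>s\<close> is zero even if the other one
  is infinite; this case is therefore not a limit of the finite estimates.\<close>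

lemma fdiff_eq_zero_ae:
  fixes f :: "real^'n::finite \<Rightarrow> real"
  assumes k: "1 \<le> k" and p: "1 \<le> p1" "1 \<le> p2" and f: "f \<in> Sobolev1_loc k"
  shows "AE x in lebesgue. sharp_maxfun p1 f x = 0 \<or> maxfun p2 (norm_nabla k f) x = 0 \<longrightarrow>
    (AE h in lebesgue. fdiff k h f x = 0)"
proof -
  note fL = Sobolev1_locD(1)[OF f]
  note [measurable] = Sobolev1_locD(2,3)[OF f]
  note lim = mollify_tendsto_ae[OF fL]
  show ?thesis
    using lim
  proof (eventually_elim, intro impI)
    fix x assume x: "((\<lambda>r. mollify f x r) \<longlongrightarrow> f x) (at_right 0)"
      and z: "sharp_maxfun p1 f x = 0 \<or> maxfun p2 (norm_nabla k f) x = 0"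
    \<comment> \<open>With h and r fixed, the majorant of the vanishing maximal function is sent to
      0, so the constants may depend on h and r. Only one of the two bounds is used in each case;
      the other maximal function may be infinite.\<close>
    have zero: "fdiff k h (\<lambda>y. mollify f y r) x = 0" if r: "0 < r" for h r
    proof -
      define R where "R = real k * norm h + r"
      let ?S = "corner_cube (x - (\<chi> i. R)) (2 * R)"
      have R: "0 < R" using r by (simp add: R_def add_nonneg_pos)
      have sub: "corner_cube (x + t *\<^sub>R h) r \<subseteq> ?S" if t: "0 \<le> t" "t \<le> real k" for t
      proof (rule corner_cube_subset)
        fix i
        have "\<bar>t * h $ i\<bar> \<le> real k * norm h"
          unfolding abs_mult using t component_le_norm_cart by (intro mult_mono) auto
        then have "t * h $ i \<le> real k * norm h" "- (real k * norm h) \<le> t * h $ i" by linarith+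
        then show "(x - (\<chi> i. R)) $ i \<le> (x + t *\<^sub>R h) $ i" "(x + t *\<^sub>R h) $ i + r \<le> (x - (\<chi> i. R)) $ i + 2 * R"
          using r by (simp_all add: R_def)
      qed
      have xS: "x \<in> ?S" using R by (simp add: mem_box_cart)
      have S: "?S \<in> {Q\<in>cubes. x \<in> Q}" using corner_cube_in_cubes[of "2 * R"] R xS by auto
      have small: "(\<integral>\<^sup>+w\<in>?S. ennreal \<bar>g w\<bar> \<partial>lebesgue) \<le> ennreal (2 * A * (2 * R) ^ CARD('n))"
        if le: "avg_pow p ?S g \<le> ennreal (A powr p)" and g: "g \<in> borel_measurable lebesgue" and A: "0 < A" and p: "1 \<le> p" for g A p
      proof -
        have "(\<integral>\<^sup>+w\<in>?S. ennreal ((\<bar>g w\<bar> / A) powr p) \<partial>lebesgue) \<le> ennreal ((2 * R) ^ CARD('n) * 1)"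
          using avg_pow_corner_cube_le[OF g _ A le] R by simp
        from nn_set_integral_le_powr[OF g _ emeasure_corner_cube _ p A _ this] R show ?thesis by simp
      qed
      show ?thesis
      proof (rule ccontr)
        assume nz: "fdiff k h (\<lambda>y. mollify f y r) x \<noteq> 0"
        let ?D = "\<bar>fdiff k h (\<lambda>y. mollify f y r) x\<bar>"
        have bound: "\<exists>K\<ge>0. \<forall>A>0. ?D \<le> K * A"
          using z
        proof
          assume "sharp_maxfun p1 f x = 0"
          define K where "K = 2 ^ k * M ^ CARD('n) / r ^ CARD('n) * (2 * (2 * R) ^ CARD('n))"
          have "?D \<le> K * A" if A: "0 < A" for A
          proof -
            have "(INF c. avg_pow p1 ?S (\<lambda>y. f y - c)) powe (1 / p1) \<le> sharp_maxfun p1 f x"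
              unfolding sharp_maxfun_def by (rule SUP_upper[OF S])
            also have "\<dots> < ennreal A" using \<open>sharp_maxfun p1 f x = 0\<close> A by simp
            finally have "(INF c. avg_pow p1 ?S (\<lambda>y. f y - c)) < ennreal (A powr p1)"
              using p by (intro powe_less_imp) auto
            then obtain c where c: "avg_pow p1 ?S (\<lambda>y. f y - c) \<le> ennreal (A powr p1)"
              unfolding INF_less_iff by (blast intro: less_imp_le)
            have "ennreal ?D \<le> ennreal (2 ^ k * M ^ CARD('n) / r ^ CARD('n)) * ennreal (2 * A * (2 * R) ^ CARD('n))"
              by (rule order_trans[OF fdiff_mollify_const[OF fL r k sub, where c = c] mult_left_mono[OF small[OF c _ A p(1)]]]) simp_all
            also have "\<dots> = ennreal (K * A)"
              unfolding K_def using r R A M_nonneg by (subst ennreal_mult[symmetric]) (auto simp: mult_ac)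
            finally show ?thesis using r R A M_nonneg by (subst (asm) ennreal_le_iff) (auto simp: K_def)
          qed
          moreover have "0 \<le> K" using r R M_nonneg by (simp add: K_def)
          ultimately show ?thesis by blast
        next
          assume "maxfun p2 (norm_nabla k f) x = 0"
          define K where "K = (real CARD('n) * norm h) ^ k * M ^ CARD('n) / r ^ CARD('n) * (2 * (2 * R) ^ CARD('n))"
          have "?D \<le> K * A" if A: "0 < A" for A
          proof -
            have "avg_pow p2 ?S (norm_nabla k f) powe (1 / p2) \<le> maxfun p2 (norm_nabla k f) x"
              unfolding maxfun_def by (rule SUP_upper[OF S])
            also have "\<dots> \<le> ennreal A" using \<open>maxfun p2 (norm_nabla k f) x = 0\<close> by simp
            finally have "avg_pow p2 ?S (norm_nabla k f) \<le> ennreal (A powr p2)"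
              using p A by (intro powe_le_imp) auto
            from small[OF this _ A p(2)]
            have N: "(\<integral>\<^sup>+w\<in>?S. ennreal (norm_nabla k f w) \<partial>lebesgue) \<le> ennreal (2 * A * (2 * R) ^ CARD('n))"
              by (simp add: norm_nabla_nonneg)
            have "ennreal ?D \<le> ennreal ((real CARD('n) * norm h) ^ k * M ^ CARD('n) / r ^ CARD('n)) * ennreal (2 * A * (2 * R) ^ CARD('n))"
              by (rule order_trans[OF fdiff_mollify_nabla[OF f r sub] mult_left_mono[OF N]]) (use N in \<open>auto intro: le_less_trans\<close>)
            also have "\<dots> = ennreal (K * A)"
              unfolding K_def using r R A M_nonneg by (subst ennreal_mult[symmetric]) (auto simp: mult_ac)
            finally show ?thesis using r R A M_nonneg by (subst (asm) ennreal_le_iff) (auto simp: K_def)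
          qed
          moreover have "0 \<le> K" using r R M_nonneg by (simp add: K_def)
          ultimately show ?thesis by blast
        qed
        then obtain K where K: "0 \<le> K" "\<And>A. 0 < A \<Longrightarrow> ?D \<le> K * A" by blast
        have "K * (?D / (K + 1)) < ?D" using K(1) nz by (simp add: field_simps)
        moreover have "0 < ?D / (K + 1)" using K(1) nz by (simp add: divide_pos_pos)
        ultimately show False using K(2)[of "?D / (K + 1)"] by linarith
      qed
    qed
    \<comment> \<open>For almost every h all the points x + j h are points of convergence, and r
      tending to 0 transfers the vanishing from the mollifications to \<open>f\<close>.\<close>
    have "AE h in lebesgue. \<forall>j\<in>{1..k}. ((\<lambda>r. mollify f (x + real j *\<^sub>R h) r) \<longlongrightarrow> f (x + real j *\<^sub>R h)) (at_right 0)"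
      by (intro AE_finite_allI AE_affine[OF lim]) auto
    then show "AE h in lebesgue. fdiff k h f x = 0"
    proof eventually_elim
      case (elim h)
      have "((\<lambda>r. fdiff k h (\<lambda>y. mollify f y r) x) \<longlongrightarrow> fdiff k h f x) (at_right 0)"
        unfolding fdiff_def
      proof (intro tendsto_sum tendsto_mult tendsto_const)
        fix j assume "j \<in> {0..k}"
        then show "((\<lambda>r. mollify f (x + real j *\<^sub>R h) r) \<longlongrightarrow> f (x + real j *\<^sub>R h)) (at_right 0)"
          using elim x by (cases "j = 0") auto
      qed
      moreover have "((\<lambda>r. fdiff k h (\<lambda>y. mollify f y r) x) \<longlongrightarrow> 0) (at_right 0)"
        by (rule tendsto_eventually) (use zero in \<open>auto simp: eventually_at_right_field intro!: exI[of _ 1]\<close>)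
      ultimately show ?case using tendsto_unique[OF _] by (metis trivial_limit_at_right_real)
    qed
  qed
qed

end

section \<open>Dyadic summation\<close>

text \<open>The source of the factors s - s0 and s0' - s. With y = m d ln 2, the inequality exp(y)
  >= 1 + y bounds the sum of the geometric series by (1 + y) / y, and d <= 1 bounds the numerator by
  1 + m.\<close>

lemma inverse_one_minus_two_powr_le:
  fixes d m :: real
  assumes "0 < d" "d \<le> 1" "0 < m"
  shows "1 / (1 - 2 powr (- (m * d))) \<le> (1 + m) / (m * ln 2) / d"
proof -
  define y where "y = m * d * ln 2"
  have y: "0 < y" using assms by (simp add: y_def)
  have "2 powr (- (m * d)) = exp (- y)" by (simp add: powr_def y_def mult.assoc)
  also have "\<dots> \<le> 1 / (1 + y)"
    using exp_ge_add_one_self[of y] y by (simp add: exp_minus divide_simps)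
  also have "\<dots> = 1 - y / (1 + y)" using y by (simp add: field_simps)
  finally have le: "y / (1 + y) \<le> 1 - 2 powr (- (m * d))" by simp
  have pos: "0 < y / (1 + y)" using y by simp
  have "1 / (1 - 2 powr (- (m * d))) \<le> 1 / (y / (1 + y))"
    by (rule divide_left_mono[OF le _ mult_pos_pos[OF less_le_trans[OF pos le] pos]]) simp
  also have "\<dots> = (1 + y) / y" by simp
  also have "\<dots> \<le> (1 + m) / y"
  proof -
    have "d * ln 2 \<le> 1 * 1" using assms ln_2_less_1 by (intro mult_mono) auto
    then have "m * (d * ln 2) \<le> m * 1" using assms by (intro mult_left_mono) auto
    then show ?thesis using y by (intro divide_right_mono) (auto simp: y_def mult.assoc)
  qed
  also have "\<dots> = (1 + m) / (m * ln 2) / d" by (simp add: y_def mult_ac)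
  finally show ?thesis .
qed

text \<open>In either case the least index satisfying one inequality is taken, and its minimality
  gives the other one.\<close>

lemma dyadic_annulus_exists:
  fixes R t :: real
  assumes "0 < R" "0 < t"
  shows "(\<exists>j. R / 2 ^ j / 2 < t \<and> t \<le> R / 2 ^ j) \<or> (\<exists>j. R * 2 ^ Suc j / 2 < t \<and> t \<le> R * 2 ^ Suc j)"
proof (cases "t \<le> R")
  case True
  have "(\<lambda>j. R / 2 ^ j) \<longlonglongrightarrow> 0" by (rule LIMSEQ_divide_realpow_zero) simp
  then have "\<forall>\<^sub>F j in sequentially. R / 2 ^ j < t" using assms(2) by (rule order_tendstoD)
  then obtain m where "R / 2 ^ m < t" by (auto simp: eventually_sequentially)
  then have "\<exists>m. R / 2 ^ m / 2 < t" using assms by (intro exI[of _ m]) (auto intro: le_less_trans[rotated])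
  then have L: "R / 2 ^ (LEAST m. R / 2 ^ m / 2 < t) / 2 < t" by (rule LeastI_ex)
  define j where "j = (LEAST m. R / 2 ^ m / 2 < t)"
  have "t \<le> R / 2 ^ j"
  proof (cases j)
    case (Suc i)
    then have "\<not> R / 2 ^ i / 2 < t" using not_less_Least[of i "\<lambda>m. R / 2 ^ m / 2 < t"] unfolding j_def by simp
    then show ?thesis by (simp add: Suc mult.commute)
  qed (use True in simp)
  then show ?thesis using L unfolding j_def by blast
next
  case False
  obtain m where "t / R < 2 ^ m" using real_arch_pow[of 2 "t / R"] by auto
  then have "\<exists>m. t \<le> R * 2 ^ Suc m" using assms
    by (intro exI[of _ m]) (simp add: divide_less_eq mult.commute)
  then have L: "t \<le> R * 2 ^ Suc (LEAST m. t \<le> R * 2 ^ Suc m)" by (rule LeastI_ex)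
  define j where "j = (LEAST m. t \<le> R * 2 ^ Suc m)"
  have "R * 2 ^ Suc j / 2 < t"
  proof (cases j)
    case (Suc i)
    then have "\<not> t \<le> R * 2 ^ Suc i" using not_less_Least[of i "\<lambda>m. t \<le> R * 2 ^ Suc m"] unfolding j_def by simp
    then show ?thesis by (simp add: Suc)
  qed (use False in simp)
  then show ?thesis using L unfolding j_def by blast
qed

text \<open>An annulus of outer radius R t contributes a multiple of t^(k q (\<theta> - s)). This is
  summable over t = 2^(-j) for \<theta> = \<theta>1 > s and over t = 2^j for \<theta> = \<theta>0 <
  s.\<close>

lemma dyadic_integral_le:
  fixes \<phi> :: "real^'n::finite \<Rightarrow> real" and k :: nat and q s \<theta>0 \<theta>1 A B C :: real
  defines "K \<equiv> C * 2 powr (real CARD('n) + real k * q) * ((1 + real k * q) / (real k * q * ln 2))"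
  assumes \<phi>[measurable]: "\<phi> \<in> borel_measurable lebesgue" and k: "1 \<le> k" and q: "1 \<le> q"
    and s: "0 \<le> \<theta>0" "\<theta>0 < s" "s < \<theta>1" "\<theta>1 \<le> 1" and AB: "0 < A" "0 < B" and C: "0 \<le> C"
    and H: "\<And>r \<theta>. 0 < r \<Longrightarrow> \<theta> \<in> {\<theta>0, \<theta>1} \<Longrightarrow> (\<integral>\<^sup>+h\<in>cball 0 r. ennreal (\<bar>\<phi> h\<bar> powr q) \<partial>lebesgue)
      \<le> ennreal (C * r ^ CARD('n) * (A powr (1 - \<theta>) * (r ^ k * B) powr \<theta>) powr q)"
  shows "(\<integral>\<^sup>+h. ennreal (\<bar>\<phi> h\<bar> powr q / norm h powr (real CARD('n) + s * real k * q)) \<partial>lebesgue)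
    \<le> ennreal (K / ((s - \<theta>0) * (\<theta>1 - s)) * (A powr (1 - s) * B powr s) powr q)"
proof -
  let ?n = "CARD('n)" and ?N = "real CARD('n) + s * real k * q"
  let ?F = "\<lambda>h. ennreal (\<bar>\<phi> h\<bar> powr q / norm h powr ?N)"
  \<comment> \<open>The radius with R^k B = A, where A^(1 - \<theta>) (R^k B)^\<theta> = A for every
    \<theta>, so that both estimates coincide.\<close>
  define R where "R = (A / B) powr (1 / real k)"
  define Y where "Y = (A powr (1 - s) * B powr s) powr q"
  \<comment> \<open>The power of 2 pays for replacing |h| by half the outer radius, uniformly in s
    <= 1.\<close>
  define C' where "C' = C * 2 powr (real ?n + real k * q)"
  have R: "0 < R" using AB by (simp add: R_def)
  have Rk: "R ^ k * B = A" using AB k by (simp add: R_def powr_powr flip: powr_realpow)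
  have C': "0 \<le> C'" using C by (simp add: C'_def)
  have N0: "0 \<le> ?N" using s q by simp
  have kq: "0 < real k * q" using k q by simp
  have RY: "R powr (- (s * real k * q)) * A powr q = Y"
  proof -
    have "R powr (- (s * real k * q)) = (A / B) powr (- (s * q))" using k by (simp add: R_def powr_powr)
    also have "\<dots> * A powr q = A powr ((1 - s) * q) * B powr (s * q)"
      using AB by (simp add: powr_divide powr_minus left_diff_distrib powr_diff divide_simps)
    finally show ?thesis using AB by (simp add: Y_def powr_mult powr_powr)
  qed
  have ann: "(\<integral>\<^sup>+h\<in>{h. R * t / 2 < norm h \<and> norm h \<le> R * t}. ?F h \<partial>lebesgue) \<le> ennreal (C' * Y * t powr (real k * q * (\<theta> - s)))"
    if t: "0 < t" and \<theta>: "\<theta> \<in> {\<theta>0, \<theta>1}" for t \<theta>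
  proof -
    let ?r = "R * t"
    have r: "0 < ?r" using R t by simp
    have pt: "?F h * indicator {h. ?r / 2 < norm h \<and> norm h \<le> ?r} h
        \<le> ennreal ((?r / 2) powr (- ?N)) * (ennreal (\<bar>\<phi> h\<bar> powr q) * indicator (cball 0 ?r) h)" for h
    proof (cases "?r / 2 < norm h \<and> norm h \<le> ?r")
      case True
      have "norm h powr (- ?N) \<le> (?r / 2) powr (- ?N)"
        using True r N0 by (intro powr_mono2') auto
      then have "norm h powr (- ?N) * \<bar>\<phi> h\<bar> powr q \<le> (?r / 2) powr (- ?N) * \<bar>\<phi> h\<bar> powr q"
        by (rule mult_right_mono) simp
      moreover have "\<bar>\<phi> h\<bar> powr q / norm h powr ?N = norm h powr (- ?N) * \<bar>\<phi> h\<bar> powr q"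
        by (simp only: powr_minus divide_inverse mult.commute)
      ultimately have "?F h \<le> ennreal ((?r / 2) powr (- ?N) * \<bar>\<phi> h\<bar> powr q)" by (simp only: ennreal_leI)
      also have "\<dots> = ennreal ((?r / 2) powr (- ?N)) * ennreal (\<bar>\<phi> h\<bar> powr q)" by (rule ennreal_mult) auto
      finally have "?F h \<le> ennreal ((?r / 2) powr (- ?N)) * ennreal (\<bar>\<phi> h\<bar> powr q)" .
      moreover have "h \<in> cball 0 ?r" "h \<in> {h. ?r / 2 < norm h \<and> norm h \<le> ?r}" using True by auto
      ultimately show ?thesis by (simp only: indicator_simps mult_1_right)
    qed (auto simp: indicator_def)
    have "(\<integral>\<^sup>+h\<in>{h. ?r / 2 < norm h \<and> norm h \<le> ?r}. ?F h \<partial>lebesgue)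
        \<le> (\<integral>\<^sup>+h. ennreal ((?r / 2) powr (- ?N)) * (ennreal (\<bar>\<phi> h\<bar> powr q) * indicator (cball 0 ?r) h) \<partial>lebesgue)"
      by (intro nn_integral_mono pt)
    also have "\<dots> = ennreal ((?r / 2) powr (- ?N)) * (\<integral>\<^sup>+h\<in>cball 0 ?r. ennreal (\<bar>\<phi> h\<bar> powr q) \<partial>lebesgue)"
    proof (rule nn_integral_cmult)
      have "cball (0 :: real^'n) ?r \<in> sets lebesgue" by simp
      then show "(\<lambda>h. ennreal (\<bar>\<phi> h\<bar> powr q) * indicator (cball 0 ?r) h) \<in> borel_measurable lebesgue"
        by (intro borel_measurable_times_ennreal borel_measurable_indicator) (use \<phi> in measurable)
    qed
    also have "\<dots> \<le> ennreal ((?r / 2) powr (- ?N)) * ennreal (C * ?r ^ ?n * (A powr (1 - \<theta>) * (?r ^ k * B) powr \<theta>) powr q)"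
      by (intro mult_left_mono H r \<theta>) simp
    also have "\<dots> = ennreal ((?r / 2) powr (- ?N) * (C * ?r ^ ?n * (A powr (1 - \<theta>) * (?r ^ k * B) powr \<theta>) powr q))"
      by (rule ennreal_mult'[symmetric]) simp
    also have "\<dots> \<le> ennreal (C' * Y * t powr (real k * q * (\<theta> - s)))"
    proof (rule ennreal_leI)
      have "?r ^ k * B = A * t ^ k" unfolding power_mult_distrib using Rk by (simp add: mult_ac)
      then have "A powr (1 - \<theta>) * (?r ^ k * B) powr \<theta> = A * t powr (real k * \<theta>)"
        using AB t by (simp add: powr_mult powr_powr powr_diff flip: powr_realpow)
      then have Z: "(A powr (1 - \<theta>) * (?r ^ k * B) powr \<theta>) powr q = A powr q * t powr (real k * \<theta> * q)"
        using AB t by (simp add: powr_mult powr_powr)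
      have "(?r / 2) powr (- ?N) = ?r powr (- ?N) / 2 powr (- ?N)" by (rule powr_divide)
      moreover have "X / 2 powr (- ?N) = 2 powr ?N * X" for X :: real
        by (subst powr_minus) (simp add: divide_inverse mult.commute)
      ultimately have "(?r / 2) powr (- ?N) = 2 powr ?N * ?r powr (- ?N)" by (simp only:)
      moreover have "?r ^ ?n = ?r powr real ?n" using r by (simp only: powr_realpow)
      ultimately have "(?r / 2) powr (- ?N) * ?r ^ ?n = 2 powr ?N * (?r powr (- ?N) * ?r powr real ?n)"
        by (simp only: mult.assoc)
      also have "?r powr (- ?N) * ?r powr real ?n = ?r powr (- (s * real k * q))"
        by (simp flip: powr_add)
      also have "\<dots> = R powr (- (s * real k * q)) * t powr (- (s * real k * q))"
        using R t by (simp add: powr_mult)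
      finally have "(?r / 2) powr (- ?N) * (C * ?r ^ ?n * (A powr q * t powr (real k * \<theta> * q)))
          = C * 2 powr ?N * (R powr (- (s * real k * q)) * A powr q) * (t powr (- (s * real k * q)) * t powr (real k * \<theta> * q))"
        by (simp add: mult_ac)
      also have "t powr (- (s * real k * q)) * t powr (real k * \<theta> * q) = t powr (real k * q * (\<theta> - s))"
        by (simp add: algebra_simps flip: powr_add)
      also have "C * 2 powr ?N * (R powr (- (s * real k * q)) * A powr q) * t powr (real k * q * (\<theta> - s)) \<le> C' * Y * t powr (real k * q * (\<theta> - s))"
      proof -
        have "s * real k * q \<le> 1 * (real k * q)" unfolding mult.assoc using s kq by (intro mult_right_mono) auto
        then have "2 powr ?N \<le> (2 :: real) powr (real ?n + real k * q)" by (intro powr_mono) auto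
        then show ?thesis unfolding RY C'_def using C by (intro mult_right_mono mult_left_mono) (auto simp: Y_def)
      qed
      finally show "(?r / 2) powr (- ?N) * (C * ?r ^ ?n * (A powr (1 - \<theta>) * (?r ^ k * B) powr \<theta>) powr q)
          \<le> C' * Y * t powr (real k * q * (\<theta> - s))" unfolding Z .
    qed
    finally show ?thesis .
  qed
  define S1 where "S1 j = {h :: real^'n. R / 2 ^ j / 2 < norm h \<and> norm h \<le> R / 2 ^ j}" for j
  \<comment> \<open>With \<open>Suc j\<close> this family starts at the annulus from R to 2 R,
    adjacent to the first annulus of \<open>S1\<close>, from R / 2 to R.\<close>
  define S2 where "S2 j = {h :: real^'n. R * 2 ^ Suc j / 2 < norm h \<and> norm h \<le> R * 2 ^ Suc j}" for j
  have S_sets: "S1 j \<in> sets lebesgue" "S2 j \<in> sets lebesgue" for j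
  proof -
    have "S1 j \<in> sets borel" unfolding S1_def by measurable
    then show "S1 j \<in> sets lebesgue" by simp
    have "S2 j \<in> sets borel" unfolding S2_def by measurable
    then show "S2 j \<in> sets lebesgue" by simp
  qed
  have n_meas: "norm \<in> borel_measurable (lebesgue :: (real^'n) measure)"
    by (intro measurable_completion) simp
  have F_meas: "?F \<in> borel_measurable lebesgue" using n_meas \<phi> by measurable
  have S_meas: "(\<lambda>h. ?F h * indicator (S1 j) h) \<in> borel_measurable lebesgue" "(\<lambda>h. ?F h * indicator (S2 j) h) \<in> borel_measurable lebesgue" for j
    by (intro borel_measurable_times_ennreal F_meas borel_measurable_indicator S_sets)+
  have geo: "(\<Sum>j. ennreal (C' * Y * (2 powr (- (real k * q * d))) ^ j)) \<le> ennreal (C' * Y * ((1 + real k * q) / (real k * q * ln 2) / d))"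
    if d: "0 < d" "d \<le> 1" for d
  proof -
    let ?x = "2 powr (- (real k * q * d)) :: real"
    have x: "0 \<le> ?x" "?x < 1" using kq d powr_less_mono[of "- (real k * q * d)" 0 2] by auto
    have CY: "0 \<le> C' * Y" using C' by (simp add: Y_def)
    have "(\<lambda>j. C' * Y * ?x ^ j) sums (C' * Y * (1 / (1 - ?x)))"
      using x by (intro sums_mult geometric_sums) auto
    then have "(\<Sum>j. ennreal (C' * Y * ?x ^ j)) = ennreal (C' * Y * (1 / (1 - ?x)))"
      using CY x by (intro suminf_ennreal_eq) auto
    also have "\<dots> \<le> ennreal (C' * Y * ((1 + real k * q) / (real k * q * ln 2) / d))"
      by (intro ennreal_leI mult_left_mono inverse_one_minus_two_powr_le d kq CY)
    finally show ?thesis .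
  qed
  have "?F h \<le> (\<Sum>j. ?F h * indicator (S1 j) h) + (\<Sum>j. ?F h * indicator (S2 j) h)" for h
  proof (cases "h = 0")
    case False
    have le: "?F h \<le> (\<Sum>j. ?F h * indicator (S j) h)" if "h \<in> S i" for S :: "nat \<Rightarrow> (real^'n) set" and i
    proof -
      have "?F h = (\<Sum>j\<in>{i}. ?F h * indicator (S j) h)" using that by simp
      also have "\<dots> \<le> (\<Sum>j. ?F h * indicator (S j) h)" by (rule sum_le_suminf) auto
      finally show ?thesis .
    qed
    from dyadic_annulus_exists[OF R, of "norm h"] False
    consider i where "h \<in> S1 i" | i where "h \<in> S2 i" by (auto simp: S1_def S2_def)
    then show ?thesis
      using le[of S1] le[of S2] by cases (auto intro: add_increasing2 add_increasing)
  qed simp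
  then have "(\<integral>\<^sup>+h. ?F h \<partial>lebesgue) \<le> (\<integral>\<^sup>+h. (\<Sum>j. ?F h * indicator (S1 j) h) + (\<Sum>j. ?F h * indicator (S2 j) h) \<partial>lebesgue)"
    by (rule nn_integral_mono)
  also have "\<dots> = (\<integral>\<^sup>+h. (\<Sum>j. ?F h * indicator (S1 j) h) \<partial>lebesgue) + (\<integral>\<^sup>+h. (\<Sum>j. ?F h * indicator (S2 j) h) \<partial>lebesgue)"
    by (intro nn_integral_add borel_measurable_suminf_order S_meas)
  also have "\<dots> = (\<Sum>j. \<integral>\<^sup>+h\<in>S1 j. ?F h \<partial>lebesgue) + (\<Sum>j. \<integral>\<^sup>+h\<in>S2 j. ?F h \<partial>lebesgue)"
    unfolding nn_integral_suminf[OF S_meas(1)] nn_integral_suminf[OF S_meas(2)] ..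
  also have "\<dots> \<le> (\<Sum>j. ennreal (C' * Y * (2 powr (- (real k * q * (\<theta>1 - s)))) ^ j)) + (\<Sum>j. ennreal (C' * Y * (2 powr (- (real k * q * (s - \<theta>0)))) ^ j))"
  proof (intro add_mono suminf_le)
    fix j
    have "(2 powr (- (real k * q * (\<theta>1 - s)))) ^ j = (1 / 2 ^ j :: real) powr (real k * q * (\<theta>1 - s))"
      by (simp add: powr_power powr_divide powr_powr powr_minus_divide mult.commute flip: powr_realpow)
    then show "(\<integral>\<^sup>+h\<in>S1 j. ?F h \<partial>lebesgue) \<le> ennreal (C' * Y * (2 powr (- (real k * q * (\<theta>1 - s)))) ^ j)"
      using ann[of "1 / 2 ^ j" \<theta>1] by (simp add: S1_def)
    have "(2 ^ Suc j :: real) powr (real k * q * (\<theta>0 - s)) = (2 powr (- (real k * q * (s - \<theta>0)))) ^ Suc j"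
    proof -
      have "- (real k * q * (s - \<theta>0)) = real k * q * (\<theta>0 - s)" by (simp add: algebra_simps)
      then show ?thesis by (simp only: powr_power powr_powr mult.commute flip: powr_realpow[of 2 "Suc j", simplified])
    qed
    also have "\<dots> \<le> (2 powr (- (real k * q * (s - \<theta>0)))) ^ j"
    proof (rule power_decreasing)
      show "2 powr (- (real k * q * (s - \<theta>0))) \<le> (1 :: real)"
        using powr_mono[of "- (real k * q * (s - \<theta>0))" 0 2] kq s by simp
    qed auto
    finally have "C' * Y * (2 ^ Suc j) powr (real k * q * (\<theta>0 - s)) \<le> C' * Y * (2 powr (- (real k * q * (s - \<theta>0)))) ^ j"
      using C' by (intro mult_left_mono) (auto simp: Y_def)
    then show "(\<integral>\<^sup>+h\<in>S2 j. ?F h \<partial>lebesgue) \<le> ennreal (C' * Y * (2 powr (- (real k * q * (s - \<theta>0)))) ^ j)"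
      using ann[of "2 ^ Suc j" \<theta>0] unfolding S2_def by (auto intro: order_trans ennreal_leI)
  qed auto
  also have "\<dots> \<le> ennreal (C' * Y * ((1 + real k * q) / (real k * q * ln 2) / (\<theta>1 - s))) + ennreal (C' * Y * ((1 + real k * q) / (real k * q * ln 2) / (s - \<theta>0)))"
    using s by (intro add_mono geo) auto
  also have "\<dots> \<le> ennreal (K / ((s - \<theta>0) * (\<theta>1 - s)) * Y)"
  proof -
    define E where "E = C' * Y * ((1 + real k * q) / (real k * q * ln 2))"
    have E: "0 \<le> E" using C' kq by (simp add: E_def Y_def)
    have "ennreal (E / (\<theta>1 - s)) + ennreal (E / (s - \<theta>0)) = ennreal (E / (\<theta>1 - s) + E / (s - \<theta>0))"
      using E s by (intro ennreal_plus[symmetric]) auto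
    \<comment> \<open>The sum of the two reciprocals has numerator \<theta>1 - \<theta>0 <= 1, which
      yields the product (s - \<theta>0) (\<theta>1 - s) in the constant.\<close>
    also have "E / (\<theta>1 - s) + E / (s - \<theta>0) = E * (\<theta>1 - \<theta>0) / ((s - \<theta>0) * (\<theta>1 - s))"
      using s by (simp add: divide_simps) (simp add: algebra_simps)
    also have "ennreal \<dots> \<le> ennreal (E * 1 / ((s - \<theta>0) * (\<theta>1 - s)))"
      using E s by (intro ennreal_leI divide_right_mono mult_left_mono) auto
    also have "E * 1 / ((s - \<theta>0) * (\<theta>1 - s)) = K / ((s - \<theta>0) * (\<theta>1 - s)) * Y"
      by (simp add: E_def K_def C'_def mult_ac)
    finally show ?thesis by (simp add: E_def)
  qed
  finally show ?thesis unfolding Y_def .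
qed

section \<open>Passage to extended values and conclusion\<close>

lemma powe_mono: assumes "x \<le> y" "0 \<le> a" shows "x powe a \<le> y powe a"
proof (cases "y = top")
  case False
  then have "x \<noteq> top" using assms(1) top_unique by auto
  then show ?thesis using assms False
    by (auto simp: ennpow_def less_top intro!: ennreal_leI powr_mono2 enn2real_mono)
qed (simp add: ennpow_def)

lemma powe_ennreal: "0 \<le> t \<Longrightarrow> ennreal t powe a = ennreal (t powr a)"
  by (simp add: ennpow_def)

lemma powe_eq_0: "x \<noteq> 0 \<Longrightarrow> x powe a \<noteq> 0"
  by (cases x rule: ennreal_cases) (auto simp: ennpow_def)

lemma fdiff_measurable:
  assumes "f \<in> borel_measurable lebesgue"
  shows "(\<lambda>h. fdiff k h f x) \<in> borel_measurable (lebesgue :: (real^'n::finite) measure)"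
  unfolding fdiff_def
proof (intro borel_measurable_sum borel_measurable_times borel_measurable_const)
  fix j
  show "(\<lambda>h. f (x + real j *\<^sub>R h)) \<in> borel_measurable lebesgue"
    using measurable_compose[OF lebesgue_measurable_affine[of "real j" x] assms] by (cases "j = 0") auto
qed

text \<open>The cases reflect the product 0 times infinity being 0: if \<alpha> or \<beta> vanishes,
  the left side is 0 by the assumption \<open>zero\<close>; if one is infinite and the other is not
  0, the right side is infinite; otherwise both are positive reals and the dyadic summation
  applies.\<close>

lemma frakD_le:
  fixes f :: "real^'n::finite \<Rightarrow> real" and k :: nat and q s \<theta>0 \<theta>1 C :: real and \<alpha> \<beta> :: ennreal
  defines "K \<equiv> C * 2 powr (real CARD('n) + real k * q) * ((1 + real k * q) / (real k * q * ln 2))"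
  assumes f: "f \<in> borel_measurable lebesgue" and k: "1 \<le> k" and q: "1 \<le> q"
    and s: "0 \<le> \<theta>0" "\<theta>0 < s" "s < \<theta>1" "\<theta>1 \<le> 1" and C: "0 < C"
    and zero: "\<alpha> = 0 \<or> \<beta> = 0 \<Longrightarrow> AE h in lebesgue. fdiff k h f x = 0"
    and est: "ball_bound k q \<theta>0 C \<alpha> \<beta> f x" "ball_bound k q \<theta>1 C \<alpha> \<beta> f x"
  shows "frakD s k q f x \<le> ennreal (2 * K powr (1 / q) / ((s - \<theta>0) * (\<theta>1 - s)) powr (1 / q)) * \<alpha> powe (1 - s) * \<beta> powe s"
proof -
  have K: "0 < K" using C k q unfolding K_def by (intro mult_pos_pos divide_pos_pos) (auto simp: add_pos_nonneg)
  have d: "0 < (s - \<theta>0) * (\<theta>1 - s)" using s by simp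
  consider (zero) "\<alpha> = 0 \<or> \<beta> = 0" | (top) "\<alpha> \<noteq> 0" "\<beta> \<noteq> 0" "\<alpha> = top \<or> \<beta> = top"
    | (fin) A B where "\<alpha> = ennreal A" "\<beta> = ennreal B" "0 < A" "0 < B"
    by (cases \<alpha> rule: ennreal_cases; cases \<beta> rule: ennreal_cases) (auto simp: less_le)
  then show ?thesis
  proof cases
    case zero
    have "AE h in lebesgue. ennreal (\<bar>fdiff k h f x\<bar> powr q / norm h powr (real CARD('n) + s * real k * q)) = 0"
      using assms(10)[OF zero] by eventually_elim simp
    then have "(\<integral>\<^sup>+h. ennreal (\<bar>fdiff k h f x\<bar> powr q / norm h powr (real CARD('n) + s * real k * q)) \<partial>lebesgue) = 0"
      using nn_integral_cong_AE by fastforce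
    then show ?thesis by (simp add: frakD_def ennpow_def)
  next
    case top
    have "\<alpha> powe (1 - s) \<noteq> 0" "\<beta> powe s \<noteq> 0" using top powe_eq_0 by auto
    moreover have "\<alpha> powe (1 - s) = top \<or> \<beta> powe s = top" using top(3) by (auto simp: ennpow_def)
    moreover have "ennreal (2 * K powr (1 / q) / ((s - \<theta>0) * (\<theta>1 - s)) powr (1 / q)) \<noteq> 0" using K d s by simp
    ultimately have "ennreal (2 * K powr (1 / q) / ((s - \<theta>0) * (\<theta>1 - s)) powr (1 / q)) * \<alpha> powe (1 - s) * \<beta> powe s = top"
      by (auto simp: ennreal_mult_eq_top_iff)
    then show ?thesis by simp
  next
    case fin
    \<comment> \<open>\<open>ball_bound\<close> asks for a strict majorant of \<alpha>, hence 2 A;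
      since 2^(1 - s) <= 2, this accounts for the 2 in the constant.\<close>
    define Y where "Y = (2 * A) powr (1 - s) * B powr s"
    have Y: "0 \<le> Y" by (simp add: Y_def)
    have "\<alpha> < ennreal (2 * A)" using fin by (simp add: ennreal_less_iff)
    then have "(\<integral>\<^sup>+h. ennreal (\<bar>fdiff k h f x\<bar> powr q / norm h powr (real CARD('n) + s * real k * q)) \<partial>lebesgue)
        \<le> ennreal (K / ((s - \<theta>0) * (\<theta>1 - s)) * Y powr q)"
      unfolding K_def Y_def using fin C est[unfolded ball_bound_def]
      by (intro dyadic_integral_le fdiff_measurable f k q s) auto
    then have "frakD s k q f x \<le> ennreal (K / ((s - \<theta>0) * (\<theta>1 - s)) * Y powr q) powe (1 / q)"
      unfolding frakD_def using q by (intro powe_mono) auto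
    also have "\<dots> = ennreal (K powr (1 / q) / ((s - \<theta>0) * (\<theta>1 - s)) powr (1 / q) * Y)"
      using K d Y q by (simp add: powe_ennreal powr_mult powr_divide powr_powr)
    also have "\<dots> \<le> ennreal (2 * K powr (1 / q) / ((s - \<theta>0) * (\<theta>1 - s)) powr (1 / q) * (A powr (1 - s) * B powr s))"
    proof (rule ennreal_leI)
      have "2 powr (1 - s) \<le> 2 powr 1" using s by (intro powr_mono) auto
      then have "Y \<le> 2 * (A powr (1 - s) * B powr s)"
        using fin by (simp add: Y_def powr_mult mult_right_mono)
      then have "K powr (1 / q) / ((s - \<theta>0) * (\<theta>1 - s)) powr (1 / q) * Y
          \<le> K powr (1 / q) / ((s - \<theta>0) * (\<theta>1 - s)) powr (1 / q) * (2 * (A powr (1 - s) * B powr s))"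
        by (intro mult_left_mono) auto
      then show "K powr (1 / q) / ((s - \<theta>0) * (\<theta>1 - s)) powr (1 / q) * Y
          \<le> 2 * K powr (1 / q) / ((s - \<theta>0) * (\<theta>1 - s)) powr (1 / q) * (A powr (1 - s) * B powr s)"
        by (simp add: mult_ac)
    qed
    also have "\<dots> = ennreal (2 * K powr (1 / q) / ((s - \<theta>0) * (\<theta>1 - s)) powr (1 / q)) * (ennreal (A powr (1 - s)) * ennreal (B powr s))"
      by (subst ennreal_mult) (auto simp: ennreal_mult)
    also have "\<dots> = ennreal (2 * K powr (1 / q) / ((s - \<theta>0) * (\<theta>1 - s)) powr (1 / q)) * \<alpha> powe (1 - s) * \<beta> powe s"
      using fin by (simp add: powe_ennreal mult.assoc)
    finally show ?thesis .
  qed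
qed

lemma sharp_maxfun_le_maxfun:
  fixes f :: "real^'n::finite \<Rightarrow> real"
  assumes "1 \<le> p" shows "sharp_maxfun p f x \<le> maxfun p (\<lambda>y. f y - c) x"
  unfolding sharp_maxfun_def maxfun_def
  using assms by (intro SUP_mono' powe_mono INF_lower) auto

theorem theorem1p1:
  fixes k :: nat and p1 p2 q :: real
  assumes "k \<ge> 1" and "p1 \<ge> 1" and "p2 \<ge> 1" and "q \<ge> 1"
  shows
    "(\<forall>s0 s0' :: real.
        0 < s0 \<and> s0 < s0' \<and> s0' \<le> 1 \<and>
        real CARD('n::finite) * ((1 - s0) / p1 + s0 / p2 - 1 / q) < s0 * real k \<and>
        real CARD('n) * ((1 - s0') / p1 + s0' / p2 - 1 / q) < s0' * real k
        \<longrightarrow>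
        (\<exists>C>0. \<forall>s. s0 < s \<and> s < s0' \<longrightarrow>
          (\<forall>f :: real^'n \<Rightarrow> real. f \<in> Sobolev1_loc k \<longrightarrow>
            (AE x in lebesgue.
              frakD s k q f x
                \<le> ennreal (C / ((s - s0) * (s0' - s)) powr (1 / q))
                    * sharp_maxfun p1 f x powe (1 - s)
                    * maxfun p2 (norm_nabla k f) x powe s))))
     \<and>
     (p1 \<ge> q \<and> real CARD('n) * (1 / p2 - 1 / q) < real k
        \<longrightarrow>
        (\<exists>C>0. \<forall>s. 0 < s \<and> s < 1 \<longrightarrow>
          (\<forall>f :: real^'n \<Rightarrow> real. f \<in> Sobolev1_loc k \<longrightarrow>
            (AE x in lebesgue.
              frakD s k q f x
                \<le> ennreal (C / (s * (1 - s)) powr (1 / q))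
                    * maxfun p1 (\<lambda>y. f y - f x) x powe (1 - s)
                    * maxfun p2 (norm_nabla k f) x powe s))))"
proof -
  obtain a b M where "mollifier k a b M" using mollifier_locale_exists[OF assms(1)] by blast
  then interpret mollifier k a b M .
  let ?K = "\<lambda>C. C * 2 powr (real CARD('n) + real k * q) * ((1 + real k * q) / (real k * q * ln 2))"
  have K: "0 < ?K C" if "0 < C" for C
    using that assms(1,4) by (intro mult_pos_pos divide_pos_pos) (auto simp: add_pos_nonneg)
  note zero = fdiff_eq_zero_ae[OF assms(1,2,3)]
  note est = ball_estimate[OF assms(1,2,3,4)]
  show ?thesis
  proof (intro conjI allI impI; elim conjE)
    fix s0 s0' :: real
    assume s0: "0 < s0" "s0 < s0'" "s0' \<le> 1"
      and c0: "real CARD('n) * ((1 - s0) / p1 + s0 / p2 - 1 / q) < s0 * real k"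
      and c1: "real CARD('n) * ((1 - s0') / p1 + s0' / p2 - 1 / q) < s0' * real k"
    have s0'': "s0 \<le> 1" "0 < s0'" using s0 by auto
    obtain C0 where C0: "0 < C0" "\<And>f :: real^'n \<Rightarrow> real. f \<in> Sobolev1_loc k \<Longrightarrow>
        AE x in lebesgue. ball_bound k q s0 C0 (sharp_maxfun p1 f x) (maxfun p2 (norm_nabla k f) x) f x"
      using est[OF s0(1) s0''(1) c0] by blast
    obtain C1 where C1: "0 < C1" "\<And>f :: real^'n \<Rightarrow> real. f \<in> Sobolev1_loc k \<Longrightarrow>
        AE x in lebesgue. ball_bound k q s0' C1 (sharp_maxfun p1 f x) (maxfun p2 (norm_nabla k f) x) f x"
      using est[OF s0''(2) s0(3) c1] by blast
    \<comment> \<open>The two endpoint estimates are brought to the common constant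
      \<open>C0 + C1\<close>, since \<open>frakD_le\<close> takes one constant for both.\<close>
    have "AE x in lebesgue. frakD s k q f x
        \<le> ennreal (2 * ?K (C0 + C1) powr (1 / q) / ((s - s0) * (s0' - s)) powr (1 / q))
            * sharp_maxfun p1 f x powe (1 - s) * maxfun p2 (norm_nabla k f) x powe s"
      if s: "s0 < s \<and> s < s0'" and f: "f \<in> Sobolev1_loc k" for s and f :: "real^'n \<Rightarrow> real"
      using zero[OF f] C0(2)[OF f] C1(2)[OF f]
    proof eventually_elim
      case (elim x)
      show ?case
        by (rule frakD_le[OF Sobolev1_locD(2)[OF f] assms(1,4)])
          (use s s0 C0(1) C1(1) elim in \<open>auto intro: ball_bound_mono\<close>)
    qed
    then show "\<exists>C>0. \<forall>s. s0 < s \<and> s < s0' \<longrightarrow> (\<forall>f :: real^'n \<Rightarrow> real. f \<in> Sobolev1_loc k \<longrightarrow>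
        (AE x in lebesgue. frakD s k q f x \<le> ennreal (C / ((s - s0) * (s0' - s)) powr (1 / q))
          * sharp_maxfun p1 f x powe (1 - s) * maxfun p2 (norm_nabla k f) x powe s))"
      using K[of "C0 + C1"] C0(1) C1(1) assms(1) by (intro exI[of _ "2 * ?K (C0 + C1) powr (1 / q)"]) auto
  next
    assume pq: "p1 \<ge> q" and c1: "real CARD('n) * (1 / p2 - 1 / q) < real k"
    \<comment> \<open>At \<theta> = 1 the exponent p1 drops out of the condition of
      \<open>ball_estimate\<close>, which becomes the hypothesis of (ii).\<close>
    have c1': "real CARD('n) * ((1 - 1) / p1 + 1 / p2 - 1 / q) < 1 * real k" using c1 by simp
    obtain C1 where C1: "0 < C1" "\<And>f :: real^'n \<Rightarrow> real. f \<in> Sobolev1_loc k \<Longrightarrow>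
        AE x in lebesgue. ball_bound k q 1 C1 (sharp_maxfun p1 f x) (maxfun p2 (norm_nabla k f) x) f x"
      using est[OF zero_less_one order_refl c1'] by blast
    define C0 where "C0 = real k * (((real k + 1) * 2 ^ k) powr q * (2 * (2 * real k) ^ CARD('n)))"
    have C0: "0 \<le> C0" by (simp add: C0_def)
    have "AE x in lebesgue. frakD s k q f x
        \<le> ennreal (2 * ?K (C0 + C1) powr (1 / q) / ((s - 0) * (1 - s)) powr (1 / q))
            * maxfun p1 (\<lambda>y. f y - f x) x powe (1 - s) * maxfun p2 (norm_nabla k f) x powe s"
      if s: "0 < s \<and> s < 1" and f: "f \<in> Sobolev1_loc k" for s and f :: "real^'n \<Rightarrow> real"
      using zero[OF f] C1(2)[OF f]
    proof eventually_elim
      case (elim x)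
      \<comment> \<open>This also transfers the degenerate case: if the maximal function of f - f(x)
        vanishes at x, so does the sharp one.\<close>
      have sharp: "sharp_maxfun p1 f x \<le> maxfun p1 (\<lambda>y. f y - f x) x"
        by (rule sharp_maxfun_le_maxfun[OF assms(2)])
      have "ball_bound k q 0 C0 (maxfun p1 (\<lambda>y. f y - f x) x) (maxfun p2 (norm_nabla k f) x) f x"
        unfolding ball_bound_def
      proof (intro allI impI)
        fix A B r :: real
        assume A: "0 < A" "0 < B" "0 < r" "maxfun p1 (\<lambda>y. f y - f x) x < ennreal A"
        show "(\<integral>\<^sup>+h\<in>cball 0 r. ennreal (\<bar>fdiff k h f x\<bar> powr q) \<partial>lebesgue)
            \<le> ennreal (C0 * r ^ CARD('n) * (A powr (1 - 0) * (r ^ k * B) powr 0) powr q)"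
          using ball_estimate_zero[OF Sobolev1_locD(2)[OF f] assms(1,4) pq A(3,1) less_imp_le[OF A(4)]] A(1-3)
          by (simp add: C0_def)
      qed
      then have bb: "ball_bound k q 0 (C0 + C1) (maxfun p1 (\<lambda>y. f y - f x) x) (maxfun p2 (norm_nabla k f) x) f x"
        by (rule ball_bound_mono) (use C1(1) in auto)
      have "ball_bound k q 1 (C0 + C1) (maxfun p1 (\<lambda>y. f y - f x) x) (maxfun p2 (norm_nabla k f) x) f x"
        by (rule ball_bound_mono[OF elim(2) _ sharp]) (use C0 in auto)
      with bb show ?case
        by (intro frakD_le[OF Sobolev1_locD(2)[OF f] assms(1,4)])
          (use s C0 C1(1) elim(1) sharp in auto)
    qed
    then show "\<exists>C>0. \<forall>s. 0 < s \<and> s < 1 \<longrightarrow> (\<forall>f :: real^'n \<Rightarrow> real. f \<in> Sobolev1_loc k \<longrightarrow>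
        (AE x in lebesgue. frakD s k q f x \<le> ennreal (C / (s * (1 - s)) powr (1 / q))
          * maxfun p1 (\<lambda>y. f y - f x) x powe (1 - s) * maxfun p2 (norm_nabla k f) x powe s))"
      using K[of "C0 + C1"] C0 C1(1) assms(1) by (intro exI[of _ "2 * ?K (C0 + C1) powr (1 / q)"]) auto
  qed
qed

end
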